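(* Let $\alpha,\beta\in(0,1)$, let $n_2\ge n_1\ge 4$ and $n=n_1+n_2$, and let $s\ge 4$ be the number of bins. Let $U_{n_1,n_2}$ be a homogeneity U-statistic with symmetric real-valued base function $g$ whose variance components $\psi_{Y,1},\psi_{Z,1},\psi_{YZ,2}$ are finite. Put $$\alpha^\star=\frac{\alpha}{2e}\Big(\frac{\beta}{3}\Big)^{1/\lfloor\alpha(B+1)\rfloor},\qquad \rho_{n_1n_2}=\frac{n_1(n_1-1)^2n_2(n_2-1)^2}{n^6},$$ $$\gamma_{n_1,n_2}=\sqrt{\frac{3-\beta}{\beta}\Big(\frac{4\psi_{Y,1}}{n_1}+\frac{4\psi_{Z,1}}{n_2}\Big)}+\sqrt{\frac{1-\alpha^\star}{\alpha^\star}\,\frac{(36n_1^2+36n_2^2+198n_1n_2)\,\psi_{YZ,2}}{\beta\,n_1(n_1-1)n_2(n_2-1)}},$$ $$\gamma_{n_1,n_2,s}=\gamma_{n_1,n_2}+\mathbf 1\{s<n\}\,\frac{\gamma_{n_1,n_2}+\sqrt{\frac{201s^2}{4n^2}\psi_{YZ,2}+\frac{12s}{n}\max(\psi_{Y,1},\psi_{Z,1})}}{\sqrt{s^3\,\frac{\beta\alpha^\star}{24(1-\alpha^\star)}\,\rho_{n_1n_2}}-1}.$$ If $$\mathbb E[U_{n_1,n_2}]\ge\gamma_{n_1,n_2,s},$$ then the cheap homogeneity test with $s$ bins, $B$ permutations and level $\alpha$ based on $U_{n_1,n_2}$ has power at least $1-\beta$.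
   Context: Data: $Y=(Y_i)_{i=1}^{n_1}$ is i.i.d. from a distribution $\mathbb P$ and, independently, $Z=(Z_j)_{j=1}^{n_2}$ is i.i.d. from $\mathbb Q$. The hypotheses are $\mathcal H_0:\mathbb P=\mathbb Q$ versus $\mathcal H_1:\mathbb P\ne\mathbb Q$. Write $[n]=\{1,\dots,n\}$ and $(p)_2=p(p-1)$. Homogeneity U-statistic: for a symmetric real-valued function $g$, let $h_{\mathrm{ho}}(y_1,y_2;z_1,z_2)=g(y_1,y_2)+g(z_1,z_2)-g(y_1,z_2)-g(y_2,z_1)$ and $$U_{n_1,n_2}=U(Y,Z)=\frac1{(n_1)_2(n_2)_2}\sum_{i_1\ne i_2\in[n_1]}\ \sum_{j_1\ne j_2\in[n_2]}h_{\mathrm{ho}}(Y_{i_1},Y_{i_2};Z_{j_1},Z_{j_2}).$$ Symmetrized kernel: $\bar h_{\mathrm{ho}}(y_1,y_2;z_1,z_2)=\frac1{2!\,2!}\sum_{(i_1,i_2)}\sum_{(j_1,j_2)}h_{\mathrm{ho}}(y_{i_1},y_{i_2};z_{j_1},z_{j_2})$, both sums over the two orderings of $\{1,2\}$. Variance components (with $Y_1,Y_2,Y_3\sim\mathbb P$, $Z_1,Z_2,Z_3\sim\mathbb Q$ all independent): $\psi_{Y,1}=\max\{\mathrm{Var}(\mathbb E[\bar h_{\mathrm{ho}}(Y_1,Y_2;Z_1,Z_2)\mid Y_1]),\ \mathrm{Var}(\mathbb E[\bar h_{\mathrm{ho}}(Z_3,Y_2;Z_1,Z_2)\mid Z_3])\}$,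 $\psi_{Z,1}=\max\{\mathrm{Var}(\mathbb E[\bar h_{\mathrm{ho}}(Y_1,Y_2;Z_1,Z_2)\mid Z_1]),\ \mathrm{Var}(\mathbb E[\bar h_{\mathrm{ho}}(Y_1,Y_2;Y_3,Z_2)\mid Y_3])\}$, $\psi_{YZ,2}=\max\{\mathbb E[g^2(Y_1,Y_2)],\mathbb E[g^2(Y_1,Z_1)],\mathbb E[g^2(Z_1,Z_2)]\}$. Cheap homogeneity test based on a statistic $T$: let $X=(X_i)_{i=1}^n=(Y_1,\dots,Y_{n_1},Z_1,\dots,Z_{n_2})$. Split $[n]$ into $s$ consecutive bins $\mathcal I_1,\dots,\mathcal I_s$ of equal size ($s$ divides $n$, and $s_1=s\,n_1/n$ is an integer, so every bin lies within one sample). For a permutation $\pi$ of $[s]$, let $Y^\pi$ be the points in bins $\mathcal I_{\pi(1)},\dots,\mathcal I_{\pi(s_1)}$ and $Z^\pi$ the points in bins $\mathcal I_{\pi(s_1+1)},\dots,\mathcal I_{\pi(s)}$. Draw $\pi_1,\dots,\pi_B$ i.i.d. uniform over permutations of $[s]$, independently of the data; set $T_0=T(Y,Z)$ and $T_b=T(Y^{\pi_b},Z^{\pi_b})$. Let $R=1+$ the number of $b\in[B]$ with $T_b$ smaller than $T_0$, ties being broken uniformly at random. The test rejects $\mathcal H_0$ with probability $\Delta(X)=\min(1,\max(0,R-(1-\alpha)(B+1)))$. Its power is $\mathbb E[\Delta(X)]$. For $s=n$ this is the standard permutation test. Here $T=U$ and the permutation count $B$ satisfies $B\ge\frac1\a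lpha-1$.
   Formalization: Assumes additionally ψ_{YZ,2}>0 (if g=0 a.s. all statistics tie and the power is only α) and, when s<n, that the denominator √(s³βα*ρ/(24(1−α* )))−1 is positive (otherwise the threshold is negative or undefined and the claim fails for P=Q). *)

theory Defs
  imports "HOL-Probability.Probability"
begin

section \<open>The homogeneity U-statistic\<close>

definition h_ho :: "('a \<Rightarrow> 'a \<Rightarrow> real) \<Rightarrow> 'a \<Rightarrow> 'a \<Rightarrow> 'a \<Rightarrow> 'a \<Rightarrow> real" where
  "h_ho g y1 y2 z1 z2 = g y1 y2 + g z1 z2 - g y1 z2 - g y2 z1"

definition h_ho_sym :: "('a \<Rightarrow> 'a \<Rightarrow> real) \<Rightarrow> 'a \<Rightarrow> 'a \<Rightarrow> 'a \<Rightarrow> 'a \<Rightarrow> real" where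
  "h_ho_sym g y1 y2 z1 z2 = 1 / (fact 2 * fact 2) *
     (h_ho g y1 y2 z1 z2 + h_ho g y1 y2 z2 z1 + h_ho g y2 y1 z1 z2 + h_ho g y2 y1 z2 z1)"

text \<open>Samples are sequences indexed from \<open>0\<close>; only the first \<open>n1\<close> entries of \<open>y\<close> and the
  first \<open>n2\<close> entries of \<open>z\<close> are used.\<close>

definition U_ho :: "nat \<Rightarrow> nat \<Rightarrow> ('a \<Rightarrow> 'a \<Rightarrow> real) \<Rightarrow> (nat \<Rightarrow> 'a) \<Rightarrow> (nat \<Rightarrow> 'a) \<Rightarrow> real" where
  "U_ho n1 n2 g y z =
     1 / ((real n1 * (real n1 - 1)) * (real n2 * (real n2 - 1))) *
     (\<Sum>i1\<in>{..<n1}. \<Sum>i2\<in>{..<n1} - {i1}. \<Sum>j1\<in>{..<n2}. \<Sum>j2\<in>{..<n2} - {j1}.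
        h_ho g (y i1) (y i2) (z j1) (z j2))"

section \<open>Data and variance components\<close>

text \<open>The law of the pooled sample \<open>X = (Y\<^sub>1, \<dots>, Y\<^sub>n\<^sub>1, Z\<^sub>1, \<dots>, Z\<^sub>n\<^sub>2)\<close>: the coordinates are
  independent, the first \<open>n1\<close> of them have law \<open>P\<close> and the other \<open>n2\<close> have law \<open>Q\<close>.\<close>

definition two_sample :: "'a measure \<Rightarrow> 'a measure \<Rightarrow> nat \<Rightarrow> nat \<Rightarrow> (nat \<Rightarrow> 'a) measure" where
  "two_sample P Q n1 n2 = (\<Pi>\<^sub>M i\<in>{..<n1 + n2}. if i < n1 then P else Q)"

text \<open>The variable \<open>f\<close> conditioned on the sigma-algebra generated by coordinate \<open>i\<close>, whose values
  lie in the measurable space of \<open>N\<close>; then the variance of the result.\<close>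

definition var_cond_exp ::
  "(nat \<Rightarrow> 'a) measure \<Rightarrow> 'a measure \<Rightarrow> nat \<Rightarrow> ((nat \<Rightarrow> 'a) \<Rightarrow> real) \<Rightarrow> real" where
  "var_cond_exp M N i f = prob_space.variance M
     (real_cond_exp M (vimage_algebra (space M) (\<lambda>w. w i) N) f)"

text \<open>In \<open>two_sample P Q 3 3\<close> the coordinates \<open>0, 1, 2, 3, 4, 5\<close> are the independent variables
  \<open>Y\<^sub>1, Y\<^sub>2, Y\<^sub>3, Z\<^sub>1, Z\<^sub>2, Z\<^sub>3\<close>.\<close>

definition psi_Y1 :: "'a measure \<Rightarrow> 'a measure \<Rightarrow> ('a \<Rightarrow> 'a \<Rightarrow> real) \<Rightarrow> real" where
  "psi_Y1 P Q g = max
     (var_cond_exp (two_sample P Q 3 3) P 0 (\<lambda>w. h_ho_sym g (w 0) (w 1) (w 3) (w 4)))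
     (var_cond_exp (two_sample P Q 3 3) Q 5 (\<lambda>w. h_ho_sym g (w 5) (w 1) (w 3) (w 4)))"

definition psi_Z1 :: "'a measure \<Rightarrow> 'a measure \<Rightarrow> ('a \<Rightarrow> 'a \<Rightarrow> real) \<Rightarrow> real" where
  "psi_Z1 P Q g = max
     (var_cond_exp (two_sample P Q 3 3) Q 3 (\<lambda>w. h_ho_sym g (w 0) (w 1) (w 3) (w 4)))
     (var_cond_exp (two_sample P Q 3 3) P 2 (\<lambda>w. h_ho_sym g (w 0) (w 1) (w 2) (w 4)))"

definition psi_YZ2 :: "'a measure \<Rightarrow> 'a measure \<Rightarrow> ('a \<Rightarrow> 'a \<Rightarrow> real) \<Rightarrow> real" where
  "psi_YZ2 P Q g = max (\<integral>w. (g (w 0) (w 1))\<^sup>2 \<partial>two_sample P Q 3 3)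
     (max (\<integral>w. (g (w 0) (w 3))\<^sup>2 \<partial>two_sample P Q 3 3)
          (\<integral>w. (g (w 3) (w 4))\<^sup>2 \<partial>two_sample P Q 3 3))"

text \<open>Finiteness of \<open>psi_YZ2\<close>. By Jensen's inequality it makes the other two components finite,
  because every \<open>h_ho_sym\<close> term above is a combination of values of \<open>g\<close> at such pairs.\<close>

definition finite_psi :: "'a measure \<Rightarrow> 'a measure \<Rightarrow> ('a \<Rightarrow> 'a \<Rightarrow> real) \<Rightarrow> bool" where
  "finite_psi P Q g \<longleftrightarrow>
     integrable (two_sample P Q 3 3) (\<lambda>w. (g (w 0) (w 1))\<^sup>2) \<and>
     integrable (two_sample P Q 3 3) (\<lambda>w. (g (w 0) (w 3))\<^sup>2) \<and>
     integrable (two_sample P Q 3 3) (\<lambda>w. (g (w 3) (w 4))\<^sup>2)"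

definition expected_U :: "'a measure \<Rightarrow> 'a measure \<Rightarrow> ('a \<Rightarrow> 'a \<Rightarrow> real) \<Rightarrow> nat \<Rightarrow> nat \<Rightarrow> real" where
  "expected_U P Q g n1 n2 =
     (\<integral>x. U_ho n1 n2 g x (\<lambda>j. x (n1 + j)) \<partial>two_sample P Q n1 n2)"

section \<open>The cheap permutation test\<close>

text \<open>Bin \<open>a < s\<close> consists of the positions \<open>a * m, \<dots>, a * m + m - 1\<close>, where \<open>m = n / s\<close>.
  Listing the bins \<open>\<pi> 0, \<pi> 1, \<dots>\<close> one after the other puts the point with index
  \<open>bin_index m \<pi> k\<close> at position \<open>k\<close>. When \<open>n1 = s1 * m\<close>, positions below \<open>n1\<close> are filled by the
  bins \<open>\<pi> 0, \<dots>, \<pi> (s1 - 1)\<close> and the other positions by the bins \<open>\<pi> s1, \<dots>, \<pi> (s - 1)\<close>.\<close>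

definition bin_index :: "nat \<Rightarrow> (nat \<Rightarrow> nat) \<Rightarrow> nat \<Rightarrow> nat" where
  "bin_index m \<pi> k = \<pi> (k div m) * m + k mod m"

definition permuted_stat ::
  "((nat \<Rightarrow> 'a) \<Rightarrow> (nat \<Rightarrow> 'a) \<Rightarrow> real) \<Rightarrow> nat \<Rightarrow> nat \<Rightarrow> (nat \<Rightarrow> 'a) \<Rightarrow> (nat \<Rightarrow> nat) \<Rightarrow> real" where
  "permuted_stat T n1 m x \<pi> =
     T (\<lambda>i. x (bin_index m \<pi> i)) (\<lambda>j. x (bin_index m \<pi> (n1 + j)))"

definition test_stats ::
  "((nat \<Rightarrow> 'a) \<Rightarrow> (nat \<Rightarrow> 'a) \<Rightarrow> real) \<Rightarrow> nat \<Rightarrow> nat \<Rightarrow> (nat \<Rightarrow> 'a) \<Rightarrow> (nat \<Rightarrow> nat \<Rightarrow> nat)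
    \<Rightarrow> nat \<Rightarrow> real" where
  "test_stats T n1 m x ps b =
     (if b = 0 then T x (\<lambda>j. x (n1 + j)) else permuted_stat T n1 m x (ps b))"

text \<open>Ties are broken by the priorities \<open>\<tau>\<close>, a uniformly random permutation of \<open>{0..B}\<close>.\<close>

definition test_rank :: "nat \<Rightarrow> (nat \<Rightarrow> real) \<Rightarrow> (nat \<Rightarrow> nat) \<Rightarrow> nat" where
  "test_rank B t \<tau> = 1 + card {b \<in> {1..B}. t b < t 0 \<or> (t b = t 0 \<and> \<tau> b < \<tau> 0)}"

definition reject_prob :: "nat \<Rightarrow> real \<Rightarrow> nat \<Rightarrow> real" where
  "reject_prob B \<alpha> R = min 1 (max 0 (real R - (1 - \<alpha>) * (real B + 1)))"

text \<open>Data, permutations \<open>\<pi>\<^sub>1, \<dots>, \<pi>\<^sub>B\<close> of the bins, and tie-breaking priorities, all independent.\<close>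

definition cheap_experiment ::
  "'a measure \<Rightarrow> 'a measure \<Rightarrow> nat \<Rightarrow> nat \<Rightarrow> nat \<Rightarrow> nat
    \<Rightarrow> ((nat \<Rightarrow> 'a) \<times> (nat \<Rightarrow> nat \<Rightarrow> nat) \<times> (nat \<Rightarrow> nat)) measure" where
  "cheap_experiment P Q n1 n2 s B =
     two_sample P Q n1 n2 \<Otimes>\<^sub>M
     ((\<Pi>\<^sub>M b\<in>{1..B}. uniform_count_measure {\<pi>. \<pi> permutes {..<s}}) \<Otimes>\<^sub>M
      uniform_count_measure {\<tau>. \<tau> permutes {0..B}})"

definition cheap_test_power ::
  "((nat \<Rightarrow> 'a) \<Rightarrow> (nat \<Rightarrow> 'a) \<Rightarrow> real) \<Rightarrow> 'a measure \<Rightarrow> 'a measure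
    \<Rightarrow> nat \<Rightarrow> nat \<Rightarrow> nat \<Rightarrow> nat \<Rightarrow> real \<Rightarrow> real" where
  "cheap_test_power T P Q n1 n2 s B \<alpha> =
     (\<integral>(x, ps, \<tau>). reject_prob B \<alpha>
         (test_rank B (test_stats T n1 ((n1 + n2) div s) x ps) \<tau>)
       \<partial>cheap_experiment P Q n1 n2 s B)"

section \<open>Separation thresholds\<close>

definition alpha_star :: "real \<Rightarrow> real \<Rightarrow> nat \<Rightarrow> real" where
  "alpha_star \<alpha> \<beta> B =
     \<alpha> / (2 * exp 1) * (\<beta> / 3) powr (1 / of_int \<lfloor>\<alpha> * (real B + 1)\<rfloor>)"

definition rho :: "nat \<Rightarrow> nat \<Rightarrow> real" where
  "rho n1 n2 = real n1 * (real n1 - 1)^2 * real n2 * (real n2 - 1)^2 / real (n1 + n2) ^ 6"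

definition gamma_full ::
  "'a measure \<Rightarrow> 'a measure \<Rightarrow> ('a \<Rightarrow> 'a \<Rightarrow> real) \<Rightarrow> real \<Rightarrow> real \<Rightarrow> nat \<Rightarrow> nat \<Rightarrow> nat \<Rightarrow> real" where
  "gamma_full P Q g \<alpha> \<beta> B n1 n2 =
     sqrt ((3 - \<beta>) / \<beta> * (4 * psi_Y1 P Q g / real n1 + 4 * psi_Z1 P Q g / real n2)) +
     sqrt ((1 - alpha_star \<alpha> \<beta> B) / alpha_star \<alpha> \<beta> B *
       ((36 * real n1 ^ 2 + 36 * real n2 ^ 2 + 198 * real n1 * real n2) * psi_YZ2 P Q g /
        (\<beta> * real n1 * (real n1 - 1) * real n2 * (real n2 - 1))))"

definition bin_factor :: "real \<Rightarrow> real \<Rightarrow> nat \<Rightarrow> nat \<Rightarrow> nat \<Rightarrow> nat \<Rightarrow> real" where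
  "bin_factor \<alpha> \<beta> B n1 n2 s =
     sqrt (real s ^ 3 * (\<beta> * alpha_star \<alpha> \<beta> B / (24 * (1 - alpha_star \<alpha> \<beta> B))) * rho n1 n2)"

text \<open>For \<open>s < n1 + n2\<close> this is meaningful only if \<open>bin_factor \<alpha> \<beta> B n1 n2 s > 1\<close>.\<close>

definition gamma_cheap ::
  "'a measure \<Rightarrow> 'a measure \<Rightarrow> ('a \<Rightarrow> 'a \<Rightarrow> real) \<Rightarrow> real \<Rightarrow> real \<Rightarrow> nat \<Rightarrow> nat \<Rightarrow> nat \<Rightarrow> nat \<Rightarrow> real"
where
  "gamma_cheap P Q g \<alpha> \<beta> B n1 n2 s =
     gamma_full P Q g \<alpha> \<beta> B n1 n2 +
     of_bool (s < n1 + n2) *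
       ((gamma_full P Q g \<alpha> \<beta> B n1 n2 +
         sqrt (201 * real s ^ 2 / (4 * real (n1 + n2) ^ 2) * psi_YZ2 P Q g +
               12 * real s / real (n1 + n2) * max (psi_Y1 P Q g) (psi_Z1 P Q g))) /
        (bin_factor \<alpha> \<beta> B n1 n2 s - 1))"

end

theory Submission
  imports Defs
begin

text \<open>
  Let \<open>p x\<close> be the fraction of bin permutations whose statistic reaches the observed one. Given
  data \<open>x\<close> with \<open>p x\<close> at most \<open>alpha_star\<close>, the number of the \<open>B\<close> drawn permutations that reach
  the observed statistic is binomial, and \<open>alpha_star\<close> is made for the union bound
  \<open>(B choose k) * alpha_star ^ k\<close> to be at most \<open>\<beta> / 6\<close>, with \<open>k\<close> the integer part of
  \<open>\<alpha> * (B + 1)\<close> (\<open>binomial_tail_le\<close>, \<open>randomized_test_power\<close>). So it suffices that \<open>p x\<close> exceeds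
  \<open>alpha_star\<close> with probability at most \<open>5 / 6 * \<beta>\<close> (\<open>cheap_power_ge\<close>).

  A permutation of the bins only changes the set \<open>S\<close> of points that are treated as first sample.
  As a function of \<open>S\<close> and the data, the statistic is a quadratic form whose coefficient matrix
  has vanishing row sums. The Hoeffding decomposition of \<open>g\<close> therefore splits it into a signal,
  a linear and a degenerate part (\<open>split_stat_decomposition\<close>). The signal is at most \<open>effect\<close>, the
  expectation of the statistic, times the squared discrepancy \<open>disc\<close> of \<open>S\<close>
  (\<open>label_weight_sum_le\<close>). The linear part depends on \<open>S\<close> through weights whose main part
  is proportional to the discrepancy. The degenerate part has the same variance bound for all \<open>S\<close>.
  The discrepancy is the same for points as for bins; its second, fourth and sixth
  moments under a random permutation come from an exchangeable pair (\<open>bin_disc_exchange\<close>).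

  For bins of one point, the second moment of the permuted statistic over permutations is small
  enough for Markov's inequality (\<open>unbinned_tail\<close>). For larger bins, let \<open>D\<close> be the bin factor.
  The squared discrepancy has to stay below a threshold between \<open>1 / D\<close> and 1, except with
  probability of order \<open>alpha_star\<close>. As \<open>D\<^sup>2\<close> is of order \<open>alpha_star * s ^ 3\<close> in the level and
  the number of bins, the sixth moment of the discrepancy has the right order for the
  signal (\<open>disc_large_deviation\<close>). For the linear part a fourth moment over permutations is
  needed, although the data have second moments only: the squared \<open>L\<^sup>4\<close> norm over permutations
  is smooth, so that its expectation over the data is bounded by a sum of variances
  (\<open>lin_L4_norm_expectation\<close>). The degenerate part needs its second moment (\<open>binned_tail\<close>).

  These moment bounds give a threshold, partly random through the data, above which \<open>p x\<close> is
  small. That the observed statistic falls below it is a one-sided event for centered noise, to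
  which Cantelli's inequality applies (\<open>one_sided_tail\<close>). The factor \<open>(3 - \<beta>) / \<beta>\<close> in the
  separation threshold is the one of this inequality at level \<open>\<beta> / 3\<close>. Both first-order components \<open>psi_Y1\<close> and \<open>psi_Z1\<close>
  equal the larger of the variances of the witness function under the two laws (\<open>psi_Y1_eq\<close>,
  \<open>psi_Z1_eq\<close>).
\<close>

section \<open>Averages over finite sets\<close>

definition mean :: "'b set \<Rightarrow> ('b \<Rightarrow> real) \<Rightarrow> real" where
  "mean A f = (\<Sum>a\<in>A. f a) / real (card A)"

lemma mean_mono:
  assumes "\<And>a. a \<in> A \<Longrightarrow> f a \<le> g a"
  shows "mean A f \<le> mean A g"
  unfolding mean_def using assms by (intro divide_right_mono sum_mono) auto

lemma mean_nonneg: "(\<And>a. a \<in> A \<Longrightarrow> 0 \<le> f a) \<Longrightarrow> 0 \<le> mean A f"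
  unfolding mean_def by (intro divide_nonneg_nonneg sum_nonneg) auto

lemma mean_add: "mean A (\<lambda>a. f a + g a) = mean A f + mean A g"
  unfolding mean_def by (simp add: sum.distrib add_divide_distrib)

lemma mean_diff: "mean A (\<lambda>a. f a - g a) = mean A f - mean A g"
  unfolding mean_def by (simp add: sum_subtractf diff_divide_distrib)

lemma mean_cmult: "mean A (\<lambda>a. c * f a) = c * mean A f"
  unfolding mean_def by (simp add: sum_distrib_left[symmetric])

lemma mean_sum: "mean A (\<lambda>a. \<Sum>i\<in>I. f i a) = (\<Sum>i\<in>I. mean A (f i))"
  unfolding mean_def by (simp add: sum_divide_distrib[symmetric] sum.swap[of _ A I])

lemma mean_const: "finite A \<Longrightarrow> A \<noteq> {} \<Longrightarrow> mean A (\<lambda>a. c) = c"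
  unfolding mean_def by simp

lemma mean_cong: "(\<And>a. a \<in> A \<Longrightarrow> f a = g a) \<Longrightarrow> mean A f = mean A g"
  unfolding mean_def by simp

lemma mean_Markov:
  assumes "finite A" "A \<noteq> {}" "c > 0" "\<And>a. a \<in> A \<Longrightarrow> 0 \<le> f a"
    and "\<And>a. a \<in> A \<Longrightarrow> P a \<Longrightarrow> c \<le> f a"
  shows "mean A (\<lambda>a. of_bool (P a)) \<le> mean A f / c"
proof -
  have "mean A (\<lambda>a. of_bool (P a)) \<le> mean A (\<lambda>a. (1 / c) * f a)"
    using assms by (intro mean_mono) (auto simp: field_simps)
  then show ?thesis by (simp only: mean_cmult) simp
qed

lemma mean_Cauchy_Schwarz:
  "mean A (\<lambda>a. f a * g a) \<le> sqrt (mean A (\<lambda>a. (f a)^2)) * sqrt (mean A (\<lambda>a. (g a)^2))"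
proof -
  have "(\<Sum>a\<in>A. f a * g a)^2 \<le> (\<Sum>a\<in>A. (f a)^2) * (\<Sum>a\<in>A. (g a)^2)"
    by (rule Cauchy_Schwarz_ineq_sum)
  then have "(mean A (\<lambda>a. f a * g a))^2 \<le> mean A (\<lambda>a. (f a)^2) * mean A (\<lambda>a. (g a)^2)"
    unfolding mean_def power_divide
    by (simp add: power2_eq_square divide_right_mono)
  then have "\<bar>mean A (\<lambda>a. f a * g a)\<bar> \<le> sqrt (mean A (\<lambda>a. (f a)^2) * mean A (\<lambda>a. (g a)^2))"
    by (rule real_le_rsqrt[of "\<bar>_\<bar>", unfolded power2_abs])
  then show ?thesis by (simp add: real_sqrt_mult)
qed

text \<open>The squared \<open>L\<^sup>4\<close> norm is twice differentiable along a line with second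
  derivative at most six times the squared norm of the direction (Cauchy-Schwarz), so that a
  Taylor expansion around 0 gives the bound. The summand \<open>\<epsilon>\<close> keeps the
  square root away from its singularity. Applied to independent centered increments, the linear
  term averages out: this is the statement that \<open>L\<^sup>4\<close> has type 2.\<close>

lemma L4_norm_smooth:
  assumes A: "finite A" "A \<noteq> {}" and eps: "\<epsilon> > 0"
  obtains D where "\<And>t. sqrt (\<epsilon> + mean A (\<lambda>a. (u a + t * v a)^4))
      \<le> sqrt (\<epsilon> + mean A (\<lambda>a. (u a)^4)) + t * D + 3 * t^2 * sqrt (mean A (\<lambda>a. (v a)^4))"
proof -
  define Y where "Y = sqrt (mean A (\<lambda>a. (v a)^4))"
  define m where "m t = \<epsilon> + mean A (\<lambda>a. (u a + t * v a)^4)" for t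
  define m1 where "m1 t = mean A (\<lambda>a. 4 * (u a + t * v a)^3 * v a)" for t
  define m2 where "m2 t = mean A (\<lambda>a. 12 * ((u a + t * v a)^2 * (v a)^2))" for t
  have mpos: "m t > 0" for t
    unfolding m_def using eps mean_nonneg[of A "\<lambda>a. (u a + t * v a)^4"] by (simp add: add_pos_nonneg)
  have d1: "(m has_real_derivative m1 t) (at t)" for t
    unfolding m_def m1_def mean_def sum_divide_distrib using A
    by (auto intro!: derivative_eq_intros sum.cong)
  have d2: "(m1 has_real_derivative m2 t) (at t)" for t
    unfolding m1_def m2_def mean_def sum_divide_distrib using A
    by (auto intro!: derivative_eq_intros sum.cong simp: power2_eq_square mult_ac split: if_splits)
  have m2le: "m2 t \<le> 12 * sqrt (m t) * Y" for t
  proof -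
    have "m2 t = 12 * mean A (\<lambda>a. (u a + t * v a)^2 * (v a)^2)"
      unfolding m2_def by (rule mean_cmult)
    also have "\<dots> \<le> 12 * (sqrt (mean A (\<lambda>a. ((u a + t * v a)^2)^2)) * sqrt (mean A (\<lambda>a. ((v a)^2)^2)))"
      by (intro mult_left_mono mean_Cauchy_Schwarz) simp
    also have "\<dots> = 12 * (sqrt (mean A (\<lambda>a. (u a + t * v a)^4)) * Y)"
      by (simp add: Y_def)
    also have "\<dots> \<le> 12 * (sqrt (m t) * Y)"
      unfolding m_def Y_def using eps mean_nonneg[of A "\<lambda>a. (v a)^4"]
      by (intro mult_left_mono mult_right_mono) auto
    finally show ?thesis by simp
  qed
  define F where "F t = sqrt (m t)" for t
  define F1 where "F1 t = m1 t / (2 * sqrt (m t))" for t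
  define F2 where "F2 t = m2 t / (2 * sqrt (m t)) - (m1 t)^2 / (4 * m t * sqrt (m t))" for t
  have dF: "(F has_real_derivative F1 t) (at t)" for t
    unfolding F_def F1_def using mpos[of t]
    by (auto intro!: derivative_eq_intros d1 simp: field_simps)
  have dF1: "(F1 has_real_derivative F2 t) (at t)" for t
    unfolding F1_def F2_def using mpos[of t]
    by (auto intro!: derivative_eq_intros d1 d2 simp: field_simps power2_eq_square)
  have F2le: "F2 t \<le> 6 * Y" for t
  proof -
    have "F2 t \<le> m2 t / (2 * sqrt (m t))" unfolding F2_def using mpos[of t] by simp
    also have "\<dots> \<le> 6 * Y" using m2le[of t] mpos[of t] by (simp add: field_simps)
    finally show ?thesis .
  qed
  have "F t \<le> F 0 + t * F1 0 + 3 * t^2 * Y" for t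
  proof -
    have "(6 * Y * 0 - F1 0) * (t - 0) \<le> (3 * Y * t^2 - F t) - (3 * Y * 0^2 - F 0)"
    proof (rule f''_imp_f'[where C = UNIV and f'' = "\<lambda>t. 6 * Y - F2 t"])
      show "((\<lambda>t. 3 * Y * t^2 - F t) has_real_derivative 6 * Y * t - F1 t) (at t)" for t
        by (auto intro!: derivative_eq_intros dF)
      show "((\<lambda>t. 6 * Y * t - F1 t) has_real_derivative 6 * Y - F2 t) (at t)" for t
        by (auto intro!: derivative_eq_intros dF1)
      show "0 \<le> 6 * Y - F2 t" for t using F2le[of t] by simp
    qed auto
    then show ?thesis by (simp add: algebra_simps)
  qed
  then show ?thesis
    by (intro that[of "F1 0"]) (simp add: F_def m_def Y_def)
qed

text \<open>Equality holds at \<open>a = 3 * b\<close>: the square of \<open>a - 3 * b\<close> splits off,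
  and the other factor is positive.\<close>

lemma power4_add_le:
  fixes a b :: real
  assumes "0 \<le> a" "0 \<le> b"
  shows "(a + b)^4 \<le> 64 / 27 * a^4 + 64 * b^4"
proof -
  have "64 / 27 * a^4 + 64 * b^4 - (a + b)^4
      = (a - 3 * b)^2 * (37 * a^2 + 114 * a * b + 189 * b^2) / 27"
    by (simp add: power2_eq_square power4_eq_xxxx algebra_simps)
  moreover have "0 \<le> (a - 3 * b)^2 * (37 * a^2 + 114 * a * b + 189 * b^2) / 27"
    using assms by (intro divide_nonneg_nonneg mult_nonneg_nonneg) auto
  ultimately show ?thesis by linarith
qed

text \<open>For fixed \<open>b\<close> the minimum over \<open>a\<close> of the cube divided by
  \<open>a\<close> is attained at \<open>b = 2 a\<close>. So a threshold \<open>a + b\<close> with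
  constant \<open>a\<close> has a cube of order at least \<open>b\<^sup>2\<close>.\<close>

lemma cube_add_ge:
  fixes a b :: real
  assumes "0 \<le> a" "0 \<le> b"
  shows "27 / 4 * a * b^2 \<le> (a + b)^3"
proof -
  have "(a + b)^3 - 27 / 4 * a * b^2 = (2 * a - b)^2 * (a + 4 * b) / 4"
    by (simp add: power2_eq_square power3_eq_cube algebra_simps)
  moreover have "0 \<le> (2 * a - b)^2 * (a + 4 * b) / 4" using assms by simp
  ultimately show ?thesis by linarith
qed

section \<open>Moments of the discrepancy of a random permutation\<close>

lemma sum_swap3:
  "(\<Sum>p\<in>A. \<Sum>i\<in>I. \<Sum>j\<in>J. f p i j) = (\<Sum>i\<in>I. \<Sum>j\<in>J. \<Sum>p\<in>A. f p i j)"
  by (rule trans[OF sum.swap sum.cong[OF refl sum.swap]])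

text \<open>The share of first-sample bins among the positions of the first group minus their share among
  the positions of the second group: 1 for the identity, and of mean 0 under a uniform
  permutation.\<close>

definition bin_disc :: "nat \<Rightarrow> nat \<Rightarrow> (nat \<Rightarrow> nat) \<Rightarrow> real" where
  "bin_disc s1 s2 \<pi> = (\<Sum>i<s1. of_bool (\<pi> i < s1)) / real s1
     - (\<Sum>j\<in>{s1..<s1 + s2}. of_bool (\<pi> j < s1)) / real s2"

text \<open>Exchanging one position of each group moves the discrepancy by at most a fixed step. This is the
  exchangeable pair from which all moments below follow.\<close>

lemma bin_disc_swap:
  assumes "i < s1" "j \<in> {s1..<s1 + s2}"
  shows "bin_disc s1 s2 (\<pi> \<circ> Transposition.transpose i j) = bin_disc s1 s2 \<pi>
    + (1 / real s1 + 1 / real s2) * (of_bool (\<pi> j < s1) - of_bool (\<pi> i < s1))"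
proof -
  define v :: "nat \<Rightarrow> real" where "v a = of_bool (\<pi> a < s1)" for a
  have i: "i \<in> {..<s1}" and ij: "i \<noteq> j" using assms by auto
  have "(\<Sum>a<s1. v (Transposition.transpose i j a)) = v j + (\<Sum>a\<in>{..<s1} - {i}. v (Transposition.transpose i j a))"
    using i by (subst sum.remove[of _ i]) auto
  also have "(\<Sum>a\<in>{..<s1} - {i}. v (Transposition.transpose i j a)) = (\<Sum>a\<in>{..<s1} - {i}. v a)"
    using assms by (intro sum.cong) (auto simp: Transposition.transpose_def)
  also have "\<dots> = (\<Sum>a<s1. v a) - v i" using i by (simp add: sum.remove[of _ i])
  finally have 1: "(\<Sum>a<s1. v (Transposition.transpose i j a)) = (\<Sum>a<s1. v a) + (v j - v i)" by simp
  have "(\<Sum>a\<in>{s1..<s1 + s2}. v (Transposition.transpose i j a))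
      = v i + (\<Sum>a\<in>{s1..<s1 + s2} - {j}. v (Transposition.transpose i j a))"
    using assms by (subst sum.remove[of _ j]) auto
  also have "(\<Sum>a\<in>{s1..<s1 + s2} - {j}. v (Transposition.transpose i j a)) = (\<Sum>a\<in>{s1..<s1 + s2} - {j}. v a)"
    using assms by (intro sum.cong) (auto simp: Transposition.transpose_def)
  also have "\<dots> = (\<Sum>a\<in>{s1..<s1 + s2}. v a) - v j" using assms by (subst sum.remove[of "{s1..<s1 + s2}" j]) auto
  finally have 2: "(\<Sum>a\<in>{s1..<s1 + s2}. v (Transposition.transpose i j a)) = (\<Sum>a\<in>{s1..<s1 + s2}. v a) - (v j - v i)"
    by simp
  show ?thesis
    unfolding bin_disc_def comp_def v_def[symmetric] 1 2
    by (simp add: diff_divide_distrib add_divide_distrib algebra_simps)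
qed

context
  fixes s1 s2 :: nat
  assumes pos: "0 < s1" "0 < s2"
begin

private abbreviation "Perms \<equiv> {\<pi>. \<pi> permutes {..<s1 + s2}}"
private abbreviation "\<delta> \<equiv> bin_disc s1 s2"
private abbreviation "lam \<equiv> 1 / real s1 + 1 / real s2"

lemma finite_perms: "finite Perms" "Perms \<noteq> {}"
  using finite_permutations[of "{..<s1 + s2}"] permutes_id[of "{..<s1 + s2}"] by blast+

lemma perm_count:
  assumes "\<pi> \<in> Perms"
  shows "(\<Sum>i<s1. of_bool (\<pi> i < s1)) + (\<Sum>j\<in>{s1..<s1 + s2}. of_bool (\<pi> j < s1)) = real s1"
proof -
  have "(\<Sum>i<s1. of_bool (\<pi> i < s1)) + (\<Sum>j\<in>{s1..<s1 + s2}. of_bool (\<pi> j < s1))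
      = (\<Sum>i\<in>{..<s1 + s2}. of_bool (\<pi> i < s1) :: real)"
    by (subst sum.union_disjoint[symmetric]) (auto simp: ivl_disj_un)
  also have "\<dots> = (\<Sum>i\<in>{..<s1 + s2}. of_bool (i < s1))"
    using assms by (intro sum.reindex_bij_betw) (auto simp: permutes_imp_bij)
  also have "\<dots> = (\<Sum>i<s1. 1)" by (intro sum.mono_neutral_cong_right) auto
  finally show ?thesis by simp
qed

lemma bin_disc_fractions:
  assumes "\<pi> \<in> Perms"
  shows "(\<Sum>i<s1. of_bool (\<pi> i < s1)) / real s1 = (real s1 + real s2 * \<delta> \<pi>) / (real s1 + real s2)"
    and "(\<Sum>j\<in>{s1..<s1 + s2}. of_bool (\<pi> j < s1)) / real s2 = real s1 * (1 - \<delta> \<pi>) / (real s1 + real s2)"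
proof -
  define h where "h = (\<Sum>i<s1. of_bool (\<pi> i < s1) :: real)"
  define h' where "h' = (\<Sum>j\<in>{s1..<s1 + s2}. of_bool (\<pi> j < s1) :: real)"
  have h': "h' = real s1 - h" using perm_count[OF assms] unfolding h_def h'_def by simp
  have d: "\<delta> \<pi> = h / real s1 - h' / real s2" unfolding bin_disc_def h_def h'_def ..
  have S: "real s1 + real s2 \<noteq> 0" using pos by simp
  have 1: "real s1 + real s2 * \<delta> \<pi> = h / real s1 * (real s1 + real s2)"
    and 2: "real s1 * (1 - \<delta> \<pi>) = h' / real s2 * (real s1 + real s2)"
    unfolding d h' using pos by (simp_all add: field_simps)
  show "h / real s1 = (real s1 + real s2 * \<delta> \<pi>) / (real s1 + real s2)"
    "h' / real s2 = real s1 * (1 - \<delta> \<pi>) / (real s1 + real s2)"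
    unfolding 1 2 using S by simp_all
qed

text \<open>Summed over all transpositions between the groups, the increments of the discrepancy are
  proportional to the discrepancy itself; composing with a transposition preserves the uniform
  distribution, which antisymmetrizes the left factor. This is Stein's identity for the
  exchangeable pair.\<close>

lemma bin_disc_exchange:
  fixes f :: "real \<Rightarrow> real"
  shows "real (s1 + s2) * (\<Sum>\<pi>\<in>Perms. f (\<delta> \<pi>) * \<delta> \<pi>)
    = 1 / 2 * (\<Sum>\<pi>\<in>Perms. \<Sum>i<s1. \<Sum>j\<in>{s1..<s1 + s2}.
        (f (\<delta> \<pi>) - f (\<delta> (\<pi> \<circ> Transposition.transpose i j))) * (\<delta> \<pi> - \<delta> (\<pi> \<circ> Transposition.transpose i j)))"
proof -
  define J where "J = {s1..<s1 + s2}"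
  have sumdiff: "(\<Sum>i<s1. \<Sum>j\<in>J. \<delta> \<pi> - \<delta> (\<pi> \<circ> Transposition.transpose i j)) = real (s1 + s2) * \<delta> \<pi>" for \<pi>
  proof -
    have "(\<Sum>i<s1. \<Sum>j\<in>J. \<delta> \<pi> - \<delta> (\<pi> \<circ> Transposition.transpose i j))
        = (\<Sum>i<s1. \<Sum>j\<in>J. lam * (of_bool (\<pi> i < s1) - of_bool (\<pi> j < s1)))"
      by (intro sum.cong) (auto simp: bin_disc_swap J_def algebra_simps)
    also have "\<dots> = lam * (real s2 * (\<Sum>i<s1. of_bool (\<pi> i < s1)) - real s1 * (\<Sum>j\<in>J. of_bool (\<pi> j < s1)))"
      by (simp add: J_def sum_distrib_left[symmetric] sum_subtractf sum.distrib)
    also have "\<dots> = real (s1 + s2) * \<delta> \<pi>"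
      using pos by (simp add: bin_disc_def J_def field_simps)
    finally show ?thesis .
  qed
  have swap: "(\<Sum>\<pi>\<in>Perms. f (\<delta> \<pi>) * (\<delta> \<pi> - \<delta> (\<pi> \<circ> Transposition.transpose i j)))
      = 1 / 2 * (\<Sum>\<pi>\<in>Perms. (f (\<delta> \<pi>) - f (\<delta> (\<pi> \<circ> Transposition.transpose i j))) * (\<delta> \<pi> - \<delta> (\<pi> \<circ> Transposition.transpose i j)))"
    if "i < s1" "j \<in> J" for i j
  proof -
    have t: "Transposition.transpose i j permutes {..<s1 + s2}"
      using that by (intro permutes_swap_id) (auto simp: J_def)
    have "(\<Sum>\<pi>\<in>Perms. f (\<delta> \<pi>) * (\<delta> \<pi> - \<delta> (\<pi> \<circ> Transposition.transpose i j)))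
        = (\<Sum>\<pi>\<in>Perms. f (\<delta> (\<pi> \<circ> Transposition.transpose i j)) * (\<delta> (\<pi> \<circ> Transposition.transpose i j) - \<delta> (\<pi> \<circ> Transposition.transpose i j \<circ> Transposition.transpose i j)))"
      by (rule sum_permutations_compose_right[OF t])
    also have "\<dots> = (\<Sum>\<pi>\<in>Perms. - f (\<delta> (\<pi> \<circ> Transposition.transpose i j)) * (\<delta> \<pi> - \<delta> (\<pi> \<circ> Transposition.transpose i j)))"
      by (intro sum.cong) (simp_all add: comp_assoc algebra_simps)
    finally show ?thesis
      by (simp add: sum_subtractf left_diff_distrib sum_negf)
  qed
  have "real (s1 + s2) * (\<Sum>\<pi>\<in>Perms. f (\<delta> \<pi>) * \<delta> \<pi>)
      = (\<Sum>\<pi>\<in>Perms. \<Sum>i<s1. \<Sum>j\<in>J. f (\<delta> \<pi>) * (\<delta> \<pi> - \<delta> (\<pi> \<circ> Transposition.transpose i j)))"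
    unfolding sum_distrib_left[symmetric] sumdiff by (simp add: sum_distrib_left mult_ac)
  also have "\<dots> = (\<Sum>i<s1. \<Sum>j\<in>J. \<Sum>\<pi>\<in>Perms. f (\<delta> \<pi>) * (\<delta> \<pi> - \<delta> (\<pi> \<circ> Transposition.transpose i j)))"
    by (rule sum_swap3)
  also have "\<dots> = (\<Sum>i<s1. \<Sum>j\<in>J. 1 / 2 * (\<Sum>\<pi>\<in>Perms. (f (\<delta> \<pi>) - f (\<delta> (\<pi> \<circ> Transposition.transpose i j))) * (\<delta> \<pi> - \<delta> (\<pi> \<circ> Transposition.transpose i j))))"
    by (intro sum.cong refl swap) auto
  also have "\<dots> = 1 / 2 * (\<Sum>i<s1. \<Sum>j\<in>J. \<Sum>\<pi>\<in>Perms. (f (\<delta> \<pi>) - f (\<delta> (\<pi> \<circ> Transposition.transpose i j))) * (\<delta> \<pi> - \<delta> (\<pi> \<circ> Transposition.transpose i j)))"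
    by (simp only: sum_distrib_left)
  also have "(\<Sum>i<s1. \<Sum>j\<in>J. \<Sum>\<pi>\<in>Perms. (f (\<delta> \<pi>) - f (\<delta> (\<pi> \<circ> Transposition.transpose i j))) * (\<delta> \<pi> - \<delta> (\<pi> \<circ> Transposition.transpose i j)))
     = (\<Sum>\<pi>\<in>Perms. \<Sum>i<s1. \<Sum>j\<in>J. (f (\<delta> \<pi>) - f (\<delta> (\<pi> \<circ> Transposition.transpose i j))) * (\<delta> \<pi> - \<delta> (\<pi> \<circ> Transposition.transpose i j)))"
    by (rule sum_swap3[symmetric])
  finally show ?thesis unfolding J_def .
qed

lemma bin_disc_mean: "mean Perms \<delta> = 0"
  using bin_disc_exchange[of "\<lambda>_. 1"] pos by (simp add: mean_def)

text \<open>Stein's identity applied to the power \<open>Suc k\<close>: the difference quotient of the power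
  is bounded by assumption and a single increment by \<open>1 / s1 + 1 / s2\<close>. Iterating
  gives Gaussian-type moments without any computation with hypergeometric probabilities.\<close>

lemma bin_disc_mean_power:
  fixes k :: nat
  assumes "\<And>a b :: real. (a^(Suc k) - b^(Suc k)) * (a - b) \<le> c * (a^k + b^k) * (a - b)^2"
    and "0 \<le> c" "even k"
  shows "mean Perms (\<lambda>\<pi>. \<delta> \<pi> ^ (k + 2)) \<le> c * lam * mean Perms (\<lambda>\<pi>. \<delta> \<pi> ^ k)"
proof -
  define J where "J = {s1..<s1 + s2}"
  have "real (s1 + s2) * (\<Sum>\<pi>\<in>Perms. \<delta> \<pi> ^ (k + 2))
     = real (s1 + s2) * (\<Sum>\<pi>\<in>Perms. \<delta> \<pi> ^ (Suc k) * \<delta> \<pi>)" by (simp add: mult_ac)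
  also have "\<dots> = 1 / 2 * (\<Sum>\<pi>\<in>Perms. \<Sum>i<s1. \<Sum>j\<in>J.
        (\<delta> \<pi> ^ (Suc k) - \<delta> (\<pi> \<circ> Transposition.transpose i j) ^ (Suc k)) * (\<delta> \<pi> - \<delta> (\<pi> \<circ> Transposition.transpose i j)))"
    unfolding J_def by (rule bin_disc_exchange[of "\<lambda>x. x ^ (Suc k)"])
  also have "\<dots> \<le> 1 / 2 * (\<Sum>\<pi>\<in>Perms. \<Sum>i<s1. \<Sum>j\<in>J.
        c * lam^2 * (\<delta> \<pi> ^ k + \<delta> (\<pi> \<circ> Transposition.transpose i j) ^ k))"
  proof (intro mult_left_mono sum_mono)
    fix \<pi> i j assume ij: "i \<in> {..<s1}" "j \<in> J"
    define a b where "a = \<delta> \<pi>" and "b = \<delta> (\<pi> \<circ> Transposition.transpose i j)"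
    have "b = a + lam * (of_bool (\<pi> j < s1) - of_bool (\<pi> i < s1))"
      using ij unfolding a_def b_def J_def by (intro bin_disc_swap) auto
    then have "(a - b)^2 = lam^2 * (of_bool (\<pi> j < s1) - of_bool (\<pi> i < s1))^2"
      by (simp add: power_mult_distrib)
    also have "\<dots> \<le> lam^2 * 1" by (intro mult_left_mono) (auto simp: of_bool_def)
    finally have ab: "(a - b)^2 \<le> lam^2" by simp
    have "(a^(Suc k) - b^(Suc k)) * (a - b) \<le> c * (a^k + b^k) * (a - b)^2" by (rule assms(1))
    also have "\<dots> \<le> c * (a^k + b^k) * lam^2"
      using ab assms(2,3) by (intro mult_left_mono mult_nonneg_nonneg add_nonneg_nonneg zero_le_even_power)
    finally show "(a^(Suc k) - b^(Suc k)) * (a - b) \<le> c * lam^2 * (a^k + b^k)"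
      by (simp add: mult_ac)
  qed simp
  also have "(\<Sum>\<pi>\<in>Perms. \<Sum>i<s1. \<Sum>j\<in>J. c * lam^2 * (\<delta> \<pi> ^ k + \<delta> (\<pi> \<circ> Transposition.transpose i j) ^ k))
      = c * lam^2 * (\<Sum>i<s1. \<Sum>j\<in>J. \<Sum>\<pi>\<in>Perms. (\<delta> \<pi> ^ k + \<delta> (\<pi> \<circ> Transposition.transpose i j) ^ k))"
    unfolding sum_distrib_left[symmetric] by (rule arg_cong[OF sum_swap3])
  also have "(\<Sum>i<s1. \<Sum>j\<in>J. \<Sum>\<pi>\<in>Perms. (\<delta> \<pi> ^ k + \<delta> (\<pi> \<circ> Transposition.transpose i j) ^ k))
      = (\<Sum>i<s1. \<Sum>j\<in>J. 2 * (\<Sum>\<pi>\<in>Perms. \<delta> \<pi> ^ k))"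
  proof (intro sum.cong refl)
    fix i j assume ij: "i \<in> {..<s1}" "j \<in> J"
    then have t: "Transposition.transpose i j permutes {..<s1 + s2}"
      by (intro permutes_swap_id) (auto simp: J_def)
    show "(\<Sum>\<pi>\<in>Perms. (\<delta> \<pi> ^ k + \<delta> (\<pi> \<circ> Transposition.transpose i j) ^ k)) = 2 * (\<Sum>\<pi>\<in>Perms. \<delta> \<pi> ^ k)"
      using sum_permutations_compose_right[OF t, of "\<lambda>\<pi>. \<delta> \<pi> ^ k"] by (simp add: sum.distrib)
  qed
  also have "\<dots> = real s1 * real s2 * (2 * (\<Sum>\<pi>\<in>Perms. \<delta> \<pi> ^ k))" by (simp add: J_def)
  finally have "real (s1 + s2) * (\<Sum>\<pi>\<in>Perms. \<delta> \<pi> ^ (k + 2))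
      \<le> c * lam^2 * (real s1 * real s2) * (\<Sum>\<pi>\<in>Perms. \<delta> \<pi> ^ k)" by (simp add: mult_ac)
  also have "c * lam^2 * (real s1 * real s2) * (\<Sum>\<pi>\<in>Perms. \<delta> \<pi> ^ k)
     = (lam^2 * (real s1 * real s2)) * (c * (\<Sum>\<pi>\<in>Perms. \<delta> \<pi> ^ k))" by (simp only: mult_ac)
  also have "lam^2 * (real s1 * real s2) = real (s1 + s2) * lam"
    using pos by (simp add: field_simps power2_eq_square)
  also have "real (s1 + s2) * lam * (c * (\<Sum>\<pi>\<in>Perms. \<delta> \<pi> ^ k))
     = real (s1 + s2) * (c * lam * (\<Sum>\<pi>\<in>Perms. \<delta> \<pi> ^ k))" by (simp only: mult_ac)
  finally have "(\<Sum>\<pi>\<in>Perms. \<delta> \<pi> ^ (k + 2)) \<le> c * lam * (\<Sum>\<pi>\<in>Perms. \<delta> \<pi> ^ k)"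
    using pos by (simp add: mult_le_cancel_left)
  then show ?thesis unfolding mean_def by (simp add: divide_right_mono)
qed

text \<open>For the identity function Stein's identity is an equation for the second moment, because the
  squared increments sum to an affine function of the discrepancy and its square.\<close>

lemma bin_disc_mean_square:
  assumes "2 \<le> s1 + s2"
  shows "mean Perms (\<lambda>\<pi>. \<delta> \<pi> ^ 2) = 1 / (real s1 + real s2 - 1)"
proof -
  define J where "J = {s1..<s1 + s2}"
  define S where "S = real s1 + real s2"
  have Spos: "S > 0" using pos by (simp add: S_def)
  have pairs: "(\<Sum>i<s1. \<Sum>j\<in>J. (\<delta> \<pi> - \<delta> (\<pi> \<circ> Transposition.transpose i j)) * (\<delta> \<pi> - \<delta> (\<pi> \<circ> Transposition.transpose i j)))
      = 2 + (real s1 - real s2)^2 / (real s1 * real s2) * \<delta> \<pi> + 2 * \<delta> \<pi> ^ 2" if "\<pi> \<in> Perms" for \<pi>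
  proof -
    define v :: "nat \<Rightarrow> real" where "v a = of_bool (\<pi> a < s1)" for a
    define h where "h = (\<Sum>i<s1. v i)"
    define h' where "h' = (\<Sum>j\<in>J. v j)"
    have vv: "v a * v a = v a" for a by (simp add: v_def)
    have "(\<Sum>i<s1. \<Sum>j\<in>J. (\<delta> \<pi> - \<delta> (\<pi> \<circ> Transposition.transpose i j)) * (\<delta> \<pi> - \<delta> (\<pi> \<circ> Transposition.transpose i j)))
       = (\<Sum>i<s1. \<Sum>j\<in>J. lam^2 * (v i + v j - 2 * v i * v j))"
    proof (intro sum.cong refl)
      fix i j assume "i \<in> {..<s1}" "j \<in> J"
      then have "\<delta> (\<pi> \<circ> Transposition.transpose i j) = \<delta> \<pi> + lam * (v j - v i)"
        unfolding v_def J_def by (intro bin_disc_swap) auto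
      then have e: "\<delta> \<pi> - \<delta> (\<pi> \<circ> Transposition.transpose i j) = lam * (v i - v j)"
        by (simp add: algebra_simps)
      have "(L * (x - y)) * (L * (x - y)) = L^2 * (x * x + y * y - 2 * x * y)" for L x y :: real
        by (simp add: power2_eq_square algebra_simps)
      then have "(\<delta> \<pi> - \<delta> (\<pi> \<circ> Transposition.transpose i j)) * (\<delta> \<pi> - \<delta> (\<pi> \<circ> Transposition.transpose i j))
          = lam^2 * (v i * v i + v j * v j - 2 * v i * v j)"
        unfolding e .
      then show "(\<delta> \<pi> - \<delta> (\<pi> \<circ> Transposition.transpose i j)) * (\<delta> \<pi> - \<delta> (\<pi> \<circ> Transposition.transpose i j))
          = lam^2 * (v i + v j - 2 * v i * v j)" unfolding vv .
    qed
    also have "\<dots> = lam^2 * (\<Sum>i<s1. (real s2 * v i + h' - 2 * v i * h'))"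
      by (simp add: sum_distrib_left[symmetric] sum_subtractf sum.distrib h'_def J_def)
    also have "(\<Sum>i<s1. (real s2 * v i + h' - 2 * v i * h')) = real s2 * h + real s1 * h' - 2 * h * h'"
      by (simp add: sum_subtractf sum.distrib h_def sum_distrib_left sum_distrib_right)
    also have "h = real s1 * ((real s1 + real s2 * \<delta> \<pi>) / S)"
      using bin_disc_fractions(1)[OF that] pos unfolding h_def v_def S_def by (simp add: field_simps)
    also have "h' = real s2 * (real s1 * (1 - \<delta> \<pi>) / S)"
      using bin_disc_fractions(2)[OF that] pos unfolding h'_def v_def J_def S_def by (simp add: field_simps)
    also have "lam = S / (real s1 * real s2)" using pos by (simp add: S_def field_simps)
    also have "(S / (real s1 * real s2))^2 * (real s2 * (real s1 * ((real s1 + real s2 * \<delta> \<pi>) / S))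
        + real s1 * (real s2 * (real s1 * (1 - \<delta> \<pi>) / S))
        - 2 * (real s1 * ((real s1 + real s2 * \<delta> \<pi>) / S)) * (real s2 * (real s1 * (1 - \<delta> \<pi>) / S)))
      = (S * ((real s1 + real s2 * \<delta> \<pi>) + real s1 * (1 - \<delta> \<pi>))
         - 2 * (real s1 + real s2 * \<delta> \<pi>) * (real s1 * (1 - \<delta> \<pi>))) / (real s1 * real s2)"
      using pos Spos by (simp add: field_simps power2_eq_square)
    also have "\<dots> = (2 * (real s1 * real s2) + (real s1 - real s2)^2 * \<delta> \<pi> + 2 * (real s1 * real s2) * \<delta> \<pi> ^ 2) / (real s1 * real s2)"
      unfolding S_def by (simp add: power2_eq_square algebra_simps)
    also have "\<dots> = 2 + (real s1 - real s2)^2 / (real s1 * real s2) * \<delta> \<pi> + 2 * \<delta> \<pi> ^ 2"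
      using pos by (simp add: field_simps)
    finally show ?thesis .
  qed
  have sum0: "(\<Sum>\<pi>\<in>Perms. \<delta> \<pi>) = 0"
    using bin_disc_exchange[of "\<lambda>_. 1"] pos by simp
  have "S * (\<Sum>\<pi>\<in>Perms. \<delta> \<pi> ^ 2) = 1 / 2 * (\<Sum>\<pi>\<in>Perms. \<Sum>i<s1. \<Sum>j\<in>J.
      (\<delta> \<pi> - \<delta> (\<pi> \<circ> Transposition.transpose i j)) * (\<delta> \<pi> - \<delta> (\<pi> \<circ> Transposition.transpose i j)))"
    using bin_disc_exchange[of "\<lambda>x. x"] by (simp add: S_def J_def power2_eq_square)
  also have "\<dots> = 1 / 2 * (\<Sum>\<pi>\<in>Perms. 2 + (real s1 - real s2)^2 / (real s1 * real s2) * \<delta> \<pi> + 2 * \<delta> \<pi> ^ 2)"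
    by (intro arg_cong[where f="\<lambda>x. 1 / 2 * x"] sum.cong refl pairs)
  also have "\<dots> = real (card Perms) + (\<Sum>\<pi>\<in>Perms. \<delta> \<pi> ^ 2)"
    unfolding sum.distrib sum_distrib_left[symmetric] sum0 by simp
  finally have "(S - 1) * (\<Sum>\<pi>\<in>Perms. \<delta> \<pi> ^ 2) = real (card Perms)" by (simp add: algebra_simps)
  moreover have "S - 1 > 0" using assms by (simp add: S_def)
  moreover have "real (card Perms) > 0" using finite_perms by (simp add: card_gt_0_iff)
  ultimately show ?thesis unfolding mean_def S_def by (simp add: field_simps)
qed

lemma bin_disc_mean_4:
  assumes "2 \<le> s1 + s2"
  shows "mean Perms (\<lambda>\<pi>. \<delta> \<pi> ^ 4) \<le> 3 / 2 * lam / (real s1 + real s2 - 1)"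
proof -
  have "(a^3 - b^3) * (a - b) \<le> 3 / 2 * (a^2 + b^2) * (a - b)^2" for a b :: real
  proof -
    have "3 * (a^2 + b^2) * (a - b)^2 - 2 * ((a^3 - b^3) * (a - b)) = (a - b)^4"
      by (simp add: power2_eq_square power3_eq_cube power4_eq_xxxx algebra_simps)
    moreover have "0 \<le> (a - b)^4" by simp
    moreover have "3 / 2 * (a^2 + b^2) * (a - b)^2 = 3 * (a^2 + b^2) * (a - b)^2 / 2" by simp
    ultimately show ?thesis by linarith
  qed
  then have "mean Perms (\<lambda>\<pi>. \<delta> \<pi> ^ (2 + 2)) \<le> 3 / 2 * lam * mean Perms (\<lambda>\<pi>. \<delta> \<pi> ^ 2)"
    by (intro bin_disc_mean_power) (auto simp: numeral_3_eq_3)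
  then show ?thesis using bin_disc_mean_square[OF assms] by simp
qed

lemma bin_disc_mean_6:
  assumes "2 \<le> s1 + s2"
  shows "mean Perms (\<lambda>\<pi>. \<delta> \<pi> ^ 6) \<le> 15 / 4 * lam^2 / (real s1 + real s2 - 1)"
proof -
  have "(a^5 - b^5) * (a - b) \<le> 5 / 2 * (a^4 + b^4) * (a - b)^2" for a b :: real
  proof -
    have "5 * (a^4 + b^4) * (a - b)^2 - 2 * ((a^5 - b^5) * (a - b))
       = (a - b)^4 * (3 * (a^2 + b^2) + 4 * a * b)"
      by (simp add: eval_nat_numeral algebra_simps)
    moreover have "3 * (a^2 + b^2) + 4 * a * b = (a^2 + b^2) + 2 * (a + b)^2"
      by (simp add: power2_eq_square algebra_simps)
    moreover have "0 \<le> (a - b)^4 * ((a^2 + b^2) + 2 * (a + b)^2)" by simp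
    moreover have "5 / 2 * (a^4 + b^4) * (a - b)^2 = 5 * (a^4 + b^4) * (a - b)^2 / 2" by simp
    ultimately show ?thesis by (metis diff_ge_0_iff_ge le_divide_eq_numeral1(1) mult.commute)
  qed
  then have "(a ^ Suc 4 - b ^ Suc 4) * (a - b) \<le> 5 / 2 * (a^4 + b^4) * (a - b)^2" for a b :: real
    unfolding Suc_numeral by simp
  then have "mean Perms (\<lambda>\<pi>. \<delta> \<pi> ^ (4 + 2)) \<le> 5 / 2 * lam * mean Perms (\<lambda>\<pi>. \<delta> \<pi> ^ 4)"
    by (rule bin_disc_mean_power) simp_all
  also have "\<dots> \<le> 5 / 2 * lam * (3 / 2 * lam / (real s1 + real s2 - 1))"
    using pos by (intro mult_left_mono bin_disc_mean_4 assms) auto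
  also have "5 / 2 * L * (3 / 2 * L / D) = 15 / 4 * L^2 / D" for L D :: real
    by (simp add: power2_eq_square)
  finally show ?thesis by simp
qed

end

section \<open>The statistic as a signed form in a split of the pooled sample\<close>

lemma real_card_remove:
  assumes "finite J" "x \<in> J"
  shows "real (card (J - {x})) = real (card J) - 1"
proof -
  have "card J \<ge> 1" using assms by (metis One_nat_def Suc_leI card_gt_0_iff empty_iff)
  then show ?thesis using assms by (simp add: of_nat_diff)
qed

lemma sum_disjoint_parts:
  fixes f :: "'i \<Rightarrow> real"
  assumes "finite B" "finite C" "A = B \<union> C" "B \<inter> C = {}"
  shows "sum f A = sum f B + sum f C"
  using assms by (simp add: sum.union_disjoint)

lemma sum_offdiag_const:
  fixes c :: real
  assumes "finite J"
  shows "(\<Sum>i\<in>J. \<Sum>j\<in>J - {i}. c) = real (card J) * (real (card J) - 1) * c"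
proof -
  have "(\<Sum>i\<in>J. \<Sum>j\<in>J - {i}. c) = (\<Sum>i\<in>J. (real (card J) - 1) * c)"
    using assms by (intro sum.cong refl) (simp add: real_card_remove del: card_Diff_insert card_Diff_singleton)
  then show ?thesis by simp
qed

lemma sum_offdiag_snd:
  fixes f :: "'i \<Rightarrow> real"
  assumes "finite J"
  shows "(\<Sum>i\<in>J. \<Sum>j\<in>J - {i}. f j) = (real (card J) - 1) * (\<Sum>j\<in>J. f j)"
proof -
  have "(\<Sum>i\<in>J. \<Sum>j\<in>J - {i}. f j) = (\<Sum>i\<in>J. (\<Sum>j\<in>J. f j) - f i)"
    using assms by (intro sum.cong refl) (simp add: sum_diff1)
  then show ?thesis by (simp add: sum_subtractf algebra_simps)
qed

lemma sum_offdiag_fst: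
  fixes f :: "'i \<Rightarrow> real"
  assumes "finite J"
  shows "(\<Sum>i\<in>J. \<Sum>j\<in>J - {i}. f i) = (real (card J) - 1) * (\<Sum>j\<in>J. f j)"
proof -
  have "(\<Sum>i\<in>J. \<Sum>j\<in>J - {i}. f i) = (\<Sum>i\<in>J. (real (card J) - 1) * f i)"
    using assms by (intro sum.cong refl) (simp add: real_card_remove del: card_Diff_insert card_Diff_singleton)
  then show ?thesis by (simp add: sum_distrib_left)
qed

text \<open>The signs of a two-sample contrast: positive inside the groups \<open>S\<close> and its
  complement, negative across them, and normalized so that every row sums to 0.\<close>

definition coef :: "nat \<Rightarrow> nat \<Rightarrow> nat set \<Rightarrow> nat \<Rightarrow> nat \<Rightarrow> real" where
  "coef n1 n2 S p q =
     (if p \<in> S then if q \<in> S then 1 / (real n1 * (real n1 - 1)) else - 1 / (real n1 * real n2)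
      else if q \<in> S then - 1 / (real n1 * real n2) else 1 / (real n2 * (real n2 - 1)))"

lemma coef_sym: "coef n1 n2 S p q = coef n1 n2 S q p"
  by (simp add: coef_def)

text \<open>The U-statistic recomputed when the points with indices in \<open>S\<close> form the first
  sample. Coefficients and data are separated here, so that the randomness of the permutation and
  that of the data can be averaged independently.\<close>

definition split_stat :: "('a \<Rightarrow> 'a \<Rightarrow> real) \<Rightarrow> nat \<Rightarrow> nat \<Rightarrow> nat set \<Rightarrow> (nat \<Rightarrow> 'a) \<Rightarrow> real" where
  "split_stat g n1 n2 S x =
     (\<Sum>p\<in>{..<n1 + n2}. \<Sum>q\<in>{..<n1 + n2} - {p}. coef n1 n2 S p q * g (x p) (x q))"

lemma sum_lessThan_add:
  fixes f :: "nat \<Rightarrow> real"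
  shows "(\<Sum>k\<in>{..<n1 + n2}. f k) = (\<Sum>k<n1. f k) + (\<Sum>j<n2. f (n1 + j))"
  by (induction n2) (auto simp: algebra_simps)

text \<open>Each of the four terms of the kernel depends on two of the four indices only; summing out the
  others gives the normalizations in \<open>coef\<close>.\<close>

lemma U_ho_eq_split_stat:
  assumes n: "2 \<le> n1" "2 \<le> n2"
    and sym: "\<And>p q. p < n1 + n2 \<Longrightarrow> q < n1 + n2 \<Longrightarrow> g (v p) (v q) = g (v q) (v p)"
  shows "U_ho n1 n2 g v (\<lambda>j. v (n1 + j)) = split_stat g n1 n2 {..<n1} v"
proof -
  define z where "z j = v (n1 + j)" for j
  define A where "A = (\<Sum>i<n1. \<Sum>i'\<in>{..<n1} - {i}. g (v i) (v i'))"
  define B where "B = (\<Sum>j<n2. \<Sum>j'\<in>{..<n2} - {j}. g (z j) (z j'))"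
  define C where "C = (\<Sum>i<n1. \<Sum>j<n2. g (v i) (z j))"
  define a b where "a = real n1 * (real n1 - 1)" and "b = real n2 * (real n2 - 1)"
  have 1: "(\<Sum>i1<n1. \<Sum>i2\<in>{..<n1} - {i1}. \<Sum>j1<n2. \<Sum>j2\<in>{..<n2} - {j1}. g (v i1) (v i2)) = b * A"
    by (simp only: sum_offdiag_const finite_lessThan card_lessThan A_def b_def sum_distrib_left)
  have 2: "(\<Sum>i1<n1. \<Sum>i2\<in>{..<n1} - {i1}. \<Sum>j1<n2. \<Sum>j2\<in>{..<n2} - {j1}. g (z j1) (z j2)) = a * B"
    by (simp only: sum_offdiag_const finite_lessThan card_lessThan B_def a_def)
  have 3: "(\<Sum>i1<n1. \<Sum>i2\<in>{..<n1} - {i1}. \<Sum>j1<n2. \<Sum>j2\<in>{..<n2} - {j1}. g (v i1) (z j2))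
      = (real n1 - 1) * (real n2 - 1) * C"
    by (simp add: sum_offdiag_snd sum_offdiag_fst C_def sum_distrib_left[symmetric])
  have 4: "(\<Sum>i1<n1. \<Sum>i2\<in>{..<n1} - {i1}. \<Sum>j1<n2. \<Sum>j2\<in>{..<n2} - {j1}. g (v i2) (z j1))
      = (real n1 - 1) * (real n2 - 1) * C"
    by (simp add: sum_offdiag_snd sum_offdiag_fst C_def sum_distrib_left[symmetric])
  have "U_ho n1 n2 g v z = 1 / (a * b) * (b * A + a * B - 2 * ((real n1 - 1) * (real n2 - 1) * C))"
    unfolding U_ho_def h_ho_def sum_subtractf sum.distrib 1 2 3 4 a_def b_def by simp
  also have "\<dots> = 1 / a * A + 1 / b * B - 2 / (real n1 * real n2) * C"
  proof -
    have "1 / (a * b) * (b * A + a * B - 2 * ((real n1 - 1) * (real n2 - 1) * C))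
      = (b * A) / (a * b) + (a * B) / (a * b)
        - 2 * (((real n1 - 1) * (real n2 - 1)) / (a * b)) * C"
      by (simp add: add_divide_distrib diff_divide_distrib)
    also have "(b * A) / (a * b) = 1 / a * A" using n unfolding a_def b_def by simp
    also have "(a * B) / (a * b) = 1 / b * B" using n unfolding a_def b_def by simp
    also have "((real n1 - 1) * (real n2 - 1)) / (a * b) = 1 / (real n1 * real n2)"
    proof -
      have "(x - 1) * (y - 1) / ((x * (x - 1)) * (y * (y - 1))) = 1 / (x * y)"
        if "x > 1" "y > 1" for x y :: real
        using that by (simp add: divide_simps)
      then show ?thesis unfolding a_def b_def using n by simp
    qed
    finally show ?thesis by simp
  qed
  also have "\<dots> = split_stat g n1 n2 {..<n1} v"
  proof -
    let ?I = "{..<n1 + n2}"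
    let ?c = "\<lambda>p q. coef n1 n2 {..<n1} p q * g (v p) (v q)"
    have row1: "(\<Sum>q\<in>?I - {p}. ?c p q) = 1 / a * (\<Sum>i'\<in>{..<n1} - {p}. g (v p) (v i'))
        - 1 / (real n1 * real n2) * (\<Sum>j<n2. g (v p) (z j))" if p: "p < n1" for p
    proof -
      have "(\<Sum>q\<in>?I - {p}. ?c p q) = (\<Sum>q\<in>?I. if q = p then 0 else ?c p q)"
        by (intro sum.mono_neutral_cong_left) auto
      also have "\<dots> = (\<Sum>q<n1. if q = p then 0 else ?c p q) + (\<Sum>j<n2. ?c p (n1 + j))"
        using p by (simp add: sum_lessThan_add)
      also have "(\<Sum>q<n1. if q = p then 0 else ?c p q) = (\<Sum>q\<in>{..<n1} - {p}. 1 / a * g (v p) (v q))"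
        using p by (intro sum.mono_neutral_cong_right) (auto simp: coef_def a_def)
      also have "(\<Sum>j<n2. ?c p (n1 + j)) = (\<Sum>j<n2. - (1 / (real n1 * real n2) * g (v p) (z j)))"
        using p by (intro sum.cong) (auto simp: coef_def z_def)
      finally show ?thesis by (simp only: sum_distrib_left[symmetric] sum_negf)
    qed
    have row2: "(\<Sum>q\<in>?I - {n1 + j}. ?c (n1 + j) q) = 1 / b * (\<Sum>j'\<in>{..<n2} - {j}. g (z j) (z j'))
        - 1 / (real n1 * real n2) * (\<Sum>i<n1. g (v i) (z j))" if j: "j < n2" for j
    proof -
      have "(\<Sum>q\<in>?I - {n1 + j}. ?c (n1 + j) q) = (\<Sum>q\<in>?I. if q = n1 + j then 0 else ?c (n1 + j) q)"
        by (intro sum.mono_neutral_cong_left) auto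
      also have "\<dots> = (\<Sum>q<n1. ?c (n1 + j) q) + (\<Sum>j'<n2. if j' = j then 0 else ?c (n1 + j) (n1 + j'))"
        unfolding sum_lessThan_add by (intro arg_cong2[where f = "(+)"] sum.cong) auto
      also have "(\<Sum>j'<n2. if j' = j then 0 else ?c (n1 + j) (n1 + j')) = (\<Sum>j'\<in>{..<n2} - {j}. 1 / b * g (z j) (z j'))"
        using j by (intro sum.mono_neutral_cong_right) (auto simp: coef_def b_def z_def)
      also have "(\<Sum>q<n1. ?c (n1 + j) q) = (\<Sum>i<n1. - (1 / (real n1 * real n2) * g (v i) (z j)))"
        using j by (intro sum.cong) (auto simp: coef_def z_def sym)
      finally show ?thesis by (simp only: sum_distrib_left[symmetric] sum_negf)
    qed
    have "split_stat g n1 n2 {..<n1} v = (\<Sum>p<n1. \<Sum>q\<in>?I - {p}. ?c p q) + (\<Sum>j<n2. \<Sum>q\<in>?I - {n1 + j}. ?c (n1 + j) q)"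
      unfolding split_stat_def by (rule sum_lessThan_add)
    also have "\<dots> = (\<Sum>p<n1. 1 / a * (\<Sum>i'\<in>{..<n1} - {p}. g (v p) (v i'))
        - 1 / (real n1 * real n2) * (\<Sum>j<n2. g (v p) (z j)))
      + (\<Sum>j<n2. 1 / b * (\<Sum>j'\<in>{..<n2} - {j}. g (z j) (z j'))
        - 1 / (real n1 * real n2) * (\<Sum>i<n1. g (v i) (z j)))"
      by (intro arg_cong2[where f = "(+)"] sum.cong refl row1 row2) auto
    also have "\<dots> = 1 / a * A - 1 / (real n1 * real n2) * C + (1 / b * B - 1 / (real n1 * real n2) * C)"
    proof -
      have "(\<Sum>j<n2. \<Sum>i<n1. g (v i) (z j)) = C" unfolding C_def by (rule sum.swap)
      then show ?thesis
        unfolding sum_subtractf sum_distrib_left[symmetric] A_def B_def by (simp add: C_def)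
    qed
    finally show ?thesis by simp
  qed
  finally show ?thesis unfolding z_def .
qed

text \<open>Relabelling the data by a bijection of the indices is the same as moving the split.\<close>

lemma split_stat_reindex:
  assumes "bij_betw \<sigma> {..<n1 + n2} {..<n1 + n2}"
  shows "split_stat g n1 n2 {..<n1} (\<lambda>k. x (\<sigma> k)) = split_stat g n1 n2 (\<sigma> ` {..<n1}) x"
proof -
  let ?I = "{..<n1 + n2}"
  have inj: "inj_on \<sigma> ?I" and im: "\<sigma> ` ?I = ?I" using assms by (auto simp: bij_betw_def)
  have mem: "\<sigma> p \<in> \<sigma> ` {..<n1} \<longleftrightarrow> p < n1" if "p \<in> ?I" for p
    using inj that by (auto simp: inj_on_def) (metis add_strict_increasing2 lessThan_iff zero_le order_less_le_trans le_add1)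
  have "split_stat g n1 n2 (\<sigma> ` {..<n1}) x
      = (\<Sum>p\<in>?I. \<Sum>q\<in>?I - {\<sigma> p}. coef n1 n2 (\<sigma> ` {..<n1}) (\<sigma> p) q * g (x (\<sigma> p)) (x q))"
    unfolding split_stat_def
    using sum.reindex_bij_betw[OF assms, of "\<lambda>p. \<Sum>q\<in>?I - {p}. coef n1 n2 (\<sigma> ` {..<n1}) p q * g (x p) (x q)"]
    by simp
  also have "\<dots> = (\<Sum>p\<in>?I. \<Sum>q\<in>?I - {p}. coef n1 n2 (\<sigma> ` {..<n1}) (\<sigma> p) (\<sigma> q) * g (x (\<sigma> p)) (x (\<sigma> q)))"
  proof (rule sum.cong[OF refl])
    fix p assume p: "p \<in> ?I"
    have "\<sigma> ` (?I - {p}) = ?I - {\<sigma> p}"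
      using im inj_on_image_set_diff[OF inj, of ?I "{p}"] p by auto
    then have "bij_betw \<sigma> (?I - {p}) (?I - {\<sigma> p})"
      using inj by (auto simp: bij_betw_def inj_on_def)
    then show "(\<Sum>q\<in>?I - {\<sigma> p}. coef n1 n2 (\<sigma> ` {..<n1}) (\<sigma> p) q * g (x (\<sigma> p)) (x q))
      = (\<Sum>q\<in>?I - {p}. coef n1 n2 (\<sigma> ` {..<n1}) (\<sigma> p) (\<sigma> q) * g (x (\<sigma> p)) (x (\<sigma> q)))"
      using sum.reindex_bij_betw[of \<sigma> "?I - {p}" "?I - {\<sigma> p}"
          "\<lambda>q. coef n1 n2 (\<sigma> ` {..<n1}) (\<sigma> p) q * g (x (\<sigma> p)) (x q)"] by simp
  qed
  also have "\<dots> = split_stat g n1 n2 {..<n1} (\<lambda>k. x (\<sigma> k))"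
    unfolding split_stat_def by (intro sum.cong refl) (auto simp: coef_def mem)
  finally show ?thesis ..
qed

text \<open>The total coefficient that the point \<open>p\<close> gives to the points of the first sample.
  Because rows sum to 0, the second sample receives the negative of it, so that this one number
  records how the split \<open>S\<close> contrasts the two laws at \<open>p\<close>.\<close>

definition label_weight :: "nat \<Rightarrow> nat \<Rightarrow> nat set \<Rightarrow> nat \<Rightarrow> real" where
  "label_weight n1 n2 S p = (\<Sum>q\<in>{..<n1} - {p}. coef n1 n2 S p q)"

definition frac1 :: "nat \<Rightarrow> nat set \<Rightarrow> real" where
  "frac1 n1 S = real (card (S \<inter> {..<n1})) / real n1"

definition frac2 :: "nat \<Rightarrow> nat \<Rightarrow> nat set \<Rightarrow> real" where
  "frac2 n1 n2 S = real (card ({..<n1} - S)) / real n2"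

text \<open>How well the split \<open>S\<close> separates the two samples: 1 if \<open>S\<close> is the
  first sample, near 0 for a typical random split.\<close>

definition disc :: "nat \<Rightarrow> nat \<Rightarrow> nat set \<Rightarrow> real" where
  "disc n1 n2 S = frac1 n1 S - frac2 n1 n2 S"

lemma sum_label:
  fixes a b :: real
  assumes "finite S"
  shows "(\<Sum>p\<in>S. if p < n then a else b) = real (card (S \<inter> {..<n})) * a + real (card (S - {..<n})) * b"
proof -
  have "(\<Sum>p\<in>S. if p < n then a else b) = (\<Sum>p\<in>S \<inter> {p. p < n}. a) + (\<Sum>p\<in>S \<inter> - {p. p < n}. b)"
    by (rule sum.If_cases[OF assms])
  moreover have "S \<inter> - {p. p < n} = S - {..<n}" "S \<inter> {p. p < n} = S \<inter> {..<n}" by auto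
  ultimately show ?thesis by simp
qed

context
  fixes n1 n2 :: nat and S :: "nat set"
  assumes n: "2 \<le> n1" "2 \<le> n2" and S: "S \<subseteq> {..<n1 + n2}" and cS: "card S = n1"
begin

private abbreviation "I \<equiv> {..<n1 + n2}"
private abbreviation "c \<equiv> coef n1 n2 S"
private abbreviation "d \<equiv> label_weight n1 n2 S"
private abbreviation "yb \<equiv> frac1 n1 S"
private abbreviation "zb \<equiv> frac2 n1 n2 S"
private abbreviation "\<Delta> \<equiv> disc n1 n2 S"

lemma split_cards:
  "finite S" "card (I - S) = n2"
  "real (card (S \<inter> {..<n1})) = real n1 * yb"
  "real (card (S - {..<n1})) = real n1 * (1 - yb)"
  "real (card ({..<n1} - S)) = real n2 * zb"
  "real (card ((I - S) \<inter> {..<n1})) = real n2 * zb"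
  "real (card ((I - S) - {..<n1})) = real n2 * (1 - zb)"
  "real n1 * yb + real n2 * zb = real n1"
proof -
  show fS: "finite S" using S finite_subset by auto
  show c2: "card (I - S) = n2" using card_Diff_subset[OF fS S] cS by simp
  show 3: "real (card (S \<inter> {..<n1})) = real n1 * yb" using n by (simp add: frac1_def)
  show "real (card (S - {..<n1})) = real n1 * (1 - yb)"
  proof -
    have "card S = card (S \<inter> {..<n1}) + card (S - {..<n1})"
      using fS by (rule card_Int_Diff)
    then show ?thesis using 3 cS by (simp add: algebra_simps)
  qed
  show 5: "real (card ({..<n1} - S)) = real n2 * zb" using n by (simp add: frac2_def)
  have e: "(I - S) \<inter> {..<n1} = {..<n1} - S" by auto
  then show 6: "real (card ((I - S) \<inter> {..<n1})) = real n2 * zb" using 5 by simp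
  show "real (card ((I - S) - {..<n1})) = real n2 * (1 - zb)"
  proof -
    have "card (I - S) = card ((I - S) \<inter> {..<n1}) + card ((I - S) - {..<n1})"
      by (rule card_Int_Diff) simp
    then show ?thesis using 6 c2 by (simp add: algebra_simps)
  qed
  have "card {..<n1} = card ({..<n1} \<inter> S) + card ({..<n1} - S)"
    by (rule card_Int_Diff) simp
  then show "real n1 * yb + real n2 * zb = real n1" using 3 5 by (simp add: Int_commute)
qed

lemma fracs_bounds: "0 \<le> yb" "yb \<le> 1" "0 \<le> zb" "zb \<le> 1"
proof -
  show y: "0 \<le> yb" and z: "0 \<le> zb" by (auto simp: frac1_def frac2_def)
  show "yb \<le> 1"
  proof -
    have "real n1 * yb \<le> real n1 * 1" using split_cards(8) z n by (smt (verit) mult_nonneg_nonneg of_nat_0_le_iff)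
    then show ?thesis using n by (subst (asm) mult_le_cancel_left_pos) auto
  qed
  have "0 \<le> real n2 * (1 - zb)" unfolding split_cards(7)[symmetric] by simp
  then show "zb \<le> 1" using n by (simp add: zero_le_mult_iff)
qed

lemma coef_row_sum:
  assumes "p \<in> I"
  shows "(\<Sum>q\<in>I - {p}. c p q) = 0"
proof -
  have split: "(\<Sum>q\<in>I - {p}. c p q) = (\<Sum>q\<in>S - {p}. c p q) + (\<Sum>q\<in>(I - S) - {p}. c p q)"
    using S split_cards(1) by (intro sum_disjoint_parts) auto
  show ?thesis
  proof (cases "p \<in> S")
    case True
    have "(\<Sum>q\<in>S - {p}. c p q) = (\<Sum>q\<in>S - {p}. 1 / (real n1 * (real n1 - 1)))"
      using True by (intro sum.cong) (auto simp: coef_def)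
    also have "\<dots> = (real n1 - 1) * (1 / (real n1 * (real n1 - 1)))"
      using real_card_remove[OF split_cards(1) True] cS by simp
    also have "\<dots> = 1 / real n1" using n by simp
    finally have "(\<Sum>q\<in>S - {p}. c p q) = 1 / real n1" .
    moreover have "(\<Sum>q\<in>(I - S) - {p}. c p q) = (\<Sum>q\<in>I - S. - 1 / (real n1 * real n2))"
      using True by (intro sum.cong) (auto simp: coef_def)
    moreover have "\<dots> = - 1 / real n1" using n split_cards(2) by simp
    ultimately show ?thesis unfolding split by simp
  next
    case False
    have "(\<Sum>q\<in>(I - S) - {p}. c p q) = (\<Sum>q\<in>(I - S) - {p}. 1 / (real n2 * (real n2 - 1)))"
      using False by (intro sum.cong) (auto simp: coef_def)
    also have "\<dots> = (real n2 - 1) * (1 / (real n2 * (real n2 - 1)))"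
      using real_card_remove[of "I - S" p] False assms split_cards(2) by simp
    also have "\<dots> = 1 / real n2" using n by simp
    finally have "(\<Sum>q\<in>(I - S) - {p}. c p q) = 1 / real n2" .
    moreover have "(\<Sum>q\<in>S - {p}. c p q) = (\<Sum>q\<in>S. - 1 / (real n1 * real n2))"
      using False by (intro sum.cong) (auto simp: coef_def)
    moreover have "\<dots> = - 1 / real n2" using n cS by simp
    ultimately show ?thesis unfolding split by simp
  qed
qed

text \<open>Only the numbers of first-sample points in the two groups matter, and one of them is lowered by
  1 if \<open>p\<close> itself belongs to the first sample. This correction is what makes the
  weights differ from a multiple of the discrepancy.\<close>

lemma label_weight_in:
  assumes "p \<in> S"
  shows "d p = (\<Delta> + (yb - of_bool (p < n1)) / (real n1 - 1)) / real n1"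
proof -
  have "d p = (\<Sum>q\<in>{..<n1} \<inter> S - {p}. c p q) + (\<Sum>q\<in>{..<n1} - S. c p q)"
    unfolding label_weight_def using assms by (intro sum_disjoint_parts) auto
  also have "(\<Sum>q\<in>{..<n1} \<inter> S - {p}. c p q) = (\<Sum>q\<in>{..<n1} \<inter> S - {p}. 1 / (real n1 * (real n1 - 1)))"
    using assms by (intro sum.cong) (auto simp: coef_def)
  also have "\<dots> = (real n1 * yb - of_bool (p < n1)) / (real n1 * (real n1 - 1))"
  proof -
    have "real (card ({..<n1} \<inter> S - {p})) = real n1 * yb - of_bool (p < n1)"
    proof (cases "p < n1")
      case True
      then have "p \<in> {..<n1} \<inter> S" using assms by auto
      then have "real (card ({..<n1} \<inter> S - {p})) = real (card ({..<n1} \<inter> S)) - 1"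
        by (intro real_card_remove) auto
      then show ?thesis using True split_cards(3) by (simp add: Int_commute)
    next
      case False
      then have "{..<n1} \<inter> S - {p} = {..<n1} \<inter> S" by auto
      then show ?thesis using False split_cards(3) by (simp add: Int_commute)
    qed
    then show ?thesis by simp
  qed
  also have "(\<Sum>q\<in>{..<n1} - S. c p q) = (\<Sum>q\<in>{..<n1} - S. - 1 / (real n1 * real n2))"
    using assms by (intro sum.cong) (auto simp: coef_def)
  also have "\<dots> = - zb / real n1" using split_cards(5) n by simp
  also have "(real n1 * yb - of_bool (p < n1)) / (real n1 * (real n1 - 1)) + - zb / real n1
      = (\<Delta> + (yb - of_bool (p < n1)) / (real n1 - 1)) / real n1"
  proof -
    have "(a * y - e) / (a * (a - 1)) + - w / a = ((y - w) + (y - e) / (a - 1)) / a"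
      if "a > 1" for a y e w :: real
      using that by (simp add: field_simps)
    then show ?thesis unfolding disc_def using n by simp
  qed
  finally show ?thesis .
qed

text \<open>The same count for a point of the second group.\<close>

lemma label_weight_out:
  assumes "p \<in> I - S"
  shows "d p = (- \<Delta> + (zb - of_bool (p < n1)) / (real n2 - 1)) / real n2"
proof -
  have "d p = (\<Sum>q\<in>{..<n1} \<inter> S. c p q) + (\<Sum>q\<in>{..<n1} - S - {p}. c p q)"
    unfolding label_weight_def using assms by (intro sum_disjoint_parts) auto
  also have "(\<Sum>q\<in>{..<n1} - S - {p}. c p q) = (\<Sum>q\<in>{..<n1} - S - {p}. 1 / (real n2 * (real n2 - 1)))"
    using assms by (intro sum.cong) (auto simp: coef_def)
  also have "\<dots> = (real n2 * zb - of_bool (p < n1)) / (real n2 * (real n2 - 1))"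
  proof -
    have "real (card ({..<n1} - S - {p})) = real n2 * zb - of_bool (p < n1)"
    proof (cases "p < n1")
      case True
      then have "p \<in> {..<n1} - S" using assms by auto
      then have "real (card ({..<n1} - S - {p})) = real (card ({..<n1} - S)) - 1"
        by (intro real_card_remove) auto
      then show ?thesis using True split_cards(5) by simp
    next
      case False
      then have "{..<n1} - S - {p} = {..<n1} - S" by auto
      then show ?thesis using False split_cards(5) by simp
    qed
    then show ?thesis by simp
  qed
  also have "(\<Sum>q\<in>{..<n1} \<inter> S. c p q) = (\<Sum>q\<in>{..<n1} \<inter> S. - 1 / (real n1 * real n2))"
    using assms by (intro sum.cong) (auto simp: coef_def)
  also have "\<dots> = - yb / real n2" using split_cards(3) n by (simp add: Int_commute)
  also have "- yb / real n2 + (real n2 * zb - of_bool (p < n1)) / (real n2 * (real n2 - 1))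
      = (- \<Delta> + (zb - of_bool (p < n1)) / (real n2 - 1)) / real n2"
  proof -
    have "- w / a + (a * y - e) / (a * (a - 1)) = (- (w - y) + (y - e) / (a - 1)) / a"
      if "a > 1" for a y e w :: real
      using that by (simp add: field_simps)
    then show ?thesis unfolding disc_def using n by simp
  qed
  finally show ?thesis .
qed

lemma sum_over_split:
  fixes F :: "nat \<Rightarrow> real"
  shows "(\<Sum>p\<in>I. F p) = (\<Sum>p\<in>S. F p) + (\<Sum>p\<in>I - S. F p)"
  using S split_cards(1) by (subst sum.subset_diff[OF S]) auto

lemma sum_over_in:
  fixes F :: "real \<Rightarrow> real"
  shows "(\<Sum>p\<in>S. F (of_bool (p < n1))) = real n1 * (yb * F 1 + (1 - yb) * F 0)"
proof -
  have "(\<Sum>p\<in>S. F (of_bool (p < n1))) = (\<Sum>p\<in>S. if p < n1 then F 1 else F 0)"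
    by (intro sum.cong) auto
  then show ?thesis by (simp add: sum_label split_cards algebra_simps)
qed

lemma sum_over_out:
  fixes F :: "real \<Rightarrow> real"
  shows "(\<Sum>p\<in>I - S. F (of_bool (p < n1))) = real n2 * (zb * F 1 + (1 - zb) * F 0)"
proof -
  have "(\<Sum>p\<in>I - S. F (of_bool (p < n1))) = (\<Sum>p\<in>I - S. if p < n1 then F 1 else F 0)"
    by (intro sum.cong) auto
  then show ?thesis by (simp only: sum_label finite_Diff finite_lessThan split_cards) (simp add: algebra_simps)
qed

text \<open>The sum does not depend on the split, so that the degenerate term has the same size for every
  permutation.\<close>

lemma coef_square_sum:
  "(\<Sum>p\<in>I. \<Sum>q\<in>I - {p}. (c p q)^2)
    = 1 / (real n1 * (real n1 - 1)) + 1 / (real n2 * (real n2 - 1)) + 2 / (real n1 * real n2)"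
proof -
  have inn: "(\<Sum>q\<in>I - {p}. (c p q)^2) = (real n1 - 1) * (1 / (real n1 * (real n1 - 1)))^2
      + real n2 * (1 / (real n1 * real n2))^2" if "p \<in> S" for p
  proof -
    have "(\<Sum>q\<in>I - {p}. (c p q)^2) = (\<Sum>q\<in>S - {p}. (c p q)^2) + (\<Sum>q\<in>I - S. (c p q)^2)"
      using S that split_cards(1) by (intro sum_disjoint_parts) auto
    also have "(\<Sum>q\<in>S - {p}. (c p q)^2) = (\<Sum>q\<in>S - {p}. (1 / (real n1 * (real n1 - 1)))^2)"
      using that by (intro sum.cong) (auto simp: coef_def)
    also have "(\<Sum>q\<in>I - S. (c p q)^2) = (\<Sum>q\<in>I - S. (1 / (real n1 * real n2))^2)"
      using that by (intro sum.cong) (auto simp: coef_def power_divide)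
    finally show ?thesis using cS split_cards(2) real_card_remove[OF split_cards(1) that] by simp
  qed
  have out: "(\<Sum>q\<in>I - {p}. (c p q)^2) = (real n2 - 1) * (1 / (real n2 * (real n2 - 1)))^2
      + real n1 * (1 / (real n1 * real n2))^2" if "p \<in> I - S" for p
  proof -
    have "(\<Sum>q\<in>I - {p}. (c p q)^2) = (\<Sum>q\<in>I - S - {p}. (c p q)^2) + (\<Sum>q\<in>S. (c p q)^2)"
      using S that split_cards(1) by (intro sum_disjoint_parts) auto
    also have "(\<Sum>q\<in>I - S - {p}. (c p q)^2) = (\<Sum>q\<in>I - S - {p}. (1 / (real n2 * (real n2 - 1)))^2)"
      using that by (intro sum.cong) (auto simp: coef_def)
    also have "(\<Sum>q\<in>S. (c p q)^2) = (\<Sum>q\<in>S. (1 / (real n1 * real n2))^2)"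
      using that by (intro sum.cong) (auto simp: coef_def power_divide)
    finally show ?thesis using cS split_cards(2) real_card_remove[OF _ that] by simp
  qed
  have "(\<Sum>p\<in>I. \<Sum>q\<in>I - {p}. (c p q)^2)
     = (\<Sum>p\<in>S. \<Sum>q\<in>I - {p}. (c p q)^2) + (\<Sum>p\<in>I - S. \<Sum>q\<in>I - {p}. (c p q)^2)"
    by (rule sum_over_split)
  also have "\<dots> = real n1 * ((real n1 - 1) * (1 / (real n1 * (real n1 - 1)))^2 + real n2 * (1 / (real n1 * real n2))^2)
    + real n2 * ((real n2 - 1) * (1 / (real n2 * (real n2 - 1)))^2 + real n1 * (1 / (real n1 * real n2))^2)"
    using inn out cS split_cards(2) by simp
  also have "\<dots> = 1 / (real n1 * (real n1 - 1)) + 1 / (real n2 * (real n2 - 1)) + 2 / (real n1 * real n2)"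
  proof -
    have "a * (u * (1 / (a * u))^2 + b * (1 / (a * b))^2)
      = 1 / (a * u) + 1 / (a * b)" if "a > 0" "u > 0" "b > 0" for a u b :: real
      using that by (simp add: power2_eq_square field_simps)
    from this[of "real n1" "real n1 - 1" "real n2"] this[of "real n2" "real n2 - 1" "real n1"] show ?thesis
      using n by (simp add: mult.commute)
  qed
  finally show ?thesis .
qed

text \<open>Without the diagonal correction the sum would be the square of the discrepancy; the correction
  only subtracts variances of zero-one labels. Hence the signal left after a permutation is at
  most the squared discrepancy times the original signal.\<close>

lemma label_weight_sum_le: "(\<Sum>p<n1. d p) \<le> \<Delta>^2"
proof -
  have "(\<Sum>p<n1. d p) = (\<Sum>p\<in>I. of_bool (p < n1) * d p)"
    by (intro sum.mono_neutral_cong_left) auto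
  also have "\<dots> = (\<Sum>p\<in>S. of_bool (p < n1) * d p) + (\<Sum>p\<in>I - S. of_bool (p < n1) * d p)"
    by (rule sum_over_split)
  also have "(\<Sum>p\<in>S. of_bool (p < n1) * d p)
      = (\<Sum>p\<in>S. (\<lambda>t. t * ((\<Delta> + (yb - t) / (real n1 - 1)) / real n1)) (of_bool (p < n1)))"
    by (intro sum.cong) (auto simp: label_weight_in)
  also have "\<dots> = real n1 * (yb * (1 * ((\<Delta> + (yb - 1) / (real n1 - 1)) / real n1))
      + (1 - yb) * (0 * ((\<Delta> + (yb - 0) / (real n1 - 1)) / real n1)))"
    by (rule sum_over_in)
  also have "\<dots> = yb * (\<Delta> + (yb - 1) / (real n1 - 1))" using n by simp
  also have "(\<Sum>p\<in>I - S. of_bool (p < n1) * d p)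
      = (\<Sum>p\<in>I - S. (\<lambda>t. t * ((- \<Delta> + (zb - t) / (real n2 - 1)) / real n2)) (of_bool (p < n1)))"
    by (intro sum.cong refl) (simp add: label_weight_out)
  also have "\<dots> = real n2 * (zb * (1 * ((- \<Delta> + (zb - 1) / (real n2 - 1)) / real n2))
      + (1 - zb) * (0 * ((- \<Delta> + (zb - 0) / (real n2 - 1)) / real n2)))"
    by (rule sum_over_out)
  also have "\<dots> = zb * (- \<Delta> + (zb - 1) / (real n2 - 1))" using n by simp
  also have "yb * (\<Delta> + (yb - 1) / (real n1 - 1)) \<le> yb * \<Delta>"
    using fracs_bounds n by (intro mult_left_mono) (auto simp: divide_le_0_iff)
  also have "zb * (- \<Delta> + (zb - 1) / (real n2 - 1)) \<le> zb * (- \<Delta>)"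
    using fracs_bounds n by (intro mult_left_mono) (auto simp: divide_le_0_iff)
  also have "yb * \<Delta> + zb * (- \<Delta>) = \<Delta>^2" by (simp add: disc_def power2_eq_square algebra_simps)
  finally show ?thesis by simp
qed

text \<open>Summing by columns, each column sum vanishes.\<close>

lemma label_weight_total: "(\<Sum>p\<in>I. d p) = 0"
proof -
  have "(\<Sum>p\<in>I. d p) = (\<Sum>p\<in>I. \<Sum>q\<in>{..<n1}. if q = p then 0 else c p q)"
    unfolding label_weight_def by (intro sum.cong refl sum.mono_neutral_cong_left) auto
  also have "\<dots> = (\<Sum>q\<in>{..<n1}. \<Sum>p\<in>I. if q = p then 0 else c p q)" by (rule sum.swap)
  also have "\<dots> = (\<Sum>q\<in>{..<n1}. \<Sum>p\<in>I - {q}. c q p)"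
    by (intro sum.cong refl sum.mono_neutral_cong_right) (auto simp: coef_sym)
  also have "\<dots> = 0" by (intro sum.neutral ballI coef_row_sum) auto
  finally show ?thesis .
qed

text \<open>In each group the weights take two values, one of which is attained by the fraction of
  first-sample points. Their second moment splits exactly into the discrepancy and the variance of
  a zero-one label.\<close>

lemma label_weight_power2_sum:
  "(\<Sum>p\<in>I. (d p)^2) \<le> \<Delta>^2 * (1 / real n1 + 1 / real n2)
     + yb / (real n1 * (real n1 - 1)^2) + zb / (real n2 * (real n2 - 1)^2)"
proof -
  have key: "a * (y * ((x + (y - 1) / (a - 1)) / a)^2 + (1 - y) * ((x + (y - 0) / (a - 1)) / a)^2)
     \<le> x^2 / a + y / (a * (a - 1)^2)" if "a > 1" "0 \<le> y" "y \<le> 1" for a x y :: real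
  proof -
    define k where "k = 1 / (a - 1)"
    have "a * (y * ((x + (y - 1) / (a - 1)) / a)^2 + (1 - y) * ((x + (y - 0) / (a - 1)) / a)^2)
        = (y * (x + (y - 1) * k)^2 + (1 - y) * (x + y * k)^2) / a"
    proof -
      have "a * (y * (A / a)^2 + (1 - y) * (B / a)^2) = (y * A^2 + (1 - y) * B^2) / a" for A B
        using that by (simp add: power_divide power2_eq_square field_simps)
      then show ?thesis unfolding k_def by simp
    qed
    also have "y * (x + (y - 1) * k)^2 + (1 - y) * (x + y * k)^2 = x^2 + y * (1 - y) * k^2"
      by (simp add: power2_eq_square algebra_simps)
    also have "\<dots> / a \<le> (x^2 + y * 1 * k^2) / a"
      using that by (intro divide_right_mono add_left_mono mult_right_mono mult_left_mono) auto
    also have "\<dots> = x^2 / a + y / (a * (a - 1)^2)"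
      unfolding k_def by (simp add: add_divide_distrib power_divide)
    finally show ?thesis .
  qed
  have "(\<Sum>p\<in>I. (d p)^2) = (\<Sum>p\<in>S. (d p)^2) + (\<Sum>p\<in>I - S. (d p)^2)" by (rule sum_over_split)
  also have "(\<Sum>p\<in>S. (d p)^2) = (\<Sum>p\<in>S. (\<lambda>t. ((\<Delta> + (yb - t) / (real n1 - 1)) / real n1)^2) (of_bool (p < n1)))"
    by (intro sum.cong refl) (simp add: label_weight_in)
  also have "\<dots> = real n1 * (yb * ((\<Delta> + (yb - 1) / (real n1 - 1)) / real n1)^2 + (1 - yb) * ((\<Delta> + (yb - 0) / (real n1 - 1)) / real n1)^2)"
    by (rule sum_over_in)
  also have "\<dots> \<le> \<Delta>^2 / real n1 + yb / (real n1 * (real n1 - 1)^2)"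
    using n fracs_bounds by (intro key) auto
  also have "(\<Sum>p\<in>I - S. (d p)^2) = (\<Sum>p\<in>I - S. (\<lambda>t. ((- \<Delta> + (zb - t) / (real n2 - 1)) / real n2)^2) (of_bool (p < n1)))"
    by (intro sum.cong refl) (simp add: label_weight_out)
  also have "\<dots> = real n2 * (zb * ((- \<Delta> + (zb - 1) / (real n2 - 1)) / real n2)^2 + (1 - zb) * ((- \<Delta> + (zb - 0) / (real n2 - 1)) / real n2)^2)"
    by (rule sum_over_out)
  also have "\<dots> \<le> (- \<Delta>)^2 / real n2 + zb / (real n2 * (real n2 - 1)^2)"
    using n fracs_bounds by (intro key) auto
  finally show ?thesis by (simp add: algebra_simps)
qed

text \<open>The fourth-power analogue: \<open>power4_add_le\<close> separates the discrepancy from the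
  diagonal correction.\<close>

lemma label_weight_power4_sum:
  "(\<Sum>p\<in>I. (d p)^4) \<le> 64 / 27 * \<Delta>^4 * (1 / real n1 ^ 3 + 1 / real n2 ^ 3)
     + 64 * (yb / (real n1 ^ 3 * (real n1 - 1)^4) + zb / (real n2 ^ 3 * (real n2 - 1)^4))"
proof -
  have key: "a * (y * ((x + (y - 1) / (a - 1)) / a)^4 + (1 - y) * ((x + (y - 0) / (a - 1)) / a)^4)
     \<le> 64 / 27 * x^4 / a^3 + 64 * (y / (a^3 * (a - 1)^4))" if "a > 1" "0 \<le> y" "y \<le> 1" for a x y :: real
  proof -
    define k where "k = 1 / (a - 1)"
    have k: "k > 0" using that unfolding k_def by simp
    have pow: "(x + w)^4 \<le> 64 / 27 * x^4 + 64 * w^4" for w :: real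
    proof -
      have "(x + w)^4 = \<bar>x + w\<bar>^4" by simp
      also have "\<dots> \<le> (\<bar>x\<bar> + \<bar>w\<bar>)^4" by (intro power_mono) auto
      also have "\<dots> \<le> 64 / 27 * \<bar>x\<bar>^4 + 64 * \<bar>w\<bar>^4" by (intro power4_add_le) auto
      finally show ?thesis by simp
    qed
    have "a * (y * ((x + (y - 1) / (a - 1)) / a)^4 + (1 - y) * ((x + (y - 0) / (a - 1)) / a)^4)
        = (y * (x + (y - 1) * k)^4 + (1 - y) * (x + y * k)^4) / a^3"
    proof -
      have "a * (y * (A / a)^4 + (1 - y) * (B / a)^4) = (y * A^4 + (1 - y) * B^4) / a^3" for A B
        using that by (simp add: power_divide power4_eq_xxxx power3_eq_cube field_simps)
      then show ?thesis unfolding k_def by simp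
    qed
    also have "\<dots> \<le> (64 / 27 * x^4 + 64 * (y * k^4)) / a^3"
    proof (intro divide_right_mono)
      have "y * (x + (y - 1) * k)^4 + (1 - y) * (x + y * k)^4
         \<le> y * (64 / 27 * x^4 + 64 * ((y - 1) * k)^4) + (1 - y) * (64 / 27 * x^4 + 64 * (y * k)^4)"
        using that by (intro add_mono mult_left_mono pow) auto
      also have "\<dots> = 64 / 27 * x^4 + 64 * (y * k^4) * ((1 - y)^4 + (1 - y) * y^3)"
      proof -
        have "y * (K + 64 * ((y - 1) * k)^4) + (1 - y) * (K + 64 * (y * k)^4)
          = K + 64 * (y * k^4) * ((1 - y)^4 + (1 - y) * y^3)" for K
          by (simp add: power_mult_distrib eval_nat_numeral algebra_simps)
        then show ?thesis .
      qed
      also have "\<dots> \<le> 64 / 27 * x^4 + 64 * (y * k^4) * 1"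
      proof (intro add_left_mono mult_left_mono)
        have "(1 - y)^4 \<le> (1 - y)" using that power_decreasing[of 1 4 "1 - y"] by simp
        moreover have "(1 - y) * y^3 \<le> 1 * y"
          using that power_decreasing[of 1 3 y] by (intro mult_mono) auto
        ultimately show "(1 - y)^4 + (1 - y) * y^3 \<le> 1" by simp
      qed (use that k in auto)
      finally show "y * (x + (y - 1) * k)^4 + (1 - y) * (x + y * k)^4 \<le> 64 / 27 * x^4 + 64 * (y * k^4)"
        by simp
    qed (use that in auto)
    also have "\<dots> = 64 / 27 * x^4 / a^3 + 64 * (y / (a^3 * (a - 1)^4))"
      unfolding k_def by (simp add: add_divide_distrib power_divide)
    finally show ?thesis .
  qed
  have "(\<Sum>p\<in>I. (d p)^4) = (\<Sum>p\<in>S. (d p)^4) + (\<Sum>p\<in>I - S. (d p)^4)" by (rule sum_over_split)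
  also have "(\<Sum>p\<in>S. (d p)^4) = (\<Sum>p\<in>S. (\<lambda>t. ((\<Delta> + (yb - t) / (real n1 - 1)) / real n1)^4) (of_bool (p < n1)))"
    by (intro sum.cong refl) (simp add: label_weight_in)
  also have "\<dots> = real n1 * (yb * ((\<Delta> + (yb - 1) / (real n1 - 1)) / real n1)^4 + (1 - yb) * ((\<Delta> + (yb - 0) / (real n1 - 1)) / real n1)^4)"
    by (rule sum_over_in)
  also have "\<dots> \<le> 64 / 27 * \<Delta>^4 / real n1 ^ 3 + 64 * (yb / (real n1 ^ 3 * (real n1 - 1)^4))"
    using n fracs_bounds by (intro key) auto
  also have "(\<Sum>p\<in>I - S. (d p)^4) = (\<Sum>p\<in>I - S. (\<lambda>t. ((- \<Delta> + (zb - t) / (real n2 - 1)) / real n2)^4) (of_bool (p < n1)))"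
    by (intro sum.cong refl) (simp add: label_weight_out)
  also have "\<dots> = real n2 * (zb * ((- \<Delta> + (zb - 1) / (real n2 - 1)) / real n2)^4 + (1 - zb) * ((- \<Delta> + (zb - 0) / (real n2 - 1)) / real n2)^4)"
    by (rule sum_over_out)
  also have "\<dots> \<le> 64 / 27 * (- \<Delta>)^4 / real n2 ^ 3 + 64 * (zb / (real n2 ^ 3 * (real n2 - 1)^4))"
    using n fracs_bounds by (intro key) auto
  finally show ?thesis by (simp add: add_divide_distrib algebra_simps)
qed

end

section \<open>Product measures and square-integrable functions\<close>

text \<open>Replacing one coordinate of a product measure by an independent copy preserves the measure. This
  makes conditioning on all other coordinates a one-dimensional integral.\<close>

lemma PiM_resample:
  fixes M :: "'i \<Rightarrow> 'a measure"
  assumes I: "finite I" and M: "\<And>i. prob_space (M i)" and k: "k \<in> I"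
  shows "distr (PiM I M \<Otimes>\<^sub>M M k) (PiM I M) (\<lambda>(w, v). w(k := v)) = PiM I M"
proof -
  interpret finite_product_prob_space M I
    using I M by (auto simp: finite_product_prob_space_def product_prob_space_def
        finite_product_sigma_finite_def finite_product_sigma_finite_axioms_def
        product_sigma_finite_def product_prob_space_axioms_def prob_space_imp_sigma_finite)
  have ins: "insert k I = I" using k by auto
  have meas: "(\<lambda>(w, v). w(k := v)) \<in> PiM I M \<Otimes>\<^sub>M M k \<rightarrow>\<^sub>M PiM I M"
    using measurable_add_dim[of k I M] unfolding ins .
  show ?thesis
  proof (rule PiM_eqI[OF I])
    fix A assume A: "\<And>i. i \<in> I \<Longrightarrow> A i \<in> sets (M i)"
    define B where "B i = (if i = k then space (M k) else A i)" for i
    have B: "\<And>i. i \<in> I \<Longrightarrow> B i \<in> sets (M i)" using A by (auto simp: B_def)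
    have "emeasure (distr (PiM I M \<Otimes>\<^sub>M M k) (PiM I M) (\<lambda>(w, v). w(k := v))) (Pi\<^sub>E I A)
        = emeasure (PiM I M \<Otimes>\<^sub>M M k) ((\<lambda>(w, v). w(k := v)) -` (Pi\<^sub>E I A) \<inter> space (PiM I M \<Otimes>\<^sub>M M k))"
      using A by (intro emeasure_distr meas sets_PiM_I_finite I) auto
    also have "(\<lambda>(w, v). w(k := v)) -` (Pi\<^sub>E I A) \<inter> space (PiM I M \<Otimes>\<^sub>M M k) = Pi\<^sub>E I B \<times> A k"
    proof (rule set_eqI, clarify)
      fix w v
      have sub: "x \<in> space (M i)" if "i \<in> I" "x \<in> A i" for i x
        using A[THEN sets.sets_into_space] that by blast
      show "(w, v) \<in> (\<lambda>(w, v). w(k := v)) -` (Pi\<^sub>E I A) \<inter> space (PiM I M \<Otimes>\<^sub>M M k)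
          \<longleftrightarrow> (w, v) \<in> Pi\<^sub>E I B \<times> A k" (is "?L \<longleftrightarrow> ?R")
      proof
        assume ?L
        then have 1: "\<And>i. i \<in> I \<Longrightarrow> (w(k := v)) i \<in> A i" and 2: "w \<in> extensional I"
          "\<And>i. i \<in> I \<Longrightarrow> w i \<in> space (M i)"
          by (auto simp: space_pair_measure space_PiM PiE_iff)
        from 1[OF k] have "v \<in> A k" by simp
        moreover have "w i \<in> B i" if "i \<in> I" for i
          using 1[OF that] 2(2)[OF that] by (auto simp: B_def split: if_splits)
        ultimately show ?R using 2 by (auto simp: PiE_iff)
      next
        assume ?R
        then have v: "v \<in> A k" and w: "\<And>i. i \<in> I \<Longrightarrow> w i \<in> B i" "w \<in> extensional I"
          by (auto simp: PiE_iff)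
        have "(w(k := v)) i \<in> A i" "w i \<in> space (M i)" if "i \<in> I" for i
          using v w(1)[OF that] sub[OF that] by (auto simp: B_def split: if_splits)
        moreover have "w(k := v) \<in> extensional I" using w(2) k by (auto simp: extensional_def)
        ultimately show ?L using w(2) v sub[OF k] by (auto simp: space_pair_measure space_PiM PiE_iff)
      qed
    qed
    also have "emeasure (PiM I M \<Otimes>\<^sub>M M k) (Pi\<^sub>E I B \<times> A k) = emeasure (PiM I M) (Pi\<^sub>E I B) * emeasure (M k) (A k)"
      using A B k I by (intro M.emeasure_pair_measure_Times sets_PiM_I_finite) auto
    also have "emeasure (PiM I M) (Pi\<^sub>E I B) = (\<Prod>i\<in>I. emeasure (M i) (B i))"
      using B I by (intro emeasure_PiM) auto
    also have "\<dots> = (\<Prod>i\<in>I - {k}. emeasure (M i) (A i))"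
      using I k by (subst prod.remove[of _ k]) (auto simp: B_def M.emeasure_space_1 intro!: prod.cong)
    also have "\<dots> * emeasure (M k) (A k) = (\<Prod>i\<in>I. emeasure (M i) (A i))"
      using I k by (subst (2) prod.remove[of _ k]) (auto simp: mult.commute)
    finally show "emeasure (distr (PiM I M \<Otimes>\<^sub>M M k) (PiM I M) (\<lambda>(w, v). w(k := v))) (Pi\<^sub>E I A)
      = (\<Prod>i\<in>I. emeasure (M i) (A i))" .
  qed simp
qed

lemma PiM_resample_integral:
  fixes M :: "'i \<Rightarrow> 'a measure" and F :: "('i \<Rightarrow> 'a) \<Rightarrow> real"
  assumes I: "finite I" and M: "\<And>i. prob_space (M i)" and k: "k \<in> I"
    and F: "integrable (PiM I M) F"
  shows "integral\<^sup>L (PiM I M) F = (\<integral>w. (\<integral>v. F (w(k := v)) \<partial>M k) \<partial>PiM I M)"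
    and "integrable (PiM I M) (\<lambda>w. \<integral>v. F (w(k := v)) \<partial>M k)"
    and "AE w in PiM I M. integrable (M k) (\<lambda>v. F (w(k := v)))"
proof -
  interpret Mk: prob_space "M k" by (rule M)
  interpret PP: prob_space "PiM I M" by (intro prob_space_PiM M)
  interpret pair_sigma_finite "PiM I M" "M k"
    by (intro pair_sigma_finite.intro Mk.sigma_finite_measure_axioms PP.sigma_finite_measure_axioms)
  let ?h = "\<lambda>(w, v). w(k := v)"
  have ins: "insert k I = I" using k by auto
  have meas: "?h \<in> PiM I M \<Otimes>\<^sub>M M k \<rightarrow>\<^sub>M PiM I M"
    using measurable_add_dim[of k I M] unfolding ins .
  have Fm: "F \<in> borel_measurable (PiM I M)" using F by auto
  note eq = PiM_resample[OF I M k]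
  have "integrable (distr (PiM I M \<Otimes>\<^sub>M M k) (PiM I M) ?h) F" using F by (subst eq)
  then have "integrable (PiM I M \<Otimes>\<^sub>M M k) (\<lambda>x. F (?h x))"
    by (rule integrable_distr[OF meas])
  then have int: "integrable (PiM I M \<Otimes>\<^sub>M M k) (\<lambda>(w, v). F (w(k := v)))"
    by (simp add: case_prod_beta')
  have "integral\<^sup>L (PiM I M) F = integral\<^sup>L (distr (PiM I M \<Otimes>\<^sub>M M k) (PiM I M) ?h) F"
    by (subst eq) (rule refl)
  also have "\<dots> = (\<integral>x. F (?h x) \<partial>(PiM I M \<Otimes>\<^sub>M M k))" by (rule integral_distr[OF meas Fm])
  also have "\<dots> = (\<integral>(w, v). F (w(k := v)) \<partial>(PiM I M \<Otimes>\<^sub>M M k))" by (simp add: case_prod_beta')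
  also have "\<dots> = (\<integral>w. (\<integral>v. F (w(k := v)) \<partial>M k) \<partial>PiM I M)"
    by (rule integral_fst[OF int, symmetric])
  finally show "integral\<^sup>L (PiM I M) F = (\<integral>w. (\<integral>v. F (w(k := v)) \<partial>M k) \<partial>PiM I M)" .
  show "integrable (PiM I M) (\<lambda>w. \<integral>v. F (w(k := v)) \<partial>M k)" by (rule integrable_fst[OF int])
  show "AE w in PiM I M. integrable (M k) (\<lambda>v. F (w(k := v)))" by (rule AE_integrable_fst[OF int])
qed

lemma PiM_two_components:
  fixes M :: "'i \<Rightarrow> 'a measure"
  assumes I: "finite I" and M: "\<And>i. prob_space (M i)" and ij: "i \<in> I" "j \<in> I" "i \<noteq> j"
  shows "distr (PiM I M) (M i \<Otimes>\<^sub>M M j) (\<lambda>w. (w i, w j)) = M i \<Otimes>\<^sub>M M j"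
proof -
  interpret finite_product_prob_space M I
    using I M by (auto simp: finite_product_prob_space_def product_prob_space_def
        finite_product_sigma_finite_def finite_product_sigma_finite_axioms_def
        product_sigma_finite_def product_prob_space_axioms_def prob_space_imp_sigma_finite)
  show ?thesis
  proof (rule pair_measure_eqI[symmetric])
    fix A B assume A: "A \<in> sets (M i)" and B: "B \<in> sets (M j)"
    define E where "E l = (if l = i then A else if l = j then B else space (M l))" for l
    have "emeasure (distr (PiM I M) (M i \<Otimes>\<^sub>M M j) (\<lambda>w. (w i, w j))) (A \<times> B)
        = emeasure (PiM I M) ((\<lambda>w. (w i, w j)) -` (A \<times> B) \<inter> space (PiM I M))"
      using A B ij by (intro emeasure_distr) auto
    also have "(\<lambda>w. (w i, w j)) -` (A \<times> B) \<inter> space (PiM I M) = Pi\<^sub>E I E"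
    proof (rule set_eqI)
      fix w
      have sub: "x \<in> A \<Longrightarrow> x \<in> space (M i)" "x \<in> B \<Longrightarrow> x \<in> space (M j)" for x
        using A[THEN sets.sets_into_space] B[THEN sets.sets_into_space] by auto
      show "w \<in> (\<lambda>w. (w i, w j)) -` (A \<times> B) \<inter> space (PiM I M) \<longleftrightarrow> w \<in> Pi\<^sub>E I E" (is "?L \<longleftrightarrow> ?R")
      proof
        assume ?L
        then show ?R by (auto simp: space_PiM PiE_iff E_def)
      next
        assume ?R
        then have w: "\<And>l. l \<in> I \<Longrightarrow> w l \<in> E l" "w \<in> extensional I" by (auto simp: PiE_iff)
        have "w i \<in> A" "w j \<in> B" using w(1)[OF ij(1)] w(1)[OF ij(2)] ij(3) by (auto simp: E_def)
        moreover have "w l \<in> space (M l)" if "l \<in> I" for l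
          using w(1)[OF that] sub by (auto simp: E_def split: if_splits)
        ultimately show ?L using w(2) by (auto simp: space_PiM PiE_iff)
      qed
    qed
    also have "emeasure (PiM I M) (Pi\<^sub>E I E) = (\<Prod>l\<in>I. emeasure (M l) (E l))"
      using A B I by (intro emeasure_PiM) (auto simp: E_def)
    also have "\<dots> = emeasure (M i) (E i) * (emeasure (M j) (E j) * (\<Prod>l\<in>I - {i} - {j}. emeasure (M l) (E l)))"
      using I ij by (subst prod.remove[of _ i], simp, simp, subst prod.remove[of _ j]) auto
    also have "(\<Prod>l\<in>I - {i} - {j}. emeasure (M l) (E l)) = 1"
      by (intro prod.neutral) (auto simp: E_def M.emeasure_space_1)
    finally show "emeasure (M i) A * emeasure (M j) B
        = emeasure (distr (PiM I M) (M i \<Otimes>\<^sub>M M j) (\<lambda>w. (w i, w j))) (A \<times> B)"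
      using ij by (simp add: E_def)
  qed (use M.sigma_finite_measure_axioms in auto)
qed

lemma integrable_mult_of_squares:
  fixes f h :: "'a \<Rightarrow> real"
  assumes [measurable]: "f \<in> borel_measurable M" "h \<in> borel_measurable M"
    and "integrable M (\<lambda>x. (f x)^2)" "integrable M (\<lambda>x. (h x)^2)"
  shows "integrable M (\<lambda>x. f x * h x)"
proof (rule Bochner_Integration.integrable_bound)
  show "integrable M (\<lambda>x. (f x)^2 + (h x)^2)" using assms by simp
  show "AE x in M. norm (f x * h x) \<le> norm ((f x)^2 + (h x)^2)"
  proof (rule AE_I2)
    fix x
    have "0 \<le> (\<bar>f x\<bar> - \<bar>h x\<bar>)^2" by simp
    then have "2 * (\<bar>f x\<bar> * \<bar>h x\<bar>) \<le> (f x)^2 + (h x)^2" by (simp add: power2_diff)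
    moreover have "0 \<le> \<bar>f x\<bar> * \<bar>h x\<bar>" by simp
    ultimately have "\<bar>f x * h x\<bar> \<le> (f x)^2 + (h x)^2" unfolding abs_mult by linarith
    then show "norm (f x * h x) \<le> norm ((f x)^2 + (h x)^2)" by simp
  qed
qed simp

lemma integrable_square_add:
  fixes f h :: "'a \<Rightarrow> real"
  assumes [measurable]: "f \<in> borel_measurable M" "h \<in> borel_measurable M"
    and "integrable M (\<lambda>x. (f x)^2)" "integrable M (\<lambda>x. (h x)^2)"
  shows "integrable M (\<lambda>x. (f x + h x)^2)"
  using assms integrable_mult_of_squares[OF assms] by (simp add: power2_sum mult.assoc)

lemma (in prob_space) integrable_of_square:
  fixes f :: "'a \<Rightarrow> real"
  assumes "f \<in> borel_measurable M" "integrable M (\<lambda>x. (f x)^2)"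
  shows "integrable M f"
  using integrable_mult_of_squares[of f M "\<lambda>_. 1"] assms by simp

lemma (in prob_space) square_expectation_le:
  fixes f :: "'a \<Rightarrow> real"
  assumes "f \<in> borel_measurable M" "integrable M (\<lambda>x. (f x)^2)"
  shows "(expectation f)^2 \<le> expectation (\<lambda>x. (f x)^2)"
  using variance_eq[OF integrable_of_square[OF assms] assms(2)] variance_positive[of f] by simp

section \<open>Projections of the base function\<close>

locale two_sample_kernel =
  fixes P Q :: "'a measure" and g :: "'a \<Rightarrow> 'a \<Rightarrow> real"
  assumes P_prob: "prob_space P" and Q_prob: "prob_space Q" and sets_Q: "sets Q = sets P"
    and g_measurable: "(\<lambda>(x, y). g x y) \<in> borel_measurable (P \<Otimes>\<^sub>M P)"
    and g_sym: "\<And>x y. x \<in> space P \<Longrightarrow> y \<in> space P \<Longrightarrow> g x y = g y x"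
    and fin: "finite_psi P Q g"
begin

text \<open>The two distributions are indexed by truth values, True for \<open>P\<close>, so that \<open>law
  (p < n1)\<close> is the law of the pooled point \<open>p\<close>.\<close>

definition law :: "bool \<Rightarrow> 'a measure" where
  "law b = (if b then P else Q)"

lemma law_prob: "prob_space (law b)"
  using P_prob Q_prob by (simp add: law_def)

lemma sets_law [measurable_cong]: "sets (law b) = sets P"
  using sets_Q by (simp add: law_def)

lemma space_law: "space (law b) = space P"
  by (rule sets_eq_imp_space_eq) (rule sets_law)

lemma two_sample_law: "two_sample P Q n1 n2 = PiM {..<n1 + n2} (\<lambda>i. law (i < n1))"
  by (simp add: two_sample_def law_def)

lemma pair_law_sigma_finite: "pair_sigma_finite (law b) (law c)"
  using law_prob by (intro pair_sigma_finite.intro prob_space_imp_sigma_finite)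

lemma pair_law_prob: "prob_space (law b \<Otimes>\<^sub>M law c)"
  using law_prob by (intro prob_space_pair)

lemma g_measurable_law: "case_prod g \<in> borel_measurable (law b \<Otimes>\<^sub>M law c)"
  using g_measurable
  by (subst measurable_cong_sets[OF sets_pair_measure_cong[OF sets_law sets_law] refl]) simp

lemma g_measurable_pair [measurable]: "(\<lambda>z. g (fst z) (snd z)) \<in> borel_measurable (law b \<Otimes>\<^sub>M law c)"
  using g_measurable_law[of b c] by (simp add: case_prod_beta')

lemma two_sample_prob: "prob_space (two_sample P Q n1 n2)"
  unfolding two_sample_law by (intro prob_space_PiM law_prob)

lemma two_sample_component:
  assumes "p < n1 + n2"
  shows "distr (two_sample P Q n1 n2) (law (p < n1)) (\<lambda>w. w p) = law (p < n1)"
  unfolding two_sample_law using assms by (intro distr_PiM_component law_prob) auto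

lemma two_sample_component_measurable [measurable]:
  assumes "p < n1 + n2"
  shows "(\<lambda>w. w p) \<in> two_sample P Q n1 n2 \<rightarrow>\<^sub>M law b"
proof -
  have "(\<lambda>w. w p) \<in> two_sample P Q n1 n2 \<rightarrow>\<^sub>M law (p < n1)"
    unfolding two_sample_law using assms by (intro measurable_component_singleton) auto
  then show ?thesis by (simp add: measurable_def sets_law space_law)
qed

lemma two_sample_pair:
  assumes "p < n1 + n2" "q < n1 + n2" "p \<noteq> q"
  shows "distr (two_sample P Q n1 n2) (law (p < n1) \<Otimes>\<^sub>M law (q < n1)) (\<lambda>w. (w p, w q))
    = law (p < n1) \<Otimes>\<^sub>M law (q < n1)"
  unfolding two_sample_law
  using assms by (intro PiM_two_components[where M = "\<lambda>i. law (i < n1)"] law_prob) auto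

lemma two_sample_pair_integral:
  fixes F :: "'a \<Rightarrow> 'a \<Rightarrow> real"
  assumes pq: "p < n1 + n2" "q < n1 + n2" "p \<noteq> q"
    and F: "case_prod F \<in> borel_measurable (law (p < n1) \<Otimes>\<^sub>M law (q < n1))"
  shows "(\<integral>w. F (w p) (w q) \<partial>two_sample P Q n1 n2) = integral\<^sup>L (law (p < n1) \<Otimes>\<^sub>M law (q < n1)) (case_prod F)"
    and "integrable (two_sample P Q n1 n2) (\<lambda>w. F (w p) (w q))
      \<longleftrightarrow> integrable (law (p < n1) \<Otimes>\<^sub>M law (q < n1)) (case_prod F)"
proof -
  have m: "(\<lambda>w. (w p, w q)) \<in> two_sample P Q n1 n2 \<rightarrow>\<^sub>M law (p < n1) \<Otimes>\<^sub>M law (q < n1)"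
    using pq by measurable
  show "(\<integral>w. F (w p) (w q) \<partial>two_sample P Q n1 n2) = integral\<^sup>L (law (p < n1) \<Otimes>\<^sub>M law (q < n1)) (case_prod F)"
    using integral_distr[OF m F] unfolding two_sample_pair[OF pq] by simp
  show "integrable (two_sample P Q n1 n2) (\<lambda>w. F (w p) (w q))
      \<longleftrightarrow> integrable (law (p < n1) \<Otimes>\<^sub>M law (q < n1)) (case_prod F)"
    using integrable_distr_eq[OF m F] unfolding two_sample_pair[OF pq] by simp
qed

lemma two_sample_component_integral:
  fixes F :: "'a \<Rightarrow> real"
  assumes p: "p < n1 + n2" and F: "F \<in> borel_measurable P"
  shows "(\<integral>w. F (w p) \<partial>two_sample P Q n1 n2) = integral\<^sup>L (law (p < n1)) F"
    and "integrable (two_sample P Q n1 n2) (\<lambda>w. F (w p)) \<longleftrightarrow> integrable (law (p < n1)) F"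
proof -
  have m: "(\<lambda>w. w p) \<in> two_sample P Q n1 n2 \<rightarrow>\<^sub>M law (p < n1)" using p by measurable
  have F': "F \<in> borel_measurable (law (p < n1))" using F by (simp add: measurable_def sets_law space_law)
  show "(\<integral>w. F (w p) \<partial>two_sample P Q n1 n2) = integral\<^sup>L (law (p < n1)) F"
    using integral_distr[OF m F'] unfolding two_sample_component[OF p] by simp
  show "integrable (two_sample P Q n1 n2) (\<lambda>w. F (w p)) \<longleftrightarrow> integrable (law (p < n1)) F"
    using integrable_distr_eq[OF m F'] unfolding two_sample_component[OF p] by simp
qed

text \<open>The second moments whose maximum is \<open>psi_YZ2\<close>.\<close>

definition gsq :: "bool \<Rightarrow> bool \<Rightarrow> real" where
  "gsq b c = (\<integral>(x, y). (g x y)^2 \<partial>(law b \<Otimes>\<^sub>M law c))"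

lemma g_square_pair: "(\<lambda>(x, y). (g x y)^2) \<in> borel_measurable (law b \<Otimes>\<^sub>M law c)"
  unfolding case_prod_beta' by measurable

lemma psi_YZ2_eq: "psi_YZ2 P Q g = max (gsq True True) (max (gsq True False) (gsq False False))"
  unfolding psi_YZ2_def gsq_def
  using two_sample_pair_integral(1)[of 0 3 3 1 "\<lambda>x y. (g x y)^2"]
    two_sample_pair_integral(1)[of 0 3 3 3 "\<lambda>x y. (g x y)^2"]
    two_sample_pair_integral(1)[of 3 3 3 4 "\<lambda>x y. (g x y)^2"] g_square_pair
  by simp

lemma swap_law_integral:
  fixes F :: "'a \<Rightarrow> 'a \<Rightarrow> real"
  assumes "case_prod F \<in> borel_measurable (law b \<Otimes>\<^sub>M law c)"
  shows "integrable (law c \<Otimes>\<^sub>M law b) (\<lambda>(x, y). F y x) \<longleftrightarrow> integrable (law b \<Otimes>\<^sub>M law c) (case_prod F)"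
    and "integral\<^sup>L (law c \<Otimes>\<^sub>M law b) (\<lambda>(x, y). F y x) = integral\<^sup>L (law b \<Otimes>\<^sub>M law c) (case_prod F)"
proof -
  interpret pair_sigma_finite "law c" "law b" by (rule pair_law_sigma_finite)
  interpret p2: pair_sigma_finite "law b" "law c" by (rule pair_law_sigma_finite)
  show "integrable (law c \<Otimes>\<^sub>M law b) (\<lambda>(x, y). F y x) \<longleftrightarrow> integrable (law b \<Otimes>\<^sub>M law c) (case_prod F)"
    using p2.integrable_product_swap_iff[of "case_prod F"] by simp
  show "integral\<^sup>L (law c \<Otimes>\<^sub>M law b) (\<lambda>(x, y). F y x) = integral\<^sup>L (law b \<Otimes>\<^sub>M law c) (case_prod F)"
    using p2.integral_product_swap[OF assms] by simp
qed

lemma g_sym_pair: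
  assumes "z \<in> space (law b \<Otimes>\<^sub>M law c)"
  shows "(case z of (x, y) \<Rightarrow> g x y) = (case z of (x, y) \<Rightarrow> g y x)"
    and "(case z of (x, y) \<Rightarrow> (g x y)^2) = (case z of (x, y) \<Rightarrow> (g y x)^2)"
proof -
  obtain x y where z: "z = (x, y)" by (cases z)
  then have "g x y = g y x" using assms by (intro g_sym) (auto simp: space_pair_measure space_law)
  then show "(case z of (x, y) \<Rightarrow> g x y) = (case z of (x, y) \<Rightarrow> g y x)"
    "(case z of (x, y) \<Rightarrow> (g x y)^2) = (case z of (x, y) \<Rightarrow> (g y x)^2)" unfolding z by simp_all
qed

lemma g_square_integrable: "integrable (law b \<Otimes>\<^sub>M law c) (\<lambda>(x, y). (g x y)^2)"
proof -
  have 1: "integrable (law True \<Otimes>\<^sub>M law True) (\<lambda>(x, y). (g x y)^2)"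
    using two_sample_pair_integral(2)[of 0 3 3 1 "\<lambda>x y. (g x y)^2"] fin g_square_pair by (simp add: finite_psi_def)
  have 2: "integrable (law True \<Otimes>\<^sub>M law False) (\<lambda>(x, y). (g x y)^2)"
    using two_sample_pair_integral(2)[of 0 3 3 3 "\<lambda>x y. (g x y)^2"] fin g_square_pair by (simp add: finite_psi_def)
  have 3: "integrable (law False \<Otimes>\<^sub>M law False) (\<lambda>(x, y). (g x y)^2)"
    using two_sample_pair_integral(2)[of 3 3 3 4 "\<lambda>x y. (g x y)^2"] fin g_square_pair by (simp add: finite_psi_def)
  have "integrable (law False \<Otimes>\<^sub>M law True) (\<lambda>(x, y). (g y x)^2)"
    using 2 g_square_pair by (subst swap_law_integral(1)[of "\<lambda>x y. (g x y)^2"]) auto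
  then have "integrable (law False \<Otimes>\<^sub>M law True) (\<lambda>(x, y). (g x y)^2)"
    by (subst Bochner_Integration.integrable_cong[OF refl g_sym_pair(2)])
  with 1 2 3 show ?thesis by (cases b; cases c) auto
qed

lemma gsq_sym: "gsq b c = gsq c b"
proof -
  have "gsq b c = (\<integral>(x, y). (g y x)^2 \<partial>(law b \<Otimes>\<^sub>M law c))"
    unfolding gsq_def by (intro Bochner_Integration.integral_cong refl g_sym_pair(2))
  also have "\<dots> = gsq c b" unfolding gsq_def by (rule swap_law_integral[OF g_square_pair])
  finally show ?thesis .
qed

lemma gsq_le: "gsq b c \<le> psi_YZ2 P Q g"
  using gsq_sym[of False True] unfolding psi_YZ2_eq by (cases b; cases c) auto

lemma psi_YZ2_nonneg: "0 \<le> psi_YZ2 P Q g"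
proof -
  have "0 \<le> gsq True True"
    unfolding gsq_def by (intro integral_nonneg_AE AE_I2) (simp add: case_prod_beta')
  then show ?thesis using gsq_le[of True True] by linarith
qed

lemma g_integrable: "integrable (law b \<Otimes>\<^sub>M law c) (case_prod g)"
proof -
  interpret prob_space "law b \<Otimes>\<^sub>M law c" by (rule pair_law_prob)
  have "integrable (law b \<Otimes>\<^sub>M law c) (\<lambda>z. g (fst z) (snd z))"
    using g_square_integrable[of b c] unfolding case_prod_beta'
    by (rule integrable_of_square[OF g_measurable_pair])
  then show ?thesis unfolding case_prod_beta' .
qed

definition proj :: "bool \<Rightarrow> 'a \<Rightarrow> real" where
  "proj c x = (\<integral>y. g x y \<partial>law c)"

definition theta :: "bool \<Rightarrow> bool \<Rightarrow> real" where
  "theta b c = (\<integral>x. proj c x \<partial>law b)"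

text \<open>The difference of the mean embeddings of the two laws; it carries the first-order part of the
  statistic.\<close>

definition witness :: "'a \<Rightarrow> real" where
  "witness x = proj True x - proj False x"

definition witness_mean :: "bool \<Rightarrow> real" where
  "witness_mean b = (\<integral>x. witness x \<partial>law b)"

definition witness_var :: "bool \<Rightarrow> real" where
  "witness_var b = (\<integral>x. (witness x - witness_mean b)^2 \<partial>law b)"

text \<open>The completely degenerate part of \<open>g\<close> in the sense of Hoeffding: integrating out
  either argument gives 0.\<close>

definition resid :: "bool \<Rightarrow> bool \<Rightarrow> 'a \<Rightarrow> 'a \<Rightarrow> real" where
  "resid b c x y = g x y - proj c x - proj b y + theta b c"

lemma proj_measurable [measurable]: "proj c \<in> borel_measurable P"
proof -
  interpret c: prob_space "law c" by (rule law_prob)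
  have "proj c \<in> borel_measurable (law True)"
    unfolding proj_def by (rule c.borel_measurable_lebesgue_integral[OF g_measurable_law])
  then show ?thesis by (simp add: law_def)
qed

lemma proj_measurable_law [measurable]: "proj c \<in> borel_measurable (law b)"
  using proj_measurable[of c] by (simp add: measurable_def sets_law space_law)

lemma witness_measurable [measurable]: "witness \<in> borel_measurable P"
  unfolding witness_def by measurable

lemma witness_measurable_law [measurable]: "witness \<in> borel_measurable (law b)"
  unfolding witness_def by measurable

lemma resid_measurable [measurable]:
  "(\<lambda>z. resid b' c' (fst z) (snd z)) \<in> borel_measurable (law b \<Otimes>\<^sub>M law c)"
  unfolding resid_def by measurable

text \<open>Jensen's inequality in the second argument.\<close>

lemma proj_square_AE: "AE x in law b. (proj c x)^2 \<le> (\<integral>y. (g x y)^2 \<partial>law c)"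
proof -
  interpret pair_sigma_finite "law b" "law c" by (rule pair_law_sigma_finite)
  interpret c: prob_space "law c" by (rule law_prob)
  have "AE x in law b. integrable (law c) (\<lambda>y. (g x y)^2)"
    using g_square_integrable by (rule AE_integrable_fst)
  then show ?thesis
  proof eventually_elim
    case (elim x)
    show ?case unfolding proj_def
    proof (cases "g x \<in> borel_measurable (law c)")
      case True
      then show "(\<integral>y. g x y \<partial>law c)^2 \<le> (\<integral>y. (g x y)^2 \<partial>law c)" using elim by (rule c.square_expectation_le)
    next
      case False
      then have "(\<integral>y. g x y \<partial>law c) = 0" by (intro not_integrable_integral_eq) auto
      then show "(\<integral>y. g x y \<partial>law c)^2 \<le> (\<integral>y. (g x y)^2 \<partial>law c)" by simp
    qed
  qed
qed

lemma proj_square_integrable: "integrable (law b) (\<lambda>x. (proj c x)^2)"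
  and proj_square_le: "(\<integral>x. (proj c x)^2 \<partial>law b) \<le> gsq b c"
proof -
  interpret pair_sigma_finite "law b" "law c" by (rule pair_law_sigma_finite)
  have int: "integrable (law b) (\<lambda>x. \<integral>y. (g x y)^2 \<partial>law c)"
    using g_square_integrable by (rule integrable_fst)
  show *: "integrable (law b) (\<lambda>x. (proj c x)^2)"
  proof (rule Bochner_Integration.integrable_bound[OF int])
    show "AE x in law b. norm ((proj c x)^2) \<le> norm (\<integral>y. (g x y)^2 \<partial>law c)"
      using proj_square_AE[of c b] by eventually_elim auto
  qed measurable
  have "(\<integral>x. (proj c x)^2 \<partial>law b) \<le> (\<integral>x. (\<integral>y. (g x y)^2 \<partial>law c) \<partial>law b)"
    using * int proj_square_AE by (intro integral_mono_AE)
  also have "\<dots> = gsq b c" unfolding gsq_def using g_square_integrable by (rule integral_fst)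
  finally show "(\<integral>x. (proj c x)^2 \<partial>law b) \<le> gsq b c" .
qed

lemma proj_integrable: "integrable (law b) (proj c)"
  using prob_space.integrable_of_square[OF law_prob proj_measurable_law proj_square_integrable] .

lemma theta_eq: "theta b c = integral\<^sup>L (law b \<Otimes>\<^sub>M law c) (case_prod g)"
proof -
  interpret pair_sigma_finite "law b" "law c" by (rule pair_law_sigma_finite)
  show ?thesis unfolding theta_def proj_def using g_integrable[of b c] integral_fst[of g] by simp
qed

lemma theta_sym: "theta b c = theta c b"
proof -
  have "theta b c = (\<integral>(x, y). g y x \<partial>(law b \<Otimes>\<^sub>M law c))"
    unfolding theta_eq by (intro Bochner_Integration.integral_cong refl g_sym_pair(1))
  also have "\<dots> = theta c b" unfolding theta_eq by (rule swap_law_integral[OF g_measurable_law])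
  finally show ?thesis .
qed

lemma witness_integrable: "integrable (law b) witness"
  unfolding witness_def using proj_integrable by simp

lemma witness_mean_eq: "witness_mean b = theta b True - theta b False"
  unfolding witness_mean_def witness_def theta_def using proj_integrable by simp

lemma witness_centered_square_integrable: "integrable (law b) (\<lambda>x. (witness x - c)^2)"
proof -
  interpret b: prob_space "law b" by (rule law_prob)
  have "integrable (law b) (\<lambda>x. (proj True x + (- proj False x))^2)"
    using proj_square_integrable by (intro integrable_square_add) auto
  then have "integrable (law b) (\<lambda>x. (witness x + (- c))^2)"
    unfolding witness_def by (intro integrable_square_add) auto
  then show ?thesis by simp
qed

text \<open>The witness is a difference of two projections, and projections do not increase second moments.\<close>

lemma witness_var_le: "witness_var b \<le> 4 * psi_YZ2 P Q g"
proof -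
  interpret b: prob_space "law b" by (rule law_prob)
  have int0: "integrable (law b) (\<lambda>x. (witness x)^2)"
    using witness_centered_square_integrable[of b 0] by simp
  have "witness_var b = (\<integral>x. (witness x)^2 \<partial>law b) - (witness_mean b)^2"
    unfolding witness_var_def witness_mean_def using witness_integrable int0 by (rule b.variance_eq)
  also have "\<dots> \<le> (\<integral>x. (witness x)^2 \<partial>law b)" by simp
  also have "\<dots> \<le> (\<integral>x. 2 * (proj True x)^2 + 2 * (proj False x)^2 \<partial>law b)"
  proof (intro integral_mono int0)
    show "integrable (law b) (\<lambda>x. 2 * (proj True x)^2 + 2 * (proj False x)^2)"
      using proj_square_integrable by simp
    fix x
    have "0 \<le> (proj True x + proj False x)^2" by simp
    then show "(witness x)^2 \<le> 2 * (proj True x)^2 + 2 * (proj False x)^2"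
      by (simp add: witness_def power2_eq_square algebra_simps)
  qed
  also have "\<dots> = 2 * (\<integral>x. (proj True x)^2 \<partial>law b) + 2 * (\<integral>x. (proj False x)^2 \<partial>law b)"
    using proj_square_integrable by simp
  also have "\<dots> \<le> 2 * psi_YZ2 P Q g + 2 * psi_YZ2 P Q g"
    using proj_square_le[of b True] proj_square_le[of b False] gsq_le[of b True] gsq_le[of b False] by linarith
  finally show ?thesis by simp
qed

lemma witness_var_nonneg: "0 \<le> witness_var b"
  unfolding witness_var_def by simp

lemma theta_square_le: "(theta b c)^2 \<le> psi_YZ2 P Q g"
proof -
  interpret prob_space "law b \<Otimes>\<^sub>M law c" by (rule pair_law_prob)
  have "(theta b c)^2 \<le> gsq b c"
    using square_expectation_le[of "case_prod g"] g_square_integrable[of b c]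
    unfolding theta_eq gsq_def by (simp add: case_prod_beta')
  then show ?thesis using gsq_le[of b c] by linarith
qed

text \<open>The squared distance of the two laws seen through \<open>g\<close>; it is the expectation of the
  U-statistic.\<close>

definition effect :: real where
  "effect = theta True True - theta True False - theta False True + theta False False"

text \<open>Needed because the signal reappears, scaled by the discrepancy, among the permuted statistics:
  there it has to be controlled by the second moments of \<open>g\<close>.\<close>

lemma effect_square_le: "effect^2 \<le> 16 * psi_YZ2 P Q g"
proof -
  have th: "\<bar>theta b c\<bar> \<le> sqrt (psi_YZ2 P Q g)" for b c
    using theta_square_le by (rule real_le_rsqrt[of "\<bar>_\<bar>", unfolded power2_abs])
  have "\<bar>effect\<bar> \<le> 4 * sqrt (psi_YZ2 P Q g)"
    using th[of True True] th[of True False] th[of False True] th[of False False]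
    unfolding effect_def by linarith
  then have "\<bar>effect\<bar>^2 \<le> (4 * sqrt (psi_YZ2 P Q g))^2" by (intro power_mono) auto
  then show ?thesis using psi_YZ2_nonneg by (simp add: power_mult_distrib)
qed

lemma resid_sym: "x \<in> space P \<Longrightarrow> y \<in> space P \<Longrightarrow> resid b c x y = resid c b y x"
  unfolding resid_def using g_sym[of x y] theta_sym[of b c] by simp

lemma resid_integral_snd: "AE x in law b. (\<integral>y. resid b c x y \<partial>law c) = 0"
proof -
  interpret pair_sigma_finite "law b" "law c" by (rule pair_law_sigma_finite)
  interpret c: prob_space "law c" by (rule law_prob)
  have "AE x in law b. integrable (law c) (\<lambda>y. g x y)" using g_integrable by (rule AE_integrable_fst)
  then show ?thesis
  proof eventually_elim
    case (elim x)
    have "(\<integral>y. resid b c x y \<partial>law c)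
        = (\<integral>y. g x y \<partial>law c) - proj c x - (\<integral>y. proj b y \<partial>law c) + theta b c"
      unfolding resid_def using elim proj_integrable[of c b] by (simp add: c.prob_space)
    then show ?case using theta_sym[of b c] unfolding proj_def[of c x, symmetric] theta_def[of c b, symmetric]
      by simp
  qed
qed

lemma resid_integral_fst: "AE y in law c. (\<integral>x. resid b c x y \<partial>law b) = 0"
proof -
  interpret b: prob_space "law b" by (rule law_prob)
  have "AE y in law c. (\<integral>x. resid c b y x \<partial>law b) = 0" by (rule resid_integral_snd)
  then show ?thesis
  proof (rule AE_mp, intro AE_I2 impI)
    fix y assume y: "y \<in> space (law c)" and 0: "(\<integral>x. resid c b y x \<partial>law b) = 0"
    have "(\<integral>x. resid b c x y \<partial>law b) = (\<integral>x. resid c b y x \<partial>law b)"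
      using y by (intro Bochner_Integration.integral_cong refl) (auto simp: resid_sym space_law)
    then show "(\<integral>x. resid b c x y \<partial>law b) = 0" using 0 by simp
  qed
qed

lemma fst_law_integrable: "integrable (law b) F \<Longrightarrow> integrable (law b \<Otimes>\<^sub>M law c) (\<lambda>(x, y). F x :: real)"
  and snd_law_integrable: "integrable (law c) H \<Longrightarrow> integrable (law b \<Otimes>\<^sub>M law c) (\<lambda>(x, y). H y :: real)"
proof -
  interpret b: prob_space "law b" by (rule law_prob)
  interpret c: prob_space "law c" by (rule law_prob)
  interpret pair_prob_space "law b" "law c" ..
  show "integrable (law b) F \<Longrightarrow> integrable (law b \<Otimes>\<^sub>M law c) (\<lambda>(x, y). F x)"
    using integrable_distr[of fst "law b \<Otimes>\<^sub>M law c" "law b" F] c.distr_pair_fst[of "law b"]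
    by (simp add: case_prod_beta')
  show "integrable (law c) H \<Longrightarrow> integrable (law b \<Otimes>\<^sub>M law c) (\<lambda>(x, y). H y)"
  proof -
    assume H: "integrable (law c) H"
    then have [measurable]: "H \<in> borel_measurable (law c)" by auto
    have "integrable (law c \<Otimes>\<^sub>M law b) (\<lambda>(x, y). H x)"
      using H integrable_distr[of fst "law c \<Otimes>\<^sub>M law b" "law c" H] b.distr_pair_fst[of "law c"]
      by (simp add: case_prod_beta')
    then show ?thesis using swap_law_integral(1)[of "\<lambda>x y. H x" c b] by simp
  qed
qed

lemma resid_square_integrable: "integrable (law b \<Otimes>\<^sub>M law c) (\<lambda>(x, y). (resid b c x y)^2)"
  and resid_square_le: "(\<integral>(x, y). (resid b c x y)^2 \<partial>(law b \<Otimes>\<^sub>M law c)) \<le> psi_YZ2 P Q g"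
proof -
  interpret PR: prob_space "law b \<Otimes>\<^sub>M law c" by (rule pair_law_prob)
  interpret pair_sigma_finite "law b" "law c" by (rule pair_law_sigma_finite)
  interpret c: prob_space "law c" by (rule law_prob)
  interpret b: prob_space "law b" by (rule law_prob)
  let ?M = "law b \<Otimes>\<^sub>M law c"
  define A where "A z = proj c (fst z) + proj b (snd z) - theta b c" for z
  define R where "R z = resid b c (fst z) (snd z)" for z
  define G where "G z = g (fst z) (snd z)" for z
  have Am [measurable]: "A \<in> borel_measurable ?M" unfolding A_def by measurable
  have Rm [measurable]: "R \<in> borel_measurable ?M" unfolding R_def by measurable
  have Gm [measurable]: "G \<in> borel_measurable ?M" unfolding G_def by measurable
  have G2: "integrable ?M (\<lambda>z. (G z)^2)" using g_square_integrable[of b c] unfolding G_def case_prod_beta' .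
  have p1: "integrable ?M (\<lambda>z. (proj c (fst z))^2)"
    using fst_law_integrable[OF proj_square_integrable[of b c], of c] unfolding case_prod_beta' .
  have p2: "integrable ?M (\<lambda>z. (proj b (snd z))^2)"
    using snd_law_integrable[OF proj_square_integrable[of c b], of b] unfolding case_prod_beta' .
  have A2: "integrable ?M (\<lambda>z. (A z)^2)"
  proof -
    have "integrable ?M (\<lambda>z. (proj c (fst z) + proj b (snd z))^2)"
      using p1 p2 by (intro integrable_square_add) auto
    moreover have "(\<lambda>z. proj c (fst z) + proj b (snd z)) \<in> borel_measurable ?M"
      by measurable
    ultimately have "integrable ?M (\<lambda>z. ((proj c (fst z) + proj b (snd z)) + (- theta b c))^2)"
      by (rule integrable_square_add[OF _ borel_measurable_const _ PR.integrable_const, rotated])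
    then show ?thesis by (simp add: A_def)
  qed
  have RG: "R z = G z + (- A z)" for z by (simp add: R_def A_def G_def resid_def)
  have R2: "integrable ?M (\<lambda>z. (R z)^2)"
    unfolding RG using G2 A2 by (intro integrable_square_add) auto
  then show "integrable ?M (\<lambda>(x, y). (resid b c x y)^2)" unfolding R_def case_prod_beta' .
  have Rint: "integrable ?M R" by (rule PR.integrable_of_square[OF Rm R2])
  have i1: "integrable ?M (\<lambda>z. R z * proj c (fst z))"
    by (rule integrable_mult_of_squares[OF Rm _ R2 p1]) measurable
  have i2: "integrable ?M (\<lambda>z. R z * proj b (snd z))"
    by (rule integrable_mult_of_squares[OF Rm _ R2 p2]) measurable
  have z1: "(\<integral>z. R z * proj c (fst z) \<partial>?M) = 0"
  proof -
    have "AE x in law b. (\<integral>y. R (x, y) * proj c x \<partial>law c) = 0"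
      using resid_integral_snd[where b = b and c = c] by eventually_elim (simp add: R_def)
    then have "(\<integral>x. (\<integral>y. R (x, y) * proj c x \<partial>law c) \<partial>law b) = 0" by (rule integral_eq_zero_AE)
    then show ?thesis
      using integral_fst[of "\<lambda>x y. R (x, y) * proj c x"] i1 unfolding case_prod_beta' prod.collapse by simp
  qed
  have z2: "(\<integral>z. R z * proj b (snd z) \<partial>?M) = 0"
  proof -
    have "AE y in law c. (\<integral>x. R (x, y) * proj b y \<partial>law b) = 0"
      using resid_integral_fst[where b = b and c = c] by eventually_elim (simp add: R_def)
    then have "(\<integral>y. (\<integral>x. R (x, y) * proj b y \<partial>law b) \<partial>law c) = 0" by (rule integral_eq_zero_AE)
    then show ?thesis
      using integral_snd[of "\<lambda>x y. R (x, y) * proj b y"] i2 unfolding case_prod_beta' prod.collapse by simp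
  qed
  have z3: "(\<integral>z. R z \<partial>?M) = 0"
  proof -
    have "AE x in law b. (\<integral>y. R (x, y) \<partial>law c) = 0"
      using resid_integral_snd[where b = b and c = c] by eventually_elim (simp add: R_def)
    then have "(\<integral>x. (\<integral>y. R (x, y) \<partial>law c) \<partial>law b) = 0" by (rule integral_eq_zero_AE)
    then show ?thesis
      using integral_fst[of "\<lambda>x y. R (x, y)"] Rint unfolding case_prod_beta' prod.collapse by simp
  qed
  have "(\<integral>z. (R z)^2 \<partial>?M) + (\<integral>z. (A z)^2 \<partial>?M) = (\<integral>z. (G z)^2 \<partial>?M)"
  proof -
    have "(G z)^2 = (R z)^2 + (A z)^2 + (2 * (R z * proj c (fst z)) + 2 * (R z * proj b (snd z)) - 2 * theta b c * R z)" for z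
    proof -
      have "(r + (p + q - t))^2 = r^2 + (p + q - t)^2 + (2 * (r * p) + 2 * (r * q) - 2 * t * r)"
        for r p q t :: real by (simp add: power2_eq_square algebra_simps)
      moreover have "G z = R z + (proj c (fst z) + proj b (snd z) - theta b c)"
        using RG[of z] by (simp add: A_def)
      ultimately show ?thesis by (simp only: A_def)
    qed
    then have "(\<integral>z. (G z)^2 \<partial>?M) = (\<integral>z. (R z)^2 + (A z)^2 + (2 * (R z * proj c (fst z)) + 2 * (R z * proj b (snd z)) - 2 * theta b c * R z) \<partial>?M)"
      by simp
    also have "\<dots> = (\<integral>z. (R z)^2 \<partial>?M) + (\<integral>z. (A z)^2 \<partial>?M)"
      using R2 A2 i1 i2 Rint z1 z2 z3 by simp
    finally show ?thesis by simp
  qed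
  moreover have "0 \<le> (\<integral>z. (A z)^2 \<partial>?M)" by simp
  moreover have "(\<integral>z. (G z)^2 \<partial>?M) = gsq b c" unfolding gsq_def G_def case_prod_beta' ..
  ultimately show "(\<integral>(x, y). (resid b c x y)^2 \<partial>?M) \<le> psi_YZ2 P Q g"
    using gsq_le[of b c] unfolding R_def case_prod_beta' by linarith
qed

end

section \<open>Orthogonal decomposition of the statistic\<close>

lemma sum_power2_le_power2_sum:
  fixes f :: "'i \<Rightarrow> real"
  assumes "\<And>a. a \<in> A \<Longrightarrow> 0 \<le> f a"
  shows "(\<Sum>a\<in>A. (f a)^2) \<le> (\<Sum>a\<in>A. f a)^2"
proof (cases "finite A")
  case True
  have "(\<Sum>a\<in>A. (f a)^2) \<le> (\<Sum>a\<in>A. f a * (\<Sum>b\<in>A. f b))"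
    unfolding power2_eq_square using assms True
    by (intro sum_mono mult_left_mono member_le_sum) auto
  then show ?thesis by (simp add: power2_eq_square sum_distrib_right)
qed simp

text \<open>A function of the sample label alone is integrated against a row of \<open>coef\<close>:
  vanishing row sums leave only the contrast of its two values.\<close>

lemma coef_label_sum:
  assumes "2 \<le> n1" "2 \<le> n2" "S \<subseteq> {..<n1 + n2}" "card S = n1" "p < n1 + n2"
  shows "(\<Sum>q\<in>{..<n1 + n2} - {p}. coef n1 n2 S p q * F (q < n1))
    = label_weight n1 n2 S p * (F True - F False)"
proof -
  let ?I = "{..<n1 + n2}"
  have 0: "(\<Sum>q\<in>?I - {p}. coef n1 n2 S p q) = 0" using assms by (intro coef_row_sum) auto
  have 1: "(\<Sum>q\<in>?I - {p}. coef n1 n2 S p q * of_bool (q < n1)) = label_weight n1 n2 S p"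
    unfolding label_weight_def by (intro sum.mono_neutral_cong_right) auto
  have "(\<Sum>q\<in>?I - {p}. coef n1 n2 S p q * F (q < n1))
    = (\<Sum>q\<in>?I - {p}. F False * coef n1 n2 S p q + (F True - F False) * (coef n1 n2 S p q * of_bool (q < n1)))"
    by (intro sum.cong refl) (auto simp: algebra_simps)
  also have "\<dots> = F False * 0 + (F True - F False) * label_weight n1 n2 S p"
    unfolding sum.distrib sum_distrib_left[symmetric] 0 1 ..
  finally show ?thesis by simp
qed

lemma sum_offdiag_swap:
  fixes h :: "'i \<Rightarrow> 'i \<Rightarrow> real"
  assumes "finite I"
  shows "(\<Sum>p\<in>I. \<Sum>q\<in>I - {p}. h p q) = (\<Sum>p\<in>I. \<Sum>q\<in>I - {p}. h q p)"
proof -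
  have e: "(\<Sum>p\<in>I. \<Sum>q\<in>I - {p}. f p q) = (\<Sum>p\<in>I. \<Sum>q\<in>I. if q = p then 0 else f p q)" for f :: "'i \<Rightarrow> 'i \<Rightarrow> real"
    using assms by (intro sum.cong refl sum.mono_neutral_cong_left) auto
  show ?thesis unfolding e by (subst sum.swap) (intro sum.cong refl, auto)
qed

context two_sample_kernel
begin

text \<open>The first-order term of the Hoeffding decomposition. The factor 2 comes from the symmetry of
  \<open>coef\<close> and \<open>g\<close>.\<close>

definition lin :: "nat \<Rightarrow> nat \<Rightarrow> nat set \<Rightarrow> (nat \<Rightarrow> 'a) \<Rightarrow> real" where
  "lin n1 n2 S x = 2 * (\<Sum>p\<in>{..<n1 + n2}. label_weight n1 n2 S p * (witness (x p) - witness_mean (p < n1)))"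

definition quad :: "nat \<Rightarrow> nat \<Rightarrow> nat set \<Rightarrow> (nat \<Rightarrow> 'a) \<Rightarrow> real" where
  "quad n1 n2 S x = (\<Sum>p\<in>{..<n1 + n2}. \<Sum>q\<in>{..<n1 + n2} - {p}.
     coef n1 n2 S p q * resid (p < n1) (q < n1) (x p) (x q))"

text \<open>Writing \<open>g\<close> as residual plus projections minus mean, the projections depend on one
  point and on the label of the other, so that \<open>coef_label_sum\<close> collapses them to
  label weights. Thus the split enters signal and linear part through the label weights only.\<close>

lemma split_stat_decomposition:
  assumes n: "2 \<le> n1" "2 \<le> n2" and S: "S \<subseteq> {..<n1 + n2}" "card S = n1"
  shows "split_stat g n1 n2 S x
    = effect * (\<Sum>p<n1. label_weight n1 n2 S p) + lin n1 n2 S x + quad n1 n2 S x"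
proof -
  let ?I = "{..<n1 + n2}"
  let ?c = "coef n1 n2 S" and ?d = "label_weight n1 n2 S"
  have row: "(\<Sum>q\<in>?I - {p}. ?c p q * F (q < n1)) = ?d p * (F True - F False)" if "p \<in> ?I" for p F
    using n S that by (intro coef_label_sum) auto
  have T1: "(\<Sum>p\<in>?I. \<Sum>q\<in>?I - {p}. ?c p q * proj (q < n1) (x p)) = (\<Sum>p\<in>?I. ?d p * witness (x p))"
    unfolding witness_def by (intro sum.cong refl row[where F = "\<lambda>b. proj b (x _)"])
  have T2: "(\<Sum>p\<in>?I. \<Sum>q\<in>?I - {p}. ?c p q * proj (p < n1) (x q)) = (\<Sum>p\<in>?I. ?d p * witness (x p))"
    unfolding T1[symmetric] by (subst sum_offdiag_swap) (simp_all add: coef_sym[of n1 n2 S])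
  have T3: "(\<Sum>p\<in>?I. \<Sum>q\<in>?I - {p}. ?c p q * theta (p < n1) (q < n1)) = (\<Sum>p\<in>?I. ?d p * witness_mean (p < n1))"
    unfolding witness_mean_eq by (intro sum.cong refl row[where F = "theta (_ < n1)"])
  have "split_stat g n1 n2 S x = (\<Sum>p\<in>?I. \<Sum>q\<in>?I - {p}.
      ?c p q * resid (p < n1) (q < n1) (x p) (x q) + ?c p q * proj (q < n1) (x p)
      + ?c p q * proj (p < n1) (x q) - ?c p q * theta (p < n1) (q < n1))"
    unfolding split_stat_def by (intro sum.cong refl) (simp add: resid_def algebra_simps)
  also have "\<dots> = quad n1 n2 S x + (\<Sum>p\<in>?I. ?d p * witness (x p)) + (\<Sum>p\<in>?I. ?d p * witness (x p))
      - (\<Sum>p\<in>?I. ?d p * witness_mean (p < n1))"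
    unfolding sum.distrib sum_subtractf T1 T2 T3 quad_def ..
  also have "\<dots> = quad n1 n2 S x + lin n1 n2 S x + (\<Sum>p\<in>?I. ?d p * witness_mean (p < n1))"
    unfolding lin_def by (simp add: right_diff_distrib sum_subtractf)
  also have "(\<Sum>p\<in>?I. ?d p * witness_mean (p < n1)) = effect * (\<Sum>p<n1. ?d p)"
  proof -
    have "(\<Sum>p\<in>?I. ?d p * witness_mean (p < n1))
      = (\<Sum>p\<in>?I. witness_mean False * ?d p + (witness_mean True - witness_mean False) * (?d p * of_bool (p < n1)))"
      by (intro sum.cong refl) (auto simp: algebra_simps)
    also have "\<dots> = witness_mean False * 0 + (witness_mean True - witness_mean False) * (\<Sum>p\<in>?I. ?d p * of_bool (p < n1))"
      unfolding sum.distrib sum_distrib_left[symmetric] label_weight_total[OF n S] ..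
    also have "(\<Sum>p\<in>?I. ?d p * of_bool (p < n1)) = (\<Sum>p<n1. ?d p)"
      by (intro sum.mono_neutral_cong_right) auto
    also have "witness_mean True - witness_mean False = effect"
      by (simp add: witness_mean_eq effect_def)
    finally show ?thesis by simp
  qed
  finally show ?thesis by simp
qed

context
  fixes n1 n2 :: nat
begin

private abbreviation "M \<equiv> two_sample P Q n1 n2"
private abbreviation "I \<equiv> {..<n1 + n2}"

lemma point_in_space: "x \<in> space M \<Longrightarrow> p < n1 + n2 \<Longrightarrow> x p \<in> space P"
  by (auto simp: two_sample_law space_PiM PiE_iff space_law)

definition cw :: "nat \<Rightarrow> (nat \<Rightarrow> 'a) \<Rightarrow> real" where
  "cw p x = witness (x p) - witness_mean (p < n1)"

definition rs :: "nat \<Rightarrow> nat \<Rightarrow> (nat \<Rightarrow> 'a) \<Rightarrow> real" where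
  "rs p q x = resid (p < n1) (q < n1) (x p) (x q)"

lemma cw_measurable [measurable]: "p < n1 + n2 \<Longrightarrow> cw p \<in> borel_measurable M"
  unfolding cw_def by measurable

lemma rs_measurable [measurable]:
  assumes "p < n1 + n2" "q < n1 + n2"
  shows "rs p q \<in> borel_measurable M"
proof -
  have "(\<lambda>x. (x p, x q)) \<in> M \<rightarrow>\<^sub>M law True \<Otimes>\<^sub>M law True" using assms by measurable
  from measurable_compose[OF this resid_measurable[of "p < n1" "q < n1"]]
  show ?thesis unfolding rs_def by simp
qed

lemma cw_square:
  assumes "p < n1 + n2"
  shows "integrable M (\<lambda>x. (cw p x)^2)" "(\<integral>x. (cw p x)^2 \<partial>M) = witness_var (p < n1)"
proof -
  have m: "(\<lambda>v. (witness v - witness_mean (p < n1))^2) \<in> borel_measurable P" by measurable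
  show "integrable M (\<lambda>x. (cw p x)^2)" "(\<integral>x. (cw p x)^2 \<partial>M) = witness_var (p < n1)"
    using two_sample_component_integral[OF assms m] witness_centered_square_integrable[of "p < n1"]
    unfolding cw_def witness_var_def by simp_all
qed

lemma rs_square:
  assumes "p < n1 + n2" "q < n1 + n2" "p \<noteq> q"
  shows "integrable M (\<lambda>x. (rs p q x)^2)" "(\<integral>x. (rs p q x)^2 \<partial>M) \<le> psi_YZ2 P Q g"
proof -
  have m: "(\<lambda>(x, y). (resid (p < n1) (q < n1) x y)^2) \<in> borel_measurable (law (p < n1) \<Otimes>\<^sub>M law (q < n1))"
    unfolding case_prod_beta' by measurable
  show "integrable M (\<lambda>x. (rs p q x)^2)" "(\<integral>x. (rs p q x)^2 \<partial>M) \<le> psi_YZ2 P Q g"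
    using two_sample_pair_integral[OF assms m] resid_square_integrable[of "p < n1" "q < n1"]
      resid_square_le[where b = "p < n1" and c = "q < n1"]
    unfolding rs_def by simp_all
qed

lemma rs_sym: "x \<in> space M \<Longrightarrow> p < n1 + n2 \<Longrightarrow> q < n1 + n2 \<Longrightarrow> rs p q x = rs q p x"
  unfolding rs_def by (intro resid_sym point_in_space)

lemma resample_zero:
  assumes p: "p < n1 + n2" and F: "integrable M F"
    and z: "AE w in M. (\<integral>v. F (w(p := v)) \<partial>law (p < n1)) = 0"
  shows "(\<integral>x. F x \<partial>M) = (0::real)"
proof -
  have "(\<integral>x. F x \<partial>M) = (\<integral>w. (\<integral>v. F (w(p := v)) \<partial>law (p < n1)) \<partial>M)"
    unfolding two_sample_law using p F[unfolded two_sample_law]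
    by (intro PiM_resample_integral(1)[where M = "\<lambda>i. law (i < n1)"] law_prob) auto
  also have "\<dots> = 0" using z by (rule integral_eq_zero_AE)
  finally show ?thesis .
qed

lemma AE_component:
  assumes p: "p < n1 + n2" and A: "AE y in law (p < n1). R y"
  shows "AE w in M. R (w p)"
proof -
  have m: "(\<lambda>w. w p) \<in> M \<rightarrow>\<^sub>M law (p < n1)" using p by measurable
  have "AE y in distr M (law (p < n1)) (\<lambda>w. w p). R y"
    unfolding two_sample_component[OF p] by (rule A)
  then show ?thesis using m by (rule AE_distrD[rotated])
qed

text \<open>The centered witness integrates to 0 over its own coordinate.\<close>

lemma cw_orthogonal:
  assumes p: "p < n1 + n2" and H: "H \<in> borel_measurable M" "integrable M (\<lambda>x. (H x)^2)"
    and indep: "\<And>w v. H (w(p := v)) = H w"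
  shows "(\<integral>x. cw p x * H x \<partial>M) = 0"
proof (rule resample_zero[OF p])
  interpret b: prob_space "law (p < n1)" by (rule law_prob)
  show "integrable M (\<lambda>x. cw p x * H x)"
    by (rule integrable_mult_of_squares[OF cw_measurable[OF p] H(1) cw_square(1)[OF p] H(2)])
  have "(\<integral>v. witness v - witness_mean (p < n1) \<partial>law (p < n1)) = 0"
    using witness_integrable by (simp add: witness_mean_def b.prob_space)
  then show "AE w in M. (\<integral>v. cw p (w(p := v)) * H (w(p := v)) \<partial>law (p < n1)) = 0"
    unfolding indep by (simp add: cw_def)
qed

lemma rs_orthogonal_fst:
  assumes p: "p < n1 + n2" and q: "q < n1 + n2" "p \<noteq> q"
    and H: "H \<in> borel_measurable M" "integrable M (\<lambda>x. (H x)^2)"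
    and indep: "\<And>w v. H (w(p := v)) = H w"
  shows "(\<integral>x. rs p q x * H x \<partial>M) = 0"
proof (rule resample_zero[OF p])
  show "integrable M (\<lambda>x. rs p q x * H x)"
    by (rule integrable_mult_of_squares[OF rs_measurable[OF p q(1)] H(1) rs_square(1)[OF p q] H(2)])
  have "AE w in M. (\<integral>v. resid (p < n1) (q < n1) v (w q) \<partial>law (p < n1)) = 0"
    by (rule AE_component[OF q(1) resid_integral_fst])
  then show "AE w in M. (\<integral>v. rs p q (w(p := v)) * H (w(p := v)) \<partial>law (p < n1)) = 0"
    unfolding indep by eventually_elim (use q in \<open>simp add: rs_def\<close>)
qed

text \<open>A degenerate term integrates to 0 over either coordinate, so that it suffices that the other
  factor ignores one of the two.\<close>

lemma rs_orthogonal: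
  assumes p: "p < n1 + n2" and q: "q < n1 + n2" "p \<noteq> q"
    and H: "H \<in> borel_measurable M" "integrable M (\<lambda>x. (H x)^2)"
    and indep: "(\<forall>w v. H (w(p := v)) = H w) \<or> (\<forall>w v. H (w(q := v)) = H w)"
  shows "(\<integral>x. rs p q x * H x \<partial>M) = 0"
  using indep
proof
  assume "\<forall>w v. H (w(p := v)) = H w"
  then show ?thesis by (intro rs_orthogonal_fst p q H) auto
next
  assume "\<forall>w v. H (w(q := v)) = H w"
  then have "(\<integral>x. rs q p x * H x \<partial>M) = 0"
    using p q H by (intro rs_orthogonal_fst) auto
  moreover have "(\<integral>x. rs p q x * H x \<partial>M) = (\<integral>x. rs q p x * H x \<partial>M)"
    using p q by (intro Bochner_Integration.integral_cong refl) (simp add: rs_sym)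
  ultimately show ?thesis by simp
qed

lemma lin_eq: "lin n1 n2 S x = 2 * (\<Sum>p\<in>I. label_weight n1 n2 S p * cw p x)"
  by (simp add: lin_def cw_def)

lemma quad_eq: "quad n1 n2 S x = (\<Sum>z\<in>(SIGMA p:I. I - {p}). coef n1 n2 S (fst z) (snd z) * rs (fst z) (snd z) x)"
  unfolding quad_def rs_def by (simp add: sum.Sigma case_prod_beta')

lemma lin_measurable [measurable]: "lin n1 n2 S \<in> borel_measurable M"
  unfolding lin_eq[abs_def] by (intro borel_measurable_times borel_measurable_const borel_measurable_sum cw_measurable) auto

lemma quad_measurable [measurable]: "quad n1 n2 S \<in> borel_measurable M"
  unfolding quad_eq[abs_def] by (intro borel_measurable_times borel_measurable_const borel_measurable_sum rs_measurable) auto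

lemma cw_mult_integrable: "p < n1 + n2 \<Longrightarrow> q < n1 + n2 \<Longrightarrow> integrable M (\<lambda>x. cw p x * cw q x)"
  by (intro integrable_mult_of_squares cw_measurable cw_square)

lemma rs_mult_integrable:
  "p < n1 + n2 \<Longrightarrow> q < n1 + n2 \<Longrightarrow> p \<noteq> q \<Longrightarrow> p' < n1 + n2 \<Longrightarrow> q' < n1 + n2 \<Longrightarrow> p' \<noteq> q'
    \<Longrightarrow> integrable M (\<lambda>x. rs p q x * rs p' q' x)"
  by (intro integrable_mult_of_squares rs_measurable rs_square)

lemma cw_rs_integrable:
  "r < n1 + n2 \<Longrightarrow> p < n1 + n2 \<Longrightarrow> q < n1 + n2 \<Longrightarrow> p \<noteq> q \<Longrightarrow> integrable M (\<lambda>x. rs p q x * cw r x)"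
  by (intro integrable_mult_of_squares rs_measurable rs_square cw_measurable cw_square)

lemma cw_cw_integral:
  assumes "p < n1 + n2" "q < n1 + n2"
  shows "(\<integral>x. cw p x * cw q x \<partial>M) = (if p = q then witness_var (p < n1) else 0)"
proof (cases "p = q")
  case True
  then show ?thesis using cw_square(2)[OF assms(1)] by (simp add: power2_eq_square)
next
  case False
  then show ?thesis
    using cw_orthogonal[OF assms(1) cw_measurable[OF assms(2)] cw_square(1)[OF assms(2)]]
    by (simp add: cw_def)
qed

lemma rs_cw_integral:
  assumes "r < n1 + n2" "p < n1 + n2" "q < n1 + n2" "p \<noteq> q"
  shows "(\<integral>x. rs p q x * cw r x \<partial>M) = 0"
  by (rule rs_orthogonal[OF assms(2,3,4) cw_measurable[OF assms(1)] cw_square(1)[OF assms(1)]])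
    (use assms(4) in \<open>auto simp: cw_def\<close>)

lemma rs_rs_integral:
  assumes "p < n1 + n2" "q < n1 + n2" "p \<noteq> q" "p' < n1 + n2" "q' < n1 + n2" "p' \<noteq> q'"
    and "{p, q} \<noteq> {p', q'}"
  shows "(\<integral>x. rs p q x * rs p' q' x \<partial>M) = 0"
proof (rule rs_orthogonal[OF assms(1-3) rs_measurable[OF assms(4,5)] rs_square(1)[OF assms(4-6)]])
  have "p \<notin> {p', q'} \<or> q \<notin> {p', q'}" using assms by auto
  then show "(\<forall>w v. rs p' q' (w(p := v)) = rs p' q' w) \<or> (\<forall>w v. rs p' q' (w(q := v)) = rs p' q' w)"
    by (auto simp: rs_def)
qed

lemma lin_square: "integrable M (\<lambda>x. (lin n1 n2 S x)^2)"
    "(\<integral>x. (lin n1 n2 S x)^2 \<partial>M) = 4 * (\<Sum>p\<in>I. (label_weight n1 n2 S p)^2 * witness_var (p < n1))"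
proof -
  let ?d = "label_weight n1 n2 S"
  have e: "(lin n1 n2 S x)^2 = 4 * (\<Sum>p\<in>I. \<Sum>q\<in>I. ?d p * ?d q * (cw p x * cw q x))" for x
    unfolding lin_eq power_mult_distrib power2_eq_square[of "sum _ _"] sum_product
    by (simp add: mult_ac)
  show "integrable M (\<lambda>x. (lin n1 n2 S x)^2)"
    unfolding e by (intro integrable_mult_right Bochner_Integration.integrable_sum cw_mult_integrable) auto
  have "(\<integral>x. (lin n1 n2 S x)^2 \<partial>M) = 4 * (\<Sum>p\<in>I. \<Sum>q\<in>I. ?d p * ?d q * (\<integral>x. cw p x * cw q x \<partial>M))"
  proof -
    have i: "integrable M (\<lambda>x. ?d p * ?d q * (cw p x * cw q x))" if "p \<in> I" "q \<in> I" for p q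
      using that by (intro integrable_mult_right cw_mult_integrable) auto
    have "(\<integral>x. (\<Sum>p\<in>I. \<Sum>q\<in>I. ?d p * ?d q * (cw p x * cw q x)) \<partial>M)
        = (\<Sum>p\<in>I. (\<integral>x. (\<Sum>q\<in>I. ?d p * ?d q * (cw p x * cw q x)) \<partial>M))"
      by (rule Bochner_Integration.integral_sum) (intro Bochner_Integration.integrable_sum i)
    also have "\<dots> = (\<Sum>p\<in>I. \<Sum>q\<in>I. (\<integral>x. ?d p * ?d q * (cw p x * cw q x) \<partial>M))"
      by (intro sum.cong refl Bochner_Integration.integral_sum i)
    finally show ?thesis unfolding e by simp
  qed
  also have "\<dots> = 4 * (\<Sum>p\<in>I. \<Sum>q\<in>I. if q = p then (?d p)^2 * witness_var (p < n1) else 0)"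
    by (intro arg_cong[where f="\<lambda>t. 4 * t"] sum.cong refl) (auto simp: cw_cw_integral power2_eq_square)
  finally show "(\<integral>x. (lin n1 n2 S x)^2 \<partial>M) = 4 * (\<Sum>p\<in>I. (?d p)^2 * witness_var (p < n1))"
    by simp
qed

text \<open>Terms with different unordered index pairs are orthogonal; each pair is counted in both orders,
  whence the factor 2.\<close>

lemma quad_square: "integrable M (\<lambda>x. (quad n1 n2 S x)^2)"
    "(\<integral>x. (quad n1 n2 S x)^2 \<partial>M) \<le> 2 * psi_YZ2 P Q g * (\<Sum>p\<in>I. \<Sum>q\<in>I - {p}. (coef n1 n2 S p q)^2)"
proof -
  define D where "D = (SIGMA p:I. I - {p})"
  define c where "c z = coef n1 n2 S (fst z) (snd z)" for z
  define r where "r z = rs (fst z) (snd z)" for z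
  have D: "fst z < n1 + n2" "snd z < n1 + n2" "fst z \<noteq> snd z" if "z \<in> D" for z
    using that by (auto simp: D_def)
  have finD: "finite D" by (auto simp: D_def)
  have int: "integrable M (\<lambda>x. r z x * r z' x)" if "z \<in> D" "z' \<in> D" for z z'
    unfolding r_def using D[OF that(1)] D[OF that(2)] by (intro rs_mult_integrable)
  have e: "(quad n1 n2 S x)^2 = (\<Sum>z\<in>D. \<Sum>z'\<in>D. c z * c z' * (r z x * r z' x))" for x
    unfolding quad_eq power2_eq_square[of "sum _ _"] sum_product D_def[symmetric] c_def r_def
    by (simp add: mult_ac)
  show "integrable M (\<lambda>x. (quad n1 n2 S x)^2)"
    unfolding e by (intro integrable_mult_right Bochner_Integration.integrable_sum int)
  have inner: "(\<Sum>z'\<in>D. c z * c z' * (\<integral>x. r z x * r z' x \<partial>M)) \<le> 2 * psi_YZ2 P Q g * (c z)^2" if z: "z \<in> D" for z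
  proof -
    define sw where "sw = (snd z, fst z)"
    have sw: "sw \<in> D" "z \<noteq> sw" using z by (auto simp: D_def sw_def)
    have csw: "c sw = c z" by (simp add: c_def sw_def coef_sym)
    have zero: "(\<integral>x. r z x * r z' x \<partial>M) = 0" if "z' \<in> D - {z, sw}" for z'
      unfolding r_def
    proof (rule rs_rs_integral)
      show "{fst z, snd z} \<noteq> {fst z', snd z'}"
        using that by (auto simp: sw_def doubleton_eq_iff prod_eq_iff)
    qed (use D[OF z] D[of z'] that in auto)
    have swr: "(\<integral>x. r z x * r sw x \<partial>M) = (\<integral>x. r z x * r z x \<partial>M)"
      using D[OF z] by (intro Bochner_Integration.integral_cong refl) (simp add: r_def sw_def rs_sym)
    have "(\<Sum>z'\<in>D. c z * c z' * (\<integral>x. r z x * r z' x \<partial>M))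
        = (\<Sum>z'\<in>{z, sw}. c z * c z' * (\<integral>x. r z x * r z' x \<partial>M))"
      using finD z sw zero by (intro sum.mono_neutral_right) auto
    also have "\<dots> = 2 * (c z)^2 * (\<integral>x. (r z x)^2 \<partial>M)"
      using sw(2) csw swr by (simp add: power2_eq_square)
    also have "\<dots> \<le> 2 * (c z)^2 * psi_YZ2 P Q g"
      unfolding r_def using D[OF z] by (intro mult_left_mono rs_square) auto
    finally show ?thesis by (simp add: mult_ac)
  qed
  have "(\<integral>x. (quad n1 n2 S x)^2 \<partial>M) = (\<Sum>z\<in>D. \<Sum>z'\<in>D. c z * c z' * (\<integral>x. r z x * r z' x \<partial>M))"
    unfolding e by (simp add: int)
  also have "\<dots> \<le> (\<Sum>z\<in>D. 2 * psi_YZ2 P Q g * (c z)^2)"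
    by (intro sum_mono inner)
  also have "\<dots> = 2 * psi_YZ2 P Q g * (\<Sum>p\<in>I. \<Sum>q\<in>I - {p}. (coef n1 n2 S p q)^2)"
    unfolding D_def c_def by (simp add: sum_distrib_left[symmetric] sum.Sigma case_prod_beta')
  finally show "(\<integral>x. (quad n1 n2 S x)^2 \<partial>M) \<le> 2 * psi_YZ2 P Q g * (\<Sum>p\<in>I. \<Sum>q\<in>I - {p}. (coef n1 n2 S p q)^2)" .
qed

lemma lin_quad_integral: "integrable M (\<lambda>x. lin n1 n2 S x * quad n1 n2 S' x)"
  "(\<integral>x. lin n1 n2 S x * quad n1 n2 S' x \<partial>M) = 0"
proof -
  define D where "D = (SIGMA p:I. I - {p})"
  have D: "fst z < n1 + n2" "snd z < n1 + n2" "fst z \<noteq> snd z" if "z \<in> D" for z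
    using that by (auto simp: D_def)
  show "integrable M (\<lambda>x. lin n1 n2 S x * quad n1 n2 S' x)"
    by (rule integrable_mult_of_squares[OF lin_measurable quad_measurable lin_square(1) quad_square(1)])
  have e: "lin n1 n2 S x * quad n1 n2 S' x = 2 * (\<Sum>p\<in>I. \<Sum>z\<in>D. label_weight n1 n2 S p *
      coef n1 n2 S' (fst z) (snd z) * (rs (fst z) (snd z) x * cw p x))" for x
    unfolding quad_eq lin_eq D_def[symmetric] mult.assoc[of 2] sum_product by (simp add: mult_ac)
  have "(\<integral>x. lin n1 n2 S x * quad n1 n2 S' x \<partial>M) = 2 * (\<Sum>p\<in>I. \<Sum>z\<in>D. label_weight n1 n2 S p *
      coef n1 n2 S' (fst z) (snd z) * (\<integral>x. rs (fst z) (snd z) x * cw p x \<partial>M))"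
    unfolding e using D by (simp add: cw_rs_integrable)
  also have "\<dots> = 0" using D by (simp add: rs_cw_integral)
  finally show "(\<integral>x. lin n1 n2 S x * quad n1 n2 S' x \<partial>M) = 0" .
qed

text \<open>The linear and the degenerate part are orthogonal, and so are the summands of the linear part.\<close>

lemma lin_quad_sum_square:
  "integrable M (\<lambda>x. (lin n1 n2 S x + quad n1 n2 S x)^2)"
  "(\<integral>x. (lin n1 n2 S x + quad n1 n2 S x)^2 \<partial>M)
    \<le> 4 * (\<Sum>p\<in>I. (label_weight n1 n2 S p)^2 * witness_var (p < n1))
      + 2 * psi_YZ2 P Q g * (\<Sum>p\<in>I. \<Sum>q\<in>I - {p}. (coef n1 n2 S p q)^2)"
proof -
  show "integrable M (\<lambda>x. (lin n1 n2 S x + quad n1 n2 S x)^2)"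
    by (rule integrable_square_add[OF lin_measurable quad_measurable lin_square(1) quad_square(1)])
  have "(\<integral>x. (lin n1 n2 S x + quad n1 n2 S x)^2 \<partial>M)
     = (\<integral>x. (lin n1 n2 S x)^2 + (quad n1 n2 S x)^2 + 2 * (lin n1 n2 S x * quad n1 n2 S x) \<partial>M)"
    by (simp add: power2_sum mult_ac)
  also have "\<dots> = (\<integral>x. (lin n1 n2 S x)^2 \<partial>M) + (\<integral>x. (quad n1 n2 S x)^2 \<partial>M)"
    using lin_square(1) quad_square(1) lin_quad_integral by simp
  finally show "(\<integral>x. (lin n1 n2 S x + quad n1 n2 S x)^2 \<partial>M)
    \<le> 4 * (\<Sum>p\<in>I. (label_weight n1 n2 S p)^2 * witness_var (p < n1))
      + 2 * psi_YZ2 P Q g * (\<Sum>p\<in>I. \<Sum>q\<in>I - {p}. (coef n1 n2 S p q)^2)"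
    using lin_square(2) quad_square(2) by simp
qed

lemma lin_integral: "integrable M (lin n1 n2 S)" "(\<integral>x. lin n1 n2 S x \<partial>M) = 0"
proof -
  interpret prob_space M by (rule two_sample_prob)
  show "integrable M (lin n1 n2 S)" by (rule integrable_of_square[OF lin_measurable lin_square(1)])
  have int: "integrable M (cw p)" if "p \<in> I" for p
    using that by (intro integrable_of_square[OF cw_measurable cw_square(1)]) auto
  have "(\<integral>x. cw p x \<partial>M) = 0" if "p \<in> I" for p
    using cw_orthogonal[of p "\<lambda>_. 1"] that by simp
  then show "(\<integral>x. lin n1 n2 S x \<partial>M) = 0" unfolding lin_eq by (simp add: int)
qed

lemma quad_integral: "integrable M (quad n1 n2 S)" "(\<integral>x. quad n1 n2 S x \<partial>M) = 0"
proof -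
  interpret prob_space M by (rule two_sample_prob)
  show "integrable M (quad n1 n2 S)" by (rule integrable_of_square[OF quad_measurable quad_square(1)])
  have int: "integrable M (rs (fst z) (snd z))" if "z \<in> (SIGMA p:I. I - {p})" for z
    using that by (intro integrable_of_square[OF rs_measurable rs_square(1)]) auto
  have "(\<integral>x. rs (fst z) (snd z) x \<partial>M) = 0" if "z \<in> (SIGMA p:I. I - {p})" for z
  proof -
    have "fst z < n1 + n2" "snd z < n1 + n2" "fst z \<noteq> snd z" using that by auto
    from rs_orthogonal[OF this, of "\<lambda>_. 1"] show ?thesis by simp
  qed
  then show "(\<integral>x. quad n1 n2 S x \<partial>M) = 0" unfolding quad_eq by (simp add: int)
qed

text \<open>The expectation runs over the data and the inner mean over the splits. Adding the coordinates
  one at a time, \<open>L4_norm_smooth\<close> bounds the increase of the squared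
  \<open>L\<^sup>4\<close> norm by a centered term plus the variance of the new coordinate. Only
  second moments of the data are used, although the norm is a fourth moment over splits; this is
  what permits a fourth-moment tail bound over permutations for data with two moments.\<close>

lemma lin_L4_norm_expectation:
  fixes A :: "'b set" and S :: "'b \<Rightarrow> nat set"
  assumes A: "finite A" "A \<noteq> {}" and v: "\<And>b. witness_var b \<le> v"
  shows "integrable M (\<lambda>x. sqrt (mean A (\<lambda>a. (lin n1 n2 (S a) x)^4)))"
    and "(\<integral>x. sqrt (mean A (\<lambda>a. (lin n1 n2 (S a) x)^4)) \<partial>M)
      \<le> 12 * v * (\<Sum>p\<in>I. sqrt (mean A (\<lambda>a. (label_weight n1 n2 (S a) p)^4)))"
proof -
  interpret PM: prob_space M by (rule two_sample_prob)
  define d where "d a p = label_weight n1 n2 (S a) p" for a p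
  define Y where "Y p = sqrt (mean A (\<lambda>a. (d a p)^4))" for p
  define F where "F \<epsilon> K x = sqrt (\<epsilon> + mean A (\<lambda>a. (\<Sum>p\<in>K. d a p * cw p x)^4))" for \<epsilon> K x
  have Ynn: "0 \<le> Y p" for p unfolding Y_def by (intro real_sqrt_ge_zero mean_nonneg) simp
  have Fint: "integrable M (F \<epsilon> K)" if K: "K \<subseteq> I" and e: "0 \<le> \<epsilon>" for \<epsilon> K
  proof (rule Bochner_Integration.integrable_bound)
    have finK: "finite K" using K finite_subset by auto
    have sq: "integrable M (\<lambda>x. (\<Sum>p\<in>K. d a p * cw p x)^2)" for a
      unfolding power2_eq_square sum_product
      using K cw_mult_integrable
      by (intro Bochner_Integration.integrable_sum)
        (auto intro!: integrable_mult_right simp: mult.assoc mult.left_commute[of "cw _ _"] subset_iff)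
    then show "integrable M (\<lambda>x. sqrt \<epsilon> + (\<Sum>a\<in>A. (\<Sum>p\<in>K. d a p * cw p x)^2))"
      by (intro Bochner_Integration.integrable_add Bochner_Integration.integrable_sum) auto
    have [measurable]: "cw p \<in> borel_measurable M" if "p \<in> K" for p using K that by (intro cw_measurable) auto
    show "F \<epsilon> K \<in> borel_measurable M" unfolding F_def mean_def by measurable
    show "AE x in M. norm (F \<epsilon> K x) \<le> norm (sqrt \<epsilon> + (\<Sum>a\<in>A. (\<Sum>p\<in>K. d a p * cw p x)^2))"
    proof (rule AE_I2)
      fix x
      define t where "t a = (\<Sum>p\<in>K. d a p * cw p x)" for a
      have "mean A (\<lambda>a. (t a)^4) \<le> (\<Sum>a\<in>A. (t a)^4) / 1"
        unfolding mean_def using A by (intro divide_left_mono sum_nonneg) (auto simp: card_gt_0_iff Suc_leI)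
      also have "\<dots> = (\<Sum>a\<in>A. ((t a)^2)^2)" by simp
      also have "\<dots> \<le> (\<Sum>a\<in>A. (t a)^2)^2" by (rule sum_power2_le_power2_sum) auto
      finally have "mean A (\<lambda>a. (t a)^4) \<le> (\<Sum>a\<in>A. (t a)^2)^2" .
      then have "sqrt (mean A (\<lambda>a. (t a)^4)) \<le> sqrt ((\<Sum>a\<in>A. (t a)^2)^2)"
        by (rule real_sqrt_le_mono)
      then have "F \<epsilon> K x \<le> sqrt \<epsilon> + sqrt ((\<Sum>a\<in>A. (t a)^2)^2)"
        unfolding F_def t_def[symmetric] using e
          sqrt_add_le_add_sqrt[of \<epsilon> "mean A (\<lambda>a. (t a)^4)"] mean_nonneg[of A "\<lambda>a. (t a)^4"] by simp
      then have "F \<epsilon> K x \<le> sqrt \<epsilon> + (\<Sum>a\<in>A. (t a)^2)" by (simp add: sum_nonneg)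
      moreover have "0 \<le> F \<epsilon> K x" unfolding F_def using e
        by (intro real_sqrt_ge_zero add_nonneg_nonneg mean_nonneg) auto
      ultimately show "norm (F \<epsilon> K x) \<le> norm (sqrt \<epsilon> + (\<Sum>a\<in>A. (\<Sum>p\<in>K. d a p * cw p x)^2))"
        unfolding t_def by simp
    qed
  qed
  have step: "(\<integral>x. F \<epsilon> K x \<partial>M) \<le> sqrt \<epsilon> + 3 * v * (\<Sum>p\<in>K. Y p)"
    if "finite K" "K \<subseteq> I" and e: "0 < \<epsilon>" for K \<epsilon>
    using that(1,2)
  proof (induction K rule: finite_induct)
    case empty
    have "F \<epsilon> {} x = sqrt \<epsilon>" for x unfolding F_def using A by (simp add: mean_const)
    then show ?case by (simp add: PM.prob_space)
  next
    case (insert p K)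
    have p: "p < n1 + n2" and K: "K \<subseteq> I" using insert.prems by auto
    interpret b: prob_space "law (p < n1)" by (rule law_prob)
    define t where "t u = witness u - witness_mean (p < n1)" for u
    have tint: "integrable (law (p < n1)) t" unfolding t_def using witness_integrable by simp
    have t0: "(\<integral>u. t u \<partial>law (p < n1)) = 0"
      unfolding t_def using witness_integrable by (simp add: witness_mean_def b.prob_space)
    have t2int: "integrable (law (p < n1)) (\<lambda>u. (t u)^2)" unfolding t_def by (rule witness_centered_square_integrable)
    have t2: "(\<integral>u. (t u)^2 \<partial>law (p < n1)) \<le> v" using v[of "p < n1"] by (simp add: t_def witness_var_def)
    have "integrable M (F \<epsilon> (insert p K))" using insert.prems e by (intro Fint) auto
    note res = PiM_resample_integral[where M = "\<lambda>i. law (i < n1)" and I = I and k = p and F = "F \<epsilon> (insert p K)",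
        OF _ law_prob _ this[unfolded two_sample_law], folded two_sample_law]
    have "(\<integral>x. F \<epsilon> (insert p K) x \<partial>M)
        = (\<integral>w. (\<integral>u. F \<epsilon> (insert p K) (w(p := u)) \<partial>law (p < n1)) \<partial>M)"
      using p by (intro res(1)) auto
    also have "\<dots> \<le> (\<integral>w. F \<epsilon> K w + 3 * v * Y p \<partial>M)"
    proof (rule integral_mono_AE)
      show "integrable M (\<lambda>w. \<integral>u. F \<epsilon> (insert p K) (w(p := u)) \<partial>law (p < n1))"
        using p by (intro res(2)) auto
      show "integrable M (\<lambda>w. F \<epsilon> K w + 3 * v * Y p)" using Fint[OF K] e by simp
      have "AE w in M. integrable (law (p < n1)) (\<lambda>u. F \<epsilon> (insert p K) (w(p := u)))"
        using p by (intro res(3)) auto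
      then show "AE w in M. (\<integral>u. F \<epsilon> (insert p K) (w(p := u)) \<partial>law (p < n1)) \<le> F \<epsilon> K w + 3 * v * Y p"
      proof eventually_elim
        case (elim w)
        obtain D where D: "\<And>t. sqrt (\<epsilon> + mean A (\<lambda>a. ((\<Sum>q\<in>K. d a q * cw q w) + t * d a p)^4))
            \<le> sqrt (\<epsilon> + mean A (\<lambda>a. (\<Sum>q\<in>K. d a q * cw q w)^4)) + t * D
              + 3 * t^2 * sqrt (mean A (\<lambda>a. (d a p)^4))"
          using L4_norm_smooth[OF A e, of "\<lambda>a. \<Sum>q\<in>K. d a q * cw q w" "\<lambda>a. d a p"] by blast
        have eq: "F \<epsilon> (insert p K) (w(p := u)) = sqrt (\<epsilon> + mean A (\<lambda>a. ((\<Sum>q\<in>K. d a q * cw q w) + t u * d a p)^4))" for u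
        proof -
          have "(\<Sum>q\<in>insert p K. d a q * cw q (w(p := u))) = (\<Sum>q\<in>K. d a q * cw q w) + t u * d a p" for a
          proof -
            have "(\<Sum>q\<in>K. d a q * cw q (w(p := u))) = (\<Sum>q\<in>K. d a q * cw q w)"
              using insert.hyps by (intro sum.cong refl) (auto simp: cw_def)
            then show ?thesis using insert.hyps by (simp add: cw_def t_def)
          qed
          then show ?thesis unfolding F_def by simp
        qed
        have pt: "F \<epsilon> (insert p K) (w(p := u)) \<le> F \<epsilon> K w + t u * D + 3 * (t u)^2 * Y p" for u
          unfolding eq using D[of "t u"] by (simp add: F_def Y_def)
        have "integrable (law (p < n1)) (\<lambda>u. F \<epsilon> K w + t u * D + 3 * (t u)^2 * Y p)"
          using tint t2int by simp
        with elim have "(\<integral>u. F \<epsilon> (insert p K) (w(p := u)) \<partial>law (p < n1))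
            \<le> (\<integral>u. F \<epsilon> K w + t u * D + 3 * (t u)^2 * Y p \<partial>law (p < n1))"
          using pt by (intro integral_mono)
        also have "\<dots> = F \<epsilon> K w + 3 * (\<integral>u. (t u)^2 \<partial>law (p < n1)) * Y p"
          using tint t2int t0 by (simp add: b.prob_space)
        also have "\<dots> \<le> F \<epsilon> K w + 3 * v * Y p"
          using t2 Ynn[of p] by (intro add_left_mono mult_right_mono) auto
        finally show ?case .
      qed
    qed
    also have "\<dots> = (\<integral>w. F \<epsilon> K w \<partial>M) + 3 * v * Y p"
      using Fint[OF K] e by (simp add: PM.prob_space)
    also have "\<dots> \<le> sqrt \<epsilon> + 3 * v * (\<Sum>p\<in>insert p K. Y p)"
      using insert.IH[OF K] insert.hyps by (simp add: algebra_simps)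
    finally show ?case .
  qed
  have lin4: "sqrt (mean A (\<lambda>a. (lin n1 n2 (S a) x)^4)) = 4 * F 0 I x" for x
  proof -
    have "(lin n1 n2 (S a) x)^4 = 16 * (\<Sum>p\<in>I. d a p * cw p x)^4" for a
      unfolding lin_eq d_def by (simp add: power_mult_distrib)
    then have "mean A (\<lambda>a. (lin n1 n2 (S a) x)^4) = 4^2 * mean A (\<lambda>a. (\<Sum>p\<in>I. d a p * cw p x)^4)"
      by (simp add: mean_cmult)
    then show ?thesis unfolding F_def by (simp add: real_sqrt_mult)
  qed
  show "integrable M (\<lambda>x. sqrt (mean A (\<lambda>a. (lin n1 n2 (S a) x)^4)))"
    unfolding lin4 using Fint[of I 0] by simp
  have "(\<integral>x. F 0 I x \<partial>M) \<le> 3 * v * (\<Sum>p\<in>I. Y p)"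
  proof (rule field_le_epsilon)
    fix e :: real assume e: "0 < e"
    have "F 0 I x \<le> F (e^2) I x" for x by (simp add: F_def)
    then have "(\<integral>x. F 0 I x \<partial>M) \<le> (\<integral>x. F (e^2) I x \<partial>M)"
      using Fint[of I 0] Fint[of I "e^2"] by (intro integral_mono) auto
    also have "\<dots> \<le> sqrt (e^2) + 3 * v * (\<Sum>p\<in>I. Y p)" using e by (intro step) auto
    finally show "(\<integral>x. F 0 I x \<partial>M) \<le> 3 * v * (\<Sum>p\<in>I. Y p) + e" using e by simp
  qed
  then show "(\<integral>x. sqrt (mean A (\<lambda>a. (lin n1 n2 (S a) x)^4)) \<partial>M)
      \<le> 12 * v * (\<Sum>p\<in>I. sqrt (mean A (\<lambda>a. (label_weight n1 n2 (S a) p)^4)))"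
    unfolding lin4 Y_def d_def by simp
qed

end

end

section \<open>The first-order variance components\<close>

context two_sample_kernel
begin

lemma g_pair_integrable:
  assumes "p < n1 + n2" "q < n1 + n2" "p \<noteq> q"
  shows "integrable (two_sample P Q n1 n2) (\<lambda>w. g (w p) (w q))"
  using two_sample_pair_integral(2)[OF assms g_measurable_law] g_integrable by simp

lemma proj_component_integrable:
  assumes "p < n1 + n2"
  shows "integrable (two_sample P Q n1 n2) (\<lambda>w. proj c (w p))"
  using two_sample_component_integral(2)[OF assms proj_measurable] proj_integrable by simp

text \<open>A version of the conditional expectation of \<open>g (w p) (w q)\<close> given the coordinate
  \<open>w i\<close>, as a function of its value.\<close>

definition pair_cond :: "nat \<Rightarrow> nat \<Rightarrow> nat \<Rightarrow> nat \<Rightarrow> 'a \<Rightarrow> real" where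
  "pair_cond n1 i p q x = (if p = i then proj (q < n1) x else if q = i then proj (p < n1) x
     else theta (p < n1) (q < n1))"

lemma pair_cond_measurable [measurable]: "pair_cond n1 i p q \<in> borel_measurable P"
proof -
  consider "p = i" | "p \<noteq> i" "q = i" | "p \<noteq> i" "q \<noteq> i" by blast
  then show ?thesis
    by cases (simp_all add: pair_cond_def[abs_def] proj_measurable)
qed

lemma pair_cond_integrable:
  assumes "i < n1 + n2"
  shows "integrable (two_sample P Q n1 n2) (\<lambda>w. pair_cond n1 i p q (w i))"
proof -
  interpret prob_space "two_sample P Q n1 n2" by (rule two_sample_prob)
  consider "p = i" | "p \<noteq> i" "q = i" | "p \<noteq> i" "q \<noteq> i" by blast
  then show ?thesis
    by cases (simp_all add: pair_cond_def proj_component_integrable[OF assms])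
qed

text \<open>The defining property of the conditional expectation, by cases on whether the conditioning
  coordinate occurs in the pair.\<close>

lemma pair_cond_integral:
  assumes i: "i < n1 + n2" and p: "p < n1 + n2" and q: "q < n1 + n2" and pq: "p \<noteq> q"
    and B: "B \<in> sets P"
  shows "(\<integral>w. indicator B (w i) * g (w p) (w q) \<partial>two_sample P Q n1 n2)
    = (\<integral>w. indicator B (w i) * pair_cond n1 i p q (w i) \<partial>two_sample P Q n1 n2)"
proof -
  let ?M = "two_sample P Q n1 n2"
  interpret PM: prob_space ?M by (rule two_sample_prob)
  define H :: "(nat \<Rightarrow> 'a) \<Rightarrow> real" where "H w = indicator B (w i)" for w
  have Hm [measurable]: "H \<in> borel_measurable ?M"
  proof -
    have "(\<lambda>w. w i) \<in> ?M \<rightarrow>\<^sub>M P" using two_sample_component_measurable[OF i, of True] by (simp add: law_def)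
    moreover have "indicator B \<in> borel_measurable P" using B by (rule borel_measurable_indicator)
    ultimately show ?thesis unfolding H_def by (rule measurable_compose)
  qed
  have bd: "integrable ?M (\<lambda>w. H w * f w)" if "integrable ?M f" for f :: "_ \<Rightarrow> real"
  proof (rule Bochner_Integration.integrable_bound[OF that])
    show "(\<lambda>w. H w * f w) \<in> borel_measurable ?M"
      using Hm borel_measurable_integrable[OF that] by (rule borel_measurable_times)
  qed (auto simp: H_def indicator_def)
  have part: "(\<integral>w. H w * g (w p) (w q) \<partial>?M) = (\<integral>w. H w * pair_cond n1 i p q (w i) \<partial>?M)"
    if p: "p < n1 + n2" and q: "q < n1 + n2" and pq: "p \<noteq> q" and qi: "q \<noteq> i" for p q
  proof -
    have 1: "(\<integral>w. H w * g (w p) (w q) \<partial>?M) = (\<integral>w. (\<integral>v. H (w(q := v)) * g ((w(q := v)) p) ((w(q := v)) q) \<partial>law (q < n1)) \<partial>?M)"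
      unfolding two_sample_law using q bd[OF g_pair_integrable[OF p q pq], unfolded two_sample_law]
      by (intro PiM_resample_integral(1)[where M = "\<lambda>i. law (i < n1)"] law_prob) auto
    also have "\<dots> = (\<integral>w. H w * proj (q < n1) (w p) \<partial>?M)"
      using pq qi by (simp add: H_def proj_def)
    finally have 2: "(\<integral>w. H w * g (w p) (w q) \<partial>?M) = (\<integral>w. H w * proj (q < n1) (w p) \<partial>?M)" .
    show ?thesis
    proof (cases "p = i")
      case True
      then show ?thesis using 2 by (simp add: pair_cond_def)
    next
      case False
      have "(\<integral>w. H w * proj (q < n1) (w p) \<partial>?M) = (\<integral>w. (\<integral>v. H (w(p := v)) * proj (q < n1) ((w(p := v)) p) \<partial>law (p < n1)) \<partial>?M)"
        unfolding two_sample_law using p bd[OF proj_component_integrable[OF p], unfolded two_sample_law]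
        by (intro PiM_resample_integral(1)[where M = "\<lambda>i. law (i < n1)"] law_prob) auto
      also have "\<dots> = (\<integral>w. H w * theta (p < n1) (q < n1) \<partial>?M)"
        using False by (simp add: H_def theta_def)
      finally show ?thesis using 2 False qi by (simp add: pair_cond_def)
    qed
  qed
  show ?thesis
  proof (cases "q = i")
    case False
    then show ?thesis using part[OF p q pq] by (simp add: H_def)
  next
    case True
    have "(\<integral>w. H w * g (w p) (w q) \<partial>?M) = (\<integral>w. H w * g (w q) (w p) \<partial>?M)"
      using p q by (intro Bochner_Integration.integral_cong refl) (simp add: g_sym point_in_space)
    also have "\<dots> = (\<integral>w. H w * pair_cond n1 i q p (w i) \<partial>?M)"
      using True pq by (intro part p q) auto
    also have "pair_cond n1 i q p = pair_cond n1 i p q"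
      using True pq by (auto simp: pair_cond_def)
    finally show ?thesis by (simp add: H_def)
  qed
qed

text \<open>A function of the coordinate that passes the integral test on events of that coordinate is a
  version of the conditional expectation, which is unique almost everywhere.\<close>

lemma var_cond_exp_coordinate:
  fixes u :: "'a \<Rightarrow> real"
  assumes i: "i < n1 + n2" and N: "sets N = sets P"
    and f: "integrable (two_sample P Q n1 n2) f"
    and u: "u \<in> borel_measurable P" "integrable (two_sample P Q n1 n2) (\<lambda>w. u (w i))"
    and eq: "\<And>B. B \<in> sets P \<Longrightarrow> (\<integral>w. indicator B (w i) * f w \<partial>two_sample P Q n1 n2)
      = (\<integral>w. indicator B (w i) * u (w i) \<partial>two_sample P Q n1 n2)"
  shows "var_cond_exp (two_sample P Q n1 n2) N i f
    = (\<integral>x. (u x - (\<integral>x. u x \<partial>law (i < n1)))^2 \<partial>law (i < n1))"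
proof -
  let ?M = "two_sample P Q n1 n2"
  interpret PM: prob_space ?M by (rule two_sample_prob)
  define F where "F = vimage_algebra (space ?M) (\<lambda>w. w i) N"
  have spN: "space N = space P" using N by (rule sets_eq_imp_space_eq)
  have pt: "(\<lambda>w. w i) \<in> space ?M \<rightarrow> space N"
    using i by (auto simp: spN point_in_space)
  have mN: "(\<lambda>w. w i) \<in> ?M \<rightarrow>\<^sub>M N"
    using two_sample_component_measurable[OF i, of True] N spN by (simp add: law_def measurable_def)
  have setsF: "sets F = {(\<lambda>w. w i) -` B \<inter> space ?M | B. B \<in> sets N}"
    unfolding F_def by (rule sets_vimage_algebra2[OF pt])
  have sub: "subalgebra ?M F"
    unfolding subalgebra_def
  proof
    show "space F = space ?M" by (simp add: F_def)
    show "sets F \<subseteq> sets ?M" unfolding setsF using mN by (auto intro: measurable_sets)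
  qed
  interpret FM: finite_measure_subalgebra ?M F by unfold_locales (rule sub)
  have uF: "(\<lambda>w. u (w i)) \<in> borel_measurable F"
  proof -
    have "(\<lambda>w. w i) \<in> F \<rightarrow>\<^sub>M N" unfolding F_def by (rule measurable_vimage_algebra1[OF pt])
    moreover have "u \<in> borel_measurable N" using u(1) N spN by (simp add: measurable_def)
    ultimately show ?thesis by (rule measurable_compose)
  qed
  have AE: "AE x in ?M. real_cond_exp ?M F f x = u (x i)"
  proof (rule FM.real_cond_exp_charact[OF _ f u(2) uF])
    fix A assume "A \<in> sets F"
    then obtain B where B: "B \<in> sets P" "A = (\<lambda>w. w i) -` B \<inter> space ?M" unfolding setsF N by auto
    have "(\<integral>x. indicator A x *\<^sub>R h x \<partial>?M) = (\<integral>w. indicator B (w i) * h w \<partial>?M)" for h :: "_ \<Rightarrow> real"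
      using B(2) by (intro Bochner_Integration.integral_cong refl) (auto simp: indicator_def)
    then show "(\<integral>x\<in>A. f x \<partial>?M) = (\<integral>x\<in>A. u (x i) \<partial>?M)"
      unfolding set_lebesgue_integral_def using eq[OF B(1)] by simp
  qed
  have cm [measurable]: "real_cond_exp ?M F f \<in> borel_measurable ?M"
    by (rule borel_measurable_cond_exp2)
  have um [measurable]: "(\<lambda>w. u (w i)) \<in> borel_measurable ?M" using u(2) by auto
  have mean: "PM.expectation (real_cond_exp ?M F f) = (\<integral>x. u x \<partial>law (i < n1))"
  proof -
    have "PM.expectation (real_cond_exp ?M F f) = (\<integral>w. u (w i) \<partial>?M)"
      using AE by (intro integral_cong_AE) auto
    also have "\<dots> = (\<integral>x. u x \<partial>law (i < n1))" by (rule two_sample_component_integral[OF i u(1)])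
    finally show ?thesis .
  qed
  define c where "c = (\<integral>x. u x \<partial>law (i < n1))"
  have "var_cond_exp ?M N i f = (\<integral>w. (real_cond_exp ?M F f w - c)^2 \<partial>?M)"
    unfolding var_cond_exp_def F_def[symmetric] mean c_def ..
  also have "\<dots> = (\<integral>w. (u (w i) - c)^2 \<partial>?M)"
    using AE by (intro integral_cong_AE) auto
  also have "\<dots> = (\<integral>x. (u x - c)^2 \<partial>law (i < n1))"
  proof (rule two_sample_component_integral[OF i])
    note u(1)[measurable]
    show "(\<lambda>x. (u x - c)^2) \<in> borel_measurable P" by measurable
  qed
  finally show ?thesis unfolding c_def .
qed

lemma var_cond_exp_h_ho_sym:
  fixes n1 n2 i a b c d :: nat
  defines "u \<equiv> \<lambda>x. (pair_cond n1 i a b x + pair_cond n1 i b a x + pair_cond n1 i c d x + pair_cond n1 i d c x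
      - pair_cond n1 i a c x - pair_cond n1 i a d x - pair_cond n1 i b c x - pair_cond n1 i b d x) / 2"
  assumes i: "i < n1 + n2" and N: "sets N = sets P"
    and l: "a < n1 + n2" "b < n1 + n2" "c < n1 + n2" "d < n1 + n2" and dist: "distinct [a, b, c, d]"
  shows "var_cond_exp (two_sample P Q n1 n2) N i (\<lambda>w. h_ho_sym g (w a) (w b) (w c) (w d))
    = (\<integral>x. (u x - (\<integral>x. u x \<partial>law (i < n1)))^2 \<partial>law (i < n1))"
proof (rule var_cond_exp_coordinate[OF i N])
  let ?M = "two_sample P Q n1 n2"
  have h: "h_ho_sym g (w a) (w b) (w c) (w d) =
     (g (w a) (w b) + g (w b) (w a) + g (w c) (w d) + g (w d) (w c)
      - g (w a) (w c) - g (w a) (w d) - g (w b) (w c) - g (w b) (w d)) / 2" for w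
    by (simp add: h_ho_sym_def h_ho_def fact_numeral field_simps)
  have gi: "integrable ?M (\<lambda>w. g (w a) (w b))" "integrable ?M (\<lambda>w. g (w b) (w a))"
    "integrable ?M (\<lambda>w. g (w c) (w d))" "integrable ?M (\<lambda>w. g (w d) (w c))"
    "integrable ?M (\<lambda>w. g (w a) (w c))" "integrable ?M (\<lambda>w. g (w a) (w d))"
    "integrable ?M (\<lambda>w. g (w b) (w c))" "integrable ?M (\<lambda>w. g (w b) (w d))"
    using l dist by (auto intro!: g_pair_integrable)
  show "integrable ?M (\<lambda>w. h_ho_sym g (w a) (w b) (w c) (w d))"
    unfolding h using gi by simp
  show "u \<in> borel_measurable P" unfolding u_def by measurable
  show "integrable ?M (\<lambda>w. u (w i))" unfolding u_def using pair_cond_integrable[OF i] by simp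
  fix B assume B: "B \<in> sets P"
  have im: "(\<lambda>w. indicator B (w i) :: real) \<in> borel_measurable ?M"
  proof -
    have "(\<lambda>w. w i) \<in> ?M \<rightarrow>\<^sub>M P" using two_sample_component_measurable[OF i, of True] by (simp add: law_def)
    then show ?thesis using borel_measurable_indicator[OF B] by (rule measurable_compose)
  qed
  have bd: "integrable ?M (\<lambda>w. indicator B (w i) * f w)" if "integrable ?M f" for f :: "_ \<Rightarrow> real"
  proof (rule Bochner_Integration.integrable_bound[OF that])
    show "(\<lambda>w. indicator B (w i) * f w) \<in> borel_measurable ?M"
      using im borel_measurable_integrable[OF that] by (rule borel_measurable_times)
  qed (auto simp: indicator_def)
  note gB = gi[THEN bd]
  note uB = pair_cond_integrable[OF i, THEN bd]
  have pe: "(\<integral>w. indicator B (w i) * g (w p) (w q) \<partial>?M) = (\<integral>w. indicator B (w i) * pair_cond n1 i p q (w i) \<partial>?M)"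
    if "p \<in> {a, b, c, d}" "q \<in> {a, b, c, d}" "p \<noteq> q" for p q
    using that l by (intro pair_cond_integral i B) auto
  have "(\<integral>w. indicator B (w i) * h_ho_sym g (w a) (w b) (w c) (w d) \<partial>?M)
     = (\<integral>w. (indicator B (w i) * g (w a) (w b) + indicator B (w i) * g (w b) (w a)
        + indicator B (w i) * g (w c) (w d) + indicator B (w i) * g (w d) (w c)
        - indicator B (w i) * g (w a) (w c) - indicator B (w i) * g (w a) (w d)
        - indicator B (w i) * g (w b) (w c) - indicator B (w i) * g (w b) (w d)) / 2 \<partial>?M)"
    unfolding h by (simp add: algebra_simps)
  also have "\<dots> = ((\<integral>w. indicator B (w i) * g (w a) (w b) \<partial>?M) + (\<integral>w. indicator B (w i) * g (w b) (w a) \<partial>?M)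
        + (\<integral>w. indicator B (w i) * g (w c) (w d) \<partial>?M) + (\<integral>w. indicator B (w i) * g (w d) (w c) \<partial>?M)
        - (\<integral>w. indicator B (w i) * g (w a) (w c) \<partial>?M) - (\<integral>w. indicator B (w i) * g (w a) (w d) \<partial>?M)
        - (\<integral>w. indicator B (w i) * g (w b) (w c) \<partial>?M) - (\<integral>w. indicator B (w i) * g (w b) (w d) \<partial>?M)) / 2"
    using gB by simp
  also have "\<dots> = ((\<integral>w. indicator B (w i) * pair_cond n1 i a b (w i) \<partial>?M) + (\<integral>w. indicator B (w i) * pair_cond n1 i b a (w i) \<partial>?M)
        + (\<integral>w. indicator B (w i) * pair_cond n1 i c d (w i) \<partial>?M) + (\<integral>w. indicator B (w i) * pair_cond n1 i d c (w i) \<partial>?M)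
        - (\<integral>w. indicator B (w i) * pair_cond n1 i a c (w i) \<partial>?M) - (\<integral>w. indicator B (w i) * pair_cond n1 i a d (w i) \<partial>?M)
        - (\<integral>w. indicator B (w i) * pair_cond n1 i b c (w i) \<partial>?M) - (\<integral>w. indicator B (w i) * pair_cond n1 i b d (w i) \<partial>?M)) / 2"
    using dist by (simp add: pe)
  also have "\<dots> = (\<integral>w. (indicator B (w i) * pair_cond n1 i a b (w i) + indicator B (w i) * pair_cond n1 i b a (w i)
        + indicator B (w i) * pair_cond n1 i c d (w i) + indicator B (w i) * pair_cond n1 i d c (w i)
        - indicator B (w i) * pair_cond n1 i a c (w i) - indicator B (w i) * pair_cond n1 i a d (w i)
        - indicator B (w i) * pair_cond n1 i b c (w i) - indicator B (w i) * pair_cond n1 i b d (w i)) / 2 \<partial>?M)"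
    using uB by simp
  also have "\<dots> = (\<integral>w. indicator B (w i) * u (w i) \<partial>?M)"
    unfolding u_def by (simp add: algebra_simps)
  finally show "(\<integral>w. indicator B (w i) * h_ho_sym g (w a) (w b) (w c) (w d) \<partial>?M)
     = (\<integral>w. indicator B (w i) * u (w i) \<partial>?M)" .
qed

lemma variance_affine_witness:
  assumes "e = 1 \<or> e = (-1::real)"
  shows "(\<integral>x. ((e * witness x + k) - (\<integral>x. e * witness x + k \<partial>law b))^2 \<partial>law b) = witness_var b"
proof -
  interpret b: prob_space "law b" by (rule law_prob)
  have "(\<integral>x. e * witness x + k \<partial>law b) = e * witness_mean b + k"
    using witness_integrable by (simp add: witness_mean_def b.prob_space)
  moreover have "((e * x + k) - (e * m + k))^2 = (x - m)^2" for x m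
    using assms by (auto simp: power2_eq_square algebra_simps)
  ultimately show ?thesis unfolding witness_var_def by simp
qed

text \<open>Conditioning the symmetrized kernel on one point leaves plus or minus the witness, up to a
  constant, whatever the laws of the other three points contribute; the variance depends on the
  law of the conditioning point only.\<close>

lemma var_cond_exp_h_witness:
  fixes n1 n2 i a b c d :: nat
  assumes "i < n1 + n2" "sets N = sets P"
    and "a < n1 + n2" "b < n1 + n2" "c < n1 + n2" "d < n1 + n2" "distinct [a, b, c, d]"
    and e: "e = 1 \<or> e = (-1::real)"
    and u: "\<And>x. (pair_cond n1 i a b x + pair_cond n1 i b a x + pair_cond n1 i c d x + pair_cond n1 i d c x
      - pair_cond n1 i a c x - pair_cond n1 i a d x - pair_cond n1 i b c x - pair_cond n1 i b d x) / 2
      = e * witness x + k"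
  shows "var_cond_exp (two_sample P Q n1 n2) N i (\<lambda>w. h_ho_sym g (w a) (w b) (w c) (w d)) = witness_var (i < n1)"
  unfolding var_cond_exp_h_ho_sym[OF assms(1-7)] u by (rule variance_affine_witness[OF e])

text \<open>The two conditioning points have the laws \<open>P\<close> and \<open>Q\<close> in both
  components, so that the two components agree.\<close>

lemma psi_Y1_eq: "psi_Y1 P Q g = max (witness_var True) (witness_var False)"
proof -
  have "var_cond_exp (two_sample P Q 3 3) P 0 (\<lambda>w. h_ho_sym g (w 0) (w 1) (w 3) (w 4)) = witness_var (0 < (3::nat))"
    by (rule var_cond_exp_h_witness[where e = "1" and k = "theta False False - theta True False"])
      (simp_all add: sets_Q pair_cond_def witness_def field_simps)
  moreover
  have "var_cond_exp (two_sample P Q 3 3) Q 5 (\<lambda>w. h_ho_sym g (w 5) (w 1) (w 3) (w 4)) = witness_var (5 < (3::nat))"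
    by (rule var_cond_exp_h_witness[where e = "1" and k = "theta False False - theta True False"])
      (simp_all add: sets_Q pair_cond_def witness_def field_simps)
  ultimately show ?thesis unfolding psi_Y1_def by simp
qed

lemma psi_Z1_eq: "psi_Z1 P Q g = max (witness_var True) (witness_var False)"
proof -
  have "var_cond_exp (two_sample P Q 3 3) Q 3 (\<lambda>w. h_ho_sym g (w 0) (w 1) (w 3) (w 4)) = witness_var (3 < (3::nat))"
    by (rule var_cond_exp_h_witness[where e = "-1" and k = "theta True True - theta True False"])
      (simp_all add: sets_Q pair_cond_def witness_def field_simps)
  moreover
  have "var_cond_exp (two_sample P Q 3 3) P 2 (\<lambda>w. h_ho_sym g (w 0) (w 1) (w 2) (w 4)) = witness_var (2 < (3::nat))"
    by (rule var_cond_exp_h_witness[where e = "-1" and k = "theta True True - theta True False"])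
      (simp_all add: sets_Q pair_cond_def witness_def field_simps)
  ultimately show ?thesis unfolding psi_Z1_def by (simp add: max.commute)
qed

end

section \<open>The randomized rank test\<close>

text \<open>In the series of \<open>exp k\<close> the terms with index \<open>k - 1\<close> and
  \<open>k\<close> are equal, so that together they are twice the latter. The factor 2 gained over
  the usual bound is what lowers the binomial tail from one third to one sixth of
  \<open>\<beta>\<close>.\<close>

lemma fact_ge_twice_power:
  assumes "1 \<le> k"
  shows "2 * (real k / exp 1)^k \<le> fact k"
proof -
  obtain j where j: "k = Suc j" using assms by (cases k) auto
  have s: "summable (\<lambda>n. real k ^ n /\<^sub>R fact n)" by (rule summable_exp_generic)
  have "(\<Sum>n\<in>{j, k}. real k ^ n /\<^sub>R fact n) \<le> (\<Sum>n. real k ^ n /\<^sub>R fact n)"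
    by (rule sum_le_suminf[OF s]) auto
  also have "\<dots> = exp (real k)" using exp_converges[of "real k"] by (simp add: sums_iff)
  also have "(\<Sum>n\<in>{j, k}. real k ^ n /\<^sub>R fact n) = 2 * real k ^ k / fact k"
    unfolding j by (simp add: divide_simps scaleR_conv_of_real)
  finally have "2 * real k ^ k \<le> exp (real k) * fact k" by (simp add: divide_le_eq)
  moreover have "exp (real k) = exp 1 ^ k" by (simp add: exp_of_nat_mult[symmetric])
  ultimately show ?thesis by (simp add: power_divide divide_le_eq mult.commute)
qed

text \<open>The union bound for at least \<open>k\<close> successes in \<open>B\<close> trials with success
  probability \<open>alpha_star\<close>. The exponent in \<open>alpha_star\<close> is chosen so
  that its \<open>k\<close>-th power produces \<open>\<beta> / 3\<close>.\<close>

lemma binomial_tail_le: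
  fixes \<alpha> \<beta> :: real and B :: nat
  assumes "0 < \<alpha>" "0 < \<beta>" and B: "1 \<le> \<alpha> * (real B + 1)"
  defines "k \<equiv> nat \<lfloor>\<alpha> * (real B + 1)\<rfloor>"
  shows "1 \<le> k" "real k \<le> \<alpha> * (real B + 1)"
    and "real (B choose k) * alpha_star \<alpha> \<beta> B ^ k \<le> \<beta> / 6"
proof -
  have fl: "1 \<le> \<lfloor>\<alpha> * (real B + 1)\<rfloor>" using B by (simp add: le_floor_iff)
  show k1: "1 \<le> k" using fl unfolding k_def by linarith
  have rk: "real k = of_int \<lfloor>\<alpha> * (real B + 1)\<rfloor>" using fl unfolding k_def by simp
  show "real k \<le> \<alpha> * (real B + 1)" unfolding rk by linarith
  have "\<alpha> * (real B + 1) < real k + 1" unfolding rk by linarith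
  also have "\<dots> \<le> 2 * real k" using k1 by simp
  finally have aB: "\<alpha> * real B \<le> 2 * real k" using assms(1) by (simp add: algebra_simps)
  have as: "alpha_star \<alpha> \<beta> B ^ k = (\<alpha> / (2 * exp 1))^k * (\<beta> / 3)"
  proof -
    have "((\<beta> / 3) powr (1 / real k)) ^ k = ((\<beta> / 3) powr (1 / real k)) powr real k"
      using assms(2) by (intro powr_realpow[symmetric]) simp
    also have "\<dots> = (\<beta> / 3) powr (1 / real k * real k)" by (rule powr_powr)
    also have "\<dots> = \<beta> / 3" using k1 assms(2) by simp
    finally show ?thesis unfolding alpha_star_def rk[symmetric] power_mult_distrib by simp
  qed
  have "real (B choose k) * fact k \<le> real B ^ k"
  proof -
    have "real ((B choose k) * fact k) \<le> real (B ^ k)" using binomial_fact_pow[of B k] by (simp only: of_nat_le_iff)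
    then show ?thesis by simp
  qed
  then have "real (B choose k) \<le> real B ^ k / fact k" by (simp add: le_divide_eq)
  then have "real (B choose k) * alpha_star \<alpha> \<beta> B ^ k \<le> real B ^ k / fact k * ((\<alpha> / (2 * exp 1))^k * (\<beta> / 3))"
    unfolding as using assms by (intro mult_right_mono) auto
  also have "\<dots> = (\<alpha> * real B / (2 * exp 1))^k / fact k * (\<beta> / 3)"
    by (simp add: power_mult_distrib power_divide mult_ac)
  also have "\<dots> \<le> (real k / exp 1)^k / fact k * (\<beta> / 3)"
    using assms aB by (intro mult_right_mono divide_right_mono power_mono) (auto simp: field_simps)
  also have "\<dots> \<le> 1 / 2 * (\<beta> / 3)"
    using fact_ge_twice_power[OF k1] assms by (intro mult_right_mono) (auto simp: divide_le_eq)
  finally show "real (B choose k) * alpha_star \<alpha> \<beta> B ^ k \<le> \<beta> / 6" by simp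
qed

lemma reject_prob_bounds: "0 \<le> reject_prob B \<alpha> R" "reject_prob B \<alpha> R \<le> 1"
  by (auto simp: reject_prob_def)

text \<open>If fewer than \<open>k\<close> permuted statistics reach the observed one, the rank is so large
  that the test rejects with certainty, however ties are broken. Otherwise some
  \<open>k\<close>-subset of them does, and the subtracted sum is at least 1.\<close>

lemma reject_prob_ge:
  fixes t :: "nat \<Rightarrow> real"
  assumes k: "real k \<le> \<alpha> * (real B + 1)"
  shows "1 - (\<Sum>J | J \<subseteq> {1..B} \<and> card J = k. \<Prod>b\<in>J. of_bool (t 0 \<le> t b))
    \<le> reject_prob B \<alpha> (test_rank B t \<tau>)"
proof -
  define E where "E = {b \<in> {1..B}. t 0 \<le> t b}"
  have finE: "finite E" by (auto simp: E_def)
  have nn: "0 \<le> (\<Sum>J | J \<subseteq> {1..B} \<and> card J = k. \<Prod>b\<in>J. of_bool (t 0 \<le> t b) :: real)"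
    by (intro sum_nonneg prod_nonneg) auto
  show ?thesis
  proof (cases "k \<le> card E")
    case True
    then obtain J where J: "J \<subseteq> E" "card J = k" by (meson obtain_subset_with_card_n)
    have "(1::real) = (\<Prod>b\<in>J. of_bool (t 0 \<le> t b))"
      using J by (intro prod.neutral[symmetric]) (auto simp: E_def)
    also have "\<dots> \<le> (\<Sum>J | J \<subseteq> {1..B} \<and> card J = k. \<Prod>b\<in>J. of_bool (t 0 \<le> t b))"
      using J by (intro member_le_sum[where f = "\<lambda>J. \<Prod>b\<in>J. of_bool (t 0 \<le> t b)"])
        (auto simp: E_def intro!: prod_nonneg)
    finally show ?thesis using reject_prob_bounds(1)[of B \<alpha>] by (meson diff_le_0_iff_le order_trans)
  next
    case False
    have "{1..B} - E \<subseteq> {b \<in> {1..B}. t b < t 0 \<or> (t b = t 0 \<and> \<tau> b < \<tau> 0)}" by (auto simp: E_def)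
    then have "card ({1..B} - E) \<le> card {b \<in> {1..B}. t b < t 0 \<or> (t b = t 0 \<and> \<tau> b < \<tau> 0)}"
      by (intro card_mono) auto
    moreover have "card ({1..B} - E) = B - card E"
      using finE by (subst card_Diff_subset) (auto simp: E_def)
    moreover have "card E \<le> B"
    proof -
      have "E \<subseteq> {1..B}" by (auto simp: E_def)
      from card_mono[OF finite_atLeastAtMost this] show ?thesis by simp
    qed
    ultimately have "real B + 2 - real k \<le> real (test_rank B t \<tau>)"
      using False unfolding test_rank_def by linarith
    then have "1 \<le> real (test_rank B t \<tau>) - (1 - \<alpha>) * (real B + 1)"
      using k by (simp add: algebra_simps)
    then have "reject_prob B \<alpha> (test_rank B t \<tau>) = 1" by (simp add: reject_prob_def)
    then show ?thesis using nn by simp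
  qed
qed

text \<open>Independence of the permutations turns the probability of a joint event into a power.\<close>

lemma perm_product_integral:
  fixes Pp :: "'p set" and B :: nat
  assumes \<Pi>: "finite Pp" "Pp \<noteq> {}" and J: "J \<subseteq> {1..B}"
  shows "(\<integral>ps. (\<Prod>b\<in>J. of_bool (R (ps b))) \<partial>(PiM {1..B} (\<lambda>_. uniform_count_measure Pp)))
    = mean Pp (\<lambda>\<pi>. of_bool (R \<pi>)) ^ card J"
proof -
  let ?U = "uniform_count_measure Pp"
  interpret U: prob_space ?U using \<Pi> by (rule prob_space_uniform_count_measure)
  interpret product_prob_space "\<lambda>_. ?U" "{1..B}"
    by (intro product_prob_spaceI) (rule U.prob_space_axioms)
  define f :: "nat \<Rightarrow> 'p \<Rightarrow> real" where "f b \<pi> = (if b \<in> J then of_bool (R \<pi>) else 1)" for b \<pi>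
  have meas: "h \<in> borel_measurable ?U" for h :: "'p \<Rightarrow> real"
    by (simp add: measurable_def sets_uniform_count_measure space_uniform_count_measure)
  have "(\<Prod>b\<in>J. of_bool (R (ps b))) = (\<Prod>b\<in>{1..B}. f b (ps b))" for ps
    using J by (intro prod.mono_neutral_cong_left) (auto simp: f_def)
  then have "(\<integral>ps. (\<Prod>b\<in>J. of_bool (R (ps b))) \<partial>(PiM {1..B} (\<lambda>_. ?U)))
      = (\<integral>ps. (\<Prod>b\<in>{1..B}. f b (ps b)) \<partial>(PiM {1..B} (\<lambda>_. ?U)))" by simp
  also have "\<dots> = (\<Prod>b\<in>{1..B}. \<integral>\<pi>. f b \<pi> \<partial>?U)"
  proof (rule product_integral_prod)
    show "integrable ?U (f b)" for b
      by (rule U.integrable_const_bound[of _ 1]) (auto simp: f_def meas)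
  qed simp
  also have "\<dots> = (\<Prod>b\<in>{1..B}. if b \<in> J then mean Pp (\<lambda>\<pi>. of_bool (R \<pi>)) else 1)"
  proof (intro prod.cong refl)
    fix b
    show "(\<integral>\<pi>. f b \<pi> \<partial>?U) = (if b \<in> J then mean Pp (\<lambda>\<pi>. of_bool (R \<pi>)) else 1)"
      using \<Pi> unfolding f_def by (simp add: integral_uniform_count_measure mean_def)
  qed
  also have "\<dots> = (\<Prod>b\<in>J. mean Pp (\<lambda>\<pi>. of_bool (R \<pi>)))"
    using J by (intro prod.mono_neutral_cong_right) auto
  finally show ?thesis by simp
qed

text \<open>Given the data, at least \<open>k\<close> of \<open>B\<close> independent permutations reach the
  observed statistic with probability at most the union bound, provided the fraction of such
  permutations is at most \<open>a\<close>. Data for which that fraction exceeds \<open>a\<close>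
  are given up.\<close>

lemma randomized_test_power:
  fixes B :: nat and T0 :: "'x \<Rightarrow> real" and T :: "'x \<Rightarrow> 'p \<Rightarrow> real" and Tau :: "(nat \<Rightarrow> nat) set"
  assumes M: "prob_space M" and Pp: "finite Pp" "Pp \<noteq> {}" and Tau: "finite Tau" "Tau \<noteq> {}"
    and T0m [measurable]: "T0 \<in> borel_measurable M"
    and Tm: "\<And>\<pi>. \<pi> \<in> Pp \<Longrightarrow> (\<lambda>x. T x \<pi>) \<in> borel_measurable M"
    and k: "real k \<le> \<alpha> * (real B + 1)"
    and a: "real (B choose k) * a ^ k \<le> \<eta>" "0 \<le> \<eta>"
  shows "1 - \<eta> - measure M {x \<in> space M. a < mean Pp (\<lambda>\<pi>. of_bool (T0 x \<le> T x \<pi>))}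
    \<le> (\<integral>(x, ps, \<tau>). reject_prob B \<alpha> (test_rank B (\<lambda>b. if b = 0 then T0 x else T x (ps b)) \<tau>)
      \<partial>(M \<Otimes>\<^sub>M (PiM {1..B} (\<lambda>_. uniform_count_measure Pp) \<Otimes>\<^sub>M uniform_count_measure Tau)))"
proof -
  let ?U = "uniform_count_measure Pp" and ?V = "uniform_count_measure Tau"
  let ?A = "PiM {1..B} (\<lambda>_. ?U)"
  let ?N = "?A \<Otimes>\<^sub>M ?V"
  interpret M: prob_space M by (rule M)
  interpret U: prob_space ?U using Pp by (rule prob_space_uniform_count_measure)
  interpret V: prob_space ?V using Tau by (rule prob_space_uniform_count_measure)
  interpret A: prob_space ?A by (intro prob_space_PiM U.prob_space_axioms)
  interpret AV: pair_prob_space ?A ?V ..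
  interpret MN: pair_prob_space M ?N ..
  define p where "p x = mean Pp (\<lambda>\<pi>. of_bool (T0 x \<le> T x \<pi>))" for x
  define h where "h x z = reject_prob B \<alpha> (test_rank B (\<lambda>b. if b = 0 then T0 x else T x (fst z b)) (snd z))" for x z
  have pm [measurable]: "p \<in> borel_measurable M"
  proof -
    have "(\<lambda>x. of_bool (T0 x \<le> T x \<pi>) :: real) \<in> borel_measurable M" if "\<pi> \<in> Pp" for \<pi>
      using Tm[OF that] by measurable
    then show ?thesis unfolding p_def mean_def
      by (intro borel_measurable_divide borel_measurable_sum borel_measurable_const)
  qed
  have pnn: "0 \<le> p x" for x unfolding p_def by (intro mean_nonneg) auto
  have perm_m: "(\<lambda>\<omega>. fst (snd \<omega>) b) \<in> M \<Otimes>\<^sub>M ?N \<rightarrow>\<^sub>M count_space Pp" if "b \<in> {1..B}" for b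
  proof -
    have "(\<lambda>\<omega>. fst (snd \<omega>) b) \<in> M \<Otimes>\<^sub>M ?N \<rightarrow>\<^sub>M ?U"
      by (rule measurable_compose[OF measurable_compose[OF measurable_snd measurable_fst]
            measurable_component_singleton[OF that]])
    then show ?thesis by (simp add: measurable_def sets_uniform_count_measure space_uniform_count_measure)
  qed
  have Tb: "(\<lambda>\<omega>. T (fst \<omega>) (fst (snd \<omega>) b)) \<in> borel_measurable (M \<Otimes>\<^sub>M ?N)" if "b \<in> {1..B}" for b
    by (rule measurable_compose_countable'[OF _ perm_m[OF that] countable_finite[OF Pp(1)]])
      (rule measurable_compose[OF measurable_fst Tm])
  have tau_m: "(\<lambda>\<omega>. snd (snd \<omega>) b < snd (snd \<omega>) 0) \<in> M \<Otimes>\<^sub>M ?N \<rightarrow>\<^sub>M count_space UNIV" for b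
  proof -
    have "(\<lambda>\<tau>. \<tau> b < \<tau> 0) \<in> ?V \<rightarrow>\<^sub>M count_space UNIV"
      by (auto simp: measurable_def sets_uniform_count_measure space_uniform_count_measure)
    then show ?thesis by (rule measurable_compose[OF measurable_compose[OF measurable_snd measurable_snd]])
  qed
  have rank: "real (test_rank B t \<tau>)
      = 1 + (\<Sum>b\<in>{1..B}. of_bool (t b < t 0 \<or> (t b = t 0 \<and> \<tau> b < \<tau> 0)))" for t \<tau>
  proof -
    let ?P = "\<lambda>b. t b < t 0 \<or> (t b = t 0 \<and> \<tau> b < \<tau> 0)"
    have "{b \<in> {1..B}. ?P b} = {1..B} \<inter> {b. ?P b}" by auto
    moreover have "(\<Sum>b\<in>{1..B}. of_bool (?P b) :: real) = real (card ({1..B} \<inter> {b. ?P b}))"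
      by (rule sum_of_bool_eq) simp_all
    ultimately show ?thesis unfolding test_rank_def by (simp only: of_nat_add of_nat_1)
  qed
  have hm: "(\<lambda>(x, z). h x z) \<in> borel_measurable (M \<Otimes>\<^sub>M ?N)"
  proof -
    have "(\<lambda>\<omega>. of_bool (T (fst \<omega>) (fst (snd \<omega>) b) < T0 (fst \<omega>) \<or>
        (T (fst \<omega>) (fst (snd \<omega>) b) = T0 (fst \<omega>) \<and> snd (snd \<omega>) b < snd (snd \<omega>) 0)) :: real)
      \<in> borel_measurable (M \<Otimes>\<^sub>M ?N)" if "b \<in> {1..B}" for b
    proof -
      note [measurable] = Tb[OF that] tau_m[of b]
      show ?thesis by measurable
    qed
    then have "(\<lambda>\<omega>. \<Sum>b\<in>{1..B}. of_bool (T (fst \<omega>) (fst (snd \<omega>) b) < T0 (fst \<omega>) \<or>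
        (T (fst \<omega>) (fst (snd \<omega>) b) = T0 (fst \<omega>) \<and> snd (snd \<omega>) b < snd (snd \<omega>) 0)) :: real)
      \<in> borel_measurable (M \<Otimes>\<^sub>M ?N)" by (rule borel_measurable_sum)
    then have "(\<lambda>\<omega>. min 1 (max 0 (1 + (\<Sum>b\<in>{1..B}. of_bool (T (fst \<omega>) (fst (snd \<omega>) b) < T0 (fst \<omega>) \<or>
        (T (fst \<omega>) (fst (snd \<omega>) b) = T0 (fst \<omega>) \<and> snd (snd \<omega>) b < snd (snd \<omega>) 0))) - (1 - \<alpha>) * (real B + 1))))
      \<in> borel_measurable (M \<Otimes>\<^sub>M ?N)" (is "?f \<in> _")
      by (intro borel_measurable_min borel_measurable_max borel_measurable_const borel_measurable_diff borel_measurable_add)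
    moreover have "h x z = ?f (x, z)" for x z
    proof -
      have "(\<Sum>b\<in>{1..B}. of_bool ((if b = 0 then T0 x else T x (fst z b)) < T0 x
          \<or> ((if b = 0 then T0 x else T x (fst z b)) = T0 x \<and> snd z b < snd z 0)) :: real)
        = (\<Sum>b\<in>{1..B}. of_bool (T x (fst z b) < T0 x \<or> (T x (fst z b) = T0 x \<and> snd z b < snd z 0)))"
        by (intro sum.cong refl) auto
      then show ?thesis unfolding h_def reject_prob_def rank by simp
    qed
    then have "(\<lambda>(x, z). h x z) = ?f" by (intro ext) (simp add: case_prod_unfold)
    ultimately show ?thesis by simp
  qed
  have hint: "integrable (M \<Otimes>\<^sub>M ?N) (\<lambda>(x, z). h x z)"
    by (rule MN.integrable_const_bound[OF _ hm, of 1]) (auto simp: h_def reject_prob_bounds)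
  have inner: "1 - \<eta> \<le> (\<integral>z. h x z \<partial>?N)" if x: "x \<in> space M" "p x \<le> a" for x
  proof -
    define F where "F ps = (\<Sum>J | J \<subseteq> {1..B} \<and> card J = k. \<Prod>b\<in>J. of_bool (T0 x \<le> T x (ps b)) :: real)" for ps
    have cm: "(\<lambda>ps. of_bool (T0 x \<le> T x (ps b)) :: real) \<in> borel_measurable ?A" if "b \<in> {1..B}" for b
    proof (rule measurable_compose[OF measurable_component_singleton[OF that]])
      show "(\<lambda>\<pi>. of_bool (T0 x \<le> T x \<pi>) :: real) \<in> borel_measurable ?U"
        by (simp add: measurable_def sets_uniform_count_measure space_uniform_count_measure)
    qed
    have Jint: "integrable ?A (\<lambda>ps. \<Prod>b\<in>J. of_bool (T0 x \<le> T x (ps b)) :: real)" if "J \<subseteq> {1..B}" for J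
    proof (rule A.integrable_const_bound[of _ 1])
      show "AE ps in ?A. norm (\<Prod>b\<in>J. of_bool (T0 x \<le> T x (ps b)) :: real) \<le> 1"
      proof (rule AE_I2)
        fix ps
        have "0 \<le> (\<Prod>b\<in>J. of_bool (T0 x \<le> T x (ps b)) :: real)" by (intro prod_nonneg) auto
        moreover have "(\<Prod>b\<in>J. of_bool (T0 x \<le> T x (ps b)) :: real) \<le> 1" by (intro prod_le_1) auto
        ultimately show "norm (\<Prod>b\<in>J. of_bool (T0 x \<le> T x (ps b)) :: real) \<le> 1" by simp
      qed
      show "(\<lambda>ps. \<Prod>b\<in>J. of_bool (T0 x \<le> T x (ps b)) :: real) \<in> borel_measurable ?A"
        using that by (intro borel_measurable_prod cm) auto
    qed
    have Fint: "integrable ?A F" unfolding F_def by (intro Bochner_Integration.integrable_sum Jint) auto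
    have "(\<integral>ps. F ps \<partial>?A) = (\<Sum>J | J \<subseteq> {1..B} \<and> card J = k. p x ^ k)"
    proof -
      have "(\<integral>ps. F ps \<partial>?A) = (\<Sum>J | J \<subseteq> {1..B} \<and> card J = k. \<integral>ps. (\<Prod>b\<in>J. of_bool (T0 x \<le> T x (ps b))) \<partial>?A)"
        unfolding F_def using Jint by (intro Bochner_Integration.integral_sum) auto
      also have "\<dots> = (\<Sum>J | J \<subseteq> {1..B} \<and> card J = k. p x ^ k)"
      proof (intro sum.cong refl)
        fix J assume "J \<in> {J. J \<subseteq> {1..B} \<and> card J = k}"
        then show "(\<integral>ps. (\<Prod>b\<in>J. of_bool (T0 x \<le> T x (ps b))) \<partial>?A) = p x ^ k"
          using perm_product_integral[OF Pp, of J B "\<lambda>\<pi>. T0 x \<le> T x \<pi>"] by (simp add: p_def)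
      qed
      finally show ?thesis .
    qed
    also have "\<dots> = real (B choose k) * p x ^ k" by (simp add: n_subsets)
    also have "\<dots> \<le> real (B choose k) * a ^ k" using x pnn by (intro mult_left_mono power_mono) auto
    also have "\<dots> \<le> \<eta>" by (rule a)
    finally have Fle: "(\<integral>ps. F ps \<partial>?A) \<le> \<eta>" .
    have dF: "integrable ?N (\<lambda>z. F (fst z))" "(\<integral>z. F (fst z) \<partial>?N) = (\<integral>ps. F ps \<partial>?A)"
    proof -
      have d: "distr ?N ?A fst = ?A" by (rule V.distr_pair_fst)
      have Fm: "F \<in> borel_measurable ?A" using Fint by auto
      show "integrable ?N (\<lambda>z. F (fst z))"
        using integrable_distr[OF measurable_fst, of ?A ?V F] Fint unfolding d by simp
      show "(\<integral>z. F (fst z) \<partial>?N) = (\<integral>ps. F ps \<partial>?A)"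
        using integral_distr[OF measurable_fst Fm, of ?V] unfolding d by simp
    qed
    have hx: "integrable ?N (h x)"
    proof (rule AV.integrable_const_bound[of _ 1])
      show "h x \<in> borel_measurable ?N" using measurable_compose[OF measurable_Pair1'[OF x(1)] hm] by simp
    qed (auto simp: h_def reject_prob_bounds)
    have "1 - \<eta> \<le> (\<integral>z. 1 - F (fst z) \<partial>?N)" using Fle dF prob_space.prob_space[OF AV.prob_space_axioms]
        Bochner_Integration.integral_diff[OF AV.integrable_const[of "1::real"] dF(1)] by simp
    also have "\<dots> \<le> (\<integral>z. h x z \<partial>?N)"
    proof (rule integral_mono)
      show "1 - F (fst z) \<le> h x z" for z
      proof -
        have "(\<Sum>J | J \<subseteq> {1..B} \<and> card J = k. \<Prod>b\<in>J. of_bool ((if (0::nat) = 0 then T0 x else T x (fst z 0)) \<le> (if b = 0 then T0 x else T x (fst z b))))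
          = F (fst z)"
          unfolding F_def by (intro sum.cong prod.cong refl) auto
        then show ?thesis
          using reject_prob_ge[OF k, of "\<lambda>b. if b = 0 then T0 x else T x (fst z b)" "snd z"]
          unfolding h_def by simp
      qed
    qed (use Bochner_Integration.integrable_diff[OF AV.integrable_const[of "1::real"] dF(1)] hx in auto)
    finally show ?thesis .
  qed
  define G where "G = {x \<in> space M. p x \<le> a}"
  have Gm [measurable]: "G \<in> sets M" unfolding G_def by measurable
  have bad: "measure M {x \<in> space M. a < p x} = 1 - measure M G"
  proof -
    have "{x \<in> space M. a < p x} = space M - G" by (auto simp: G_def)
    then show ?thesis using M.prob_compl[OF Gm] by simp
  qed
  have "1 - \<eta> - (1 - measure M G) \<le> (1 - \<eta>) * measure M G"
    using a(2) M.prob_le_1[of G] by (simp add: algebra_simps mult_left_le)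
  also have "\<dots> = (\<integral>x. (1 - \<eta>) * indicator G x \<partial>M)" by simp
  also have "\<dots> \<le> (\<integral>x. (\<integral>z. h x z \<partial>?N) \<partial>M)"
  proof (rule integral_mono)
    show "integrable M (\<lambda>x. \<integral>z. h x z \<partial>?N)" by (rule MN.integrable_fst[OF hint])
    show "(1 - \<eta>) * indicator G x \<le> (\<integral>z. h x z \<partial>?N)" if "x \<in> space M" for x
    proof (cases "x \<in> G")
      case True
      then show ?thesis using inner[of x] by (simp add: G_def)
    next
      case False
      then show ?thesis by (auto simp: h_def reject_prob_bounds intro!: integral_nonneg_AE)
    qed
  next
    have "integrable M (indicator G :: _ \<Rightarrow> real)"
      using Gm by (intro integrable_real_indicator) (simp_all add: M.emeasure_eq_measure)
    then show "integrable M (\<lambda>x. (1 - \<eta>) * indicator G x)" by simp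
  qed
  also have "\<dots> = (\<integral>(x, z). h x z \<partial>(M \<Otimes>\<^sub>M ?N))" by (rule MN.integral_fst[OF hint])
  also have "\<dots> = (\<integral>(x, ps, \<tau>). reject_prob B \<alpha> (test_rank B (\<lambda>b. if b = 0 then T0 x else T x (ps b)) \<tau>) \<partial>(M \<Otimes>\<^sub>M ?N))"
    by (simp only: h_def case_prod_beta')
  finally show ?thesis unfolding bad[symmetric] p_def .
qed

section \<open>Bin splits and tail inequalities\<close>

lemma sum_over_bins:
  fixes f :: "nat \<Rightarrow> real"
  assumes "0 < m"
  shows "(\<Sum>i\<in>{..<a * m}. f (i div m)) = real m * (\<Sum>b<a. f b)"
proof (induction a)
  case (Suc a)
  have "(\<Sum>i\<in>{..<Suc a * m}. f (i div m)) = (\<Sum>i\<in>{..<a * m + m}. f (i div m))"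
    by (simp add: add.commute)
  also have "\<dots> = (\<Sum>i<a * m. f (i div m)) + (\<Sum>j<m. f ((a * m + j) div m))"
    by (rule sum_lessThan_add)
  also have "(\<Sum>j<m. f ((a * m + j) div m)) = (\<Sum>j<m. f a)"
    using assms by (intro sum.cong refl) simp
  finally show ?case using Suc by (simp add: algebra_simps)
qed simp

text \<open>The indices of the points that the permutation \<open>\<pi>\<close> of the bins places in the
  first sample.\<close>

definition bin_split :: "nat \<Rightarrow> nat \<Rightarrow> (nat \<Rightarrow> nat) \<Rightarrow> nat set" where
  "bin_split n1 m \<pi> = bin_index m \<pi> ` {..<n1}"

lemma bin_index_less_iff: "0 < m \<Longrightarrow> bin_index m \<pi> k < a * m \<longleftrightarrow> \<pi> (k div m) < a"
proof
  assume m: "0 < m"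
  show "bin_index m \<pi> k < a * m \<Longrightarrow> \<pi> (k div m) < a"
    unfolding bin_index_def by (rule ccontr) (metis add_lessD1 mult_le_mono1 not_less)
  assume "\<pi> (k div m) < a"
  then have "(\<pi> (k div m) + 1) * m \<le> a * m" by (intro mult_le_mono1) simp
  moreover have "k mod m < m" using m by simp
  ultimately show "bin_index m \<pi> k < a * m" unfolding bin_index_def by simp
qed

lemma bin_index_bij:
  assumes m: "0 < m" and \<pi>: "\<pi> permutes {..<s}"
  shows "bij_betw (bin_index m \<pi>) {..<s * m} {..<s * m}"
proof -
  have inj: "inj_on (bin_index m \<pi>) {..<s * m}"
  proof (rule inj_onI)
    fix k l assume eq: "bin_index m \<pi> k = bin_index m \<pi> l"
    have dm: "bin_index m \<pi> j div m = \<pi> (j div m)" "bin_index m \<pi> j mod m = j mod m" for j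
      using m by (simp_all add: bin_index_def)
    have "\<pi> (k div m) = \<pi> (l div m)" "k mod m = l mod m" using dm[of k] dm[of l] eq by simp_all
    then have "k div m = l div m" using permutes_inj[OF \<pi>] by (simp add: inj_eq)
    then show "k = l" using \<open>k mod m = l mod m\<close> by (metis div_mult_mod_eq)
  qed
  have "bin_index m \<pi> ` {..<s * m} \<subseteq> {..<s * m}"
  proof (intro image_subsetI)
    fix k assume "k \<in> {..<s * m}"
    then have "k div m < s" by (simp add: less_mult_imp_div_less)
    then have "\<pi> (k div m) < s" using permutes_in_image[OF \<pi>, of "k div m"] by simp
    then show "bin_index m \<pi> k \<in> {..<s * m}" using m by (simp add: bin_index_less_iff)
  qed
  with inj show ?thesis unfolding bij_betw_def by (simp add: endo_inj_surj)
qed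

lemma image_split_cards:
  fixes \<sigma> :: "nat \<Rightarrow> nat"
  assumes bij: "bij_betw \<sigma> {..<n} {..<n}" and n1: "n1 \<le> n"
  shows "\<sigma> ` {..<n1} \<subseteq> {..<n}" "card (\<sigma> ` {..<n1}) = n1"
    and "real (card (\<sigma> ` {..<n1} \<inter> {..<n1})) = (\<Sum>i<n1. of_bool (\<sigma> i < n1))"
    and "real (card ({..<n1} - \<sigma> ` {..<n1})) = (\<Sum>j\<in>{n1..<n}. of_bool (\<sigma> j < n1))"
proof -
  have inj: "inj_on \<sigma> {..<n}" and im: "\<sigma> ` {..<n} = {..<n}"
    using bij unfolding bij_betw_def by blast+
  have sub: "{..<n1} \<subseteq> {..<n}" using n1 by auto
  show "\<sigma> ` {..<n1} \<subseteq> {..<n}" using image_mono[OF sub, of \<sigma>] unfolding im .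
  show "card (\<sigma> ` {..<n1}) = n1" unfolding card_image[OF inj_on_subset[OF inj sub]] by simp
  have e1: "\<sigma> ` {..<n1} \<inter> {..<n1} = \<sigma> ` ({..<n1} \<inter> {i. \<sigma> i < n1})"
    by (intro equalityI subsetI) auto
  have "inj_on \<sigma> ({..<n1} \<inter> {i. \<sigma> i < n1})"
    by (rule inj_on_subset[OF inj order.trans[OF Int_lower1 sub]])
  then have "card (\<sigma> ` {..<n1} \<inter> {..<n1}) = card ({..<n1} \<inter> {i. \<sigma> i < n1})"
    unfolding e1 by (rule card_image)
  then show "real (card (\<sigma> ` {..<n1} \<inter> {..<n1})) = (\<Sum>i<n1. of_bool (\<sigma> i < n1))"
    by (simp only: sum_of_bool_eq finite_lessThan)
  have e2: "{..<n1} - \<sigma> ` {..<n1} = \<sigma> ` ({n1..<n} \<inter> {j. \<sigma> j < n1})"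
  proof (rule set_eqI)
    fix k
    show "k \<in> {..<n1} - \<sigma> ` {..<n1} \<longleftrightarrow> k \<in> \<sigma> ` ({n1..<n} \<inter> {j. \<sigma> j < n1})"
    proof
      assume k: "k \<in> {..<n1} - \<sigma> ` {..<n1}"
      then have "k < n1" by simp
      then have "k \<in> \<sigma> ` {..<n}" unfolding im using n1 by simp
      then obtain j where j: "j < n" "k = \<sigma> j" by blast
      have "n1 \<le> j"
      proof (rule ccontr)
        assume "\<not> n1 \<le> j"
        then have "k \<in> \<sigma> ` {..<n1}" using j(2) by (intro image_eqI[of k \<sigma> j]) simp_all
        then show False using k by blast
      qed
      moreover have "\<sigma> j < n1" using k unfolding j(2) by blast
      ultimately have "j \<in> {n1..<n} \<inter> {j. \<sigma> j < n1}" using j(1) by simp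
      then show "k \<in> \<sigma> ` ({n1..<n} \<inter> {j. \<sigma> j < n1})" unfolding j(2) by (rule imageI)
    next
      assume "k \<in> \<sigma> ` ({n1..<n} \<inter> {j. \<sigma> j < n1})"
      then obtain j where j: "j \<in> {n1..<n} \<inter> {j. \<sigma> j < n1}" "k = \<sigma> j" by (rule imageE)
      have "k \<notin> \<sigma> ` {..<n1}"
      proof
        assume "k \<in> \<sigma> ` {..<n1}"
        then obtain i where i: "i \<in> {..<n1}" "k = \<sigma> i" by blast
        have "j = i" using inj_onD[OF inj, of j i] i j n1 by simp
        then show False using i(1) j(1) by simp
      qed
      moreover have "k < n1" using j by simp
      ultimately show "k \<in> {..<n1} - \<sigma> ` {..<n1}" by simp
    qed
  qed
  have "inj_on \<sigma> ({n1..<n} \<inter> {j. \<sigma> j < n1})"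
    by (rule inj_on_subset[OF inj]) (intro subsetI, simp)
  then have "card ({..<n1} - \<sigma> ` {..<n1}) = card ({n1..<n} \<inter> {j. \<sigma> j < n1})"
    unfolding e2 by (rule card_image)
  then show "real (card ({..<n1} - \<sigma> ` {..<n1})) = (\<Sum>j\<in>{n1..<n}. of_bool (\<sigma> j < n1))"
    by (simp only: sum_of_bool_eq finite_atLeastLessThan)
qed

lemma sum_lessThan_split:
  fixes f :: "nat \<Rightarrow> real"
  assumes "a \<le> n"
  shows "(\<Sum>i<n. f i) = (\<Sum>i<a. f i) + (\<Sum>i\<in>{a..<n}. f i)"
proof (rule sum_disjoint_parts)
  show "{..<n} = {..<a} \<union> {a..<n}" using assms by (simp only: ivl_disj_un_one)
  show "{..<a} \<inter> {a..<n} = {}" by (simp only: ivl_disj_int_one)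
qed simp_all

text \<open>A whole bin belongs to one sample, so that counting points is counting bins: the discrepancy of
  the points is that of the permutation, whatever the size of the bins.\<close>

lemma bin_split_properties:
  assumes m: "0 < m" and \<pi>: "\<pi> permutes {..<s1 + s2}" and n: "n1 = s1 * m" "n2 = s2 * m"
  shows "bin_split n1 m \<pi> \<subseteq> {..<n1 + n2}" "card (bin_split n1 m \<pi>) = n1"
    and "frac1 n1 (bin_split n1 m \<pi>) = (\<Sum>i<s1. of_bool (\<pi> i < s1)) / real s1"
    and "frac2 n1 n2 (bin_split n1 m \<pi>) = (\<Sum>j\<in>{s1..<s1 + s2}. of_bool (\<pi> j < s1)) / real s2"
    and "disc n1 n2 (bin_split n1 m \<pi>) = bin_disc s1 s2 \<pi>"
proof -
  define v :: "nat \<Rightarrow> real" where "v a = of_bool (\<pi> a < s1)" for a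
  have nn: "n1 + n2 = (s1 + s2) * m" using n by (simp add: add_mult_distrib)
  have bij: "bij_betw (bin_index m \<pi>) {..<n1 + n2} {..<n1 + n2}"
    unfolding nn by (rule bin_index_bij[OF m \<pi>])
  note cards = image_split_cards[OF bij le_add1, folded bin_split_def]
  show "bin_split n1 m \<pi> \<subseteq> {..<n1 + n2}" "card (bin_split n1 m \<pi>) = n1" by (rule cards)+
  have iff: "of_bool (bin_index m \<pi> i < n1) = v (i div m)" for i
    unfolding n(1) v_def by (simp only: bin_index_less_iff[OF m])
  have s1: "(\<Sum>i<n1. v (i div m)) = real m * (\<Sum>i<s1. v i)"
    unfolding n(1) by (rule sum_over_bins[OF m])
  have s2: "(\<Sum>i<n1 + n2. v (i div m)) = real m * (\<Sum>i<s1 + s2. v i)"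
    unfolding nn by (rule sum_over_bins[OF m])
  have s3: "(\<Sum>i\<in>{n1..<n1 + n2}. v (i div m)) = real m * (\<Sum>i\<in>{s1..<s1 + s2}. v i)"
    using s1 s2 unfolding sum_lessThan_split[of n1 "n1 + n2", OF le_add1]
      sum_lessThan_split[of s1 "s1 + s2", OF le_add1] distrib_left by linarith
  show f1: "frac1 n1 (bin_split n1 m \<pi>) = (\<Sum>i<s1. of_bool (\<pi> i < s1)) / real s1"
    unfolding frac1_def cards(3) iff s1 v_def[symmetric] using m by (simp add: n)
  show f2: "frac2 n1 n2 (bin_split n1 m \<pi>) = (\<Sum>j\<in>{s1..<s1 + s2}. of_bool (\<pi> j < s1)) / real s2"
    unfolding frac2_def cards(4) iff s3 v_def[symmetric] using m by (simp add: n)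
  show "disc n1 n2 (bin_split n1 m \<pi>) = bin_disc s1 s2 \<pi>"
    unfolding disc_def bin_disc_def f1 f2 ..
qed

text \<open>Minkowski's inequality in \<open>L\<^sup>2\<close>, from the weighted arithmetic-geometric mean
  inequality with the optimal weight. The number \<open>e\<close> keeps that weight positive and
  finite.\<close>

lemma (in prob_space) square_sum_expectation_le:
  fixes f h :: "'a \<Rightarrow> real"
  assumes m: "f \<in> borel_measurable M" "h \<in> borel_measurable M"
    and f: "integrable M (\<lambda>x. (f x)^2)" "expectation (\<lambda>x. (f x)^2) \<le> a^2" "0 \<le> a"
    and h: "integrable M (\<lambda>x. (h x)^2)" "expectation (\<lambda>x. (h x)^2) \<le> b^2" "0 \<le> b"
  shows "expectation (\<lambda>x. (f x + h x)^2) \<le> (a + b)^2"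
proof -
  have int: "integrable M (\<lambda>x. (f x + h x)^2)" by (rule integrable_square_add[OF m f(1) h(1)])
  have le: "expectation (\<lambda>x. (f x + h x)^2) \<le> ((a + e) + (b + e))^2" if e: "e > 0" for e
  proof -
    define t where "t = (b + e) / (a + e)"
    have ae: "a + e > 0" "b + e > 0" using f(3) h(3) e by auto
    have t: "t > 0" using ae by (simp add: t_def)
    have "expectation (\<lambda>x. (f x + h x)^2) \<le> expectation (\<lambda>x. (1 + t) * (f x)^2 + (1 + 1 / t) * (h x)^2)"
    proof (intro integral_mono int)
      show "integrable M (\<lambda>x. (1 + t) * (f x)^2 + (1 + 1 / t) * (h x)^2)" using f h by simp
      fix x
      have "(1 + t) * (f x)^2 + (1 + 1 / t) * (h x)^2 - (f x + h x)^2 = (t * f x - h x)^2 / t"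
        using t by (simp add: power2_eq_square field_simps)
      moreover have "0 \<le> (t * f x - h x)^2 / t" using t by simp
      ultimately show "(f x + h x)^2 \<le> (1 + t) * (f x)^2 + (1 + 1 / t) * (h x)^2" by linarith
    qed
    also have "\<dots> = (1 + t) * expectation (\<lambda>x. (f x)^2) + (1 + 1 / t) * expectation (\<lambda>x. (h x)^2)"
      using f h by simp
    also have "\<dots> \<le> (1 + t) * (a + e)^2 + (1 + 1 / t) * (b + e)^2"
    proof (intro add_mono mult_left_mono)
      show "expectation (\<lambda>x. (f x)^2) \<le> (a + e)^2" using f(2,3) e power_mono[of a "a + e" 2] by linarith
      show "expectation (\<lambda>x. (h x)^2) \<le> (b + e)^2" using h(2,3) e power_mono[of b "b + e" 2] by linarith
    qed (use t in auto)
    also have "\<dots> = ((a + e) + (b + e))^2"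
    proof -
      have "(1 + q / p) * p^2 + (1 + 1 / (q / p)) * q^2 = (p + q)^2" if "p > 0" "q > 0" for p q :: real
        using that by (simp add: power2_eq_square field_simps)
      from this[OF ae] show ?thesis unfolding t_def .
    qed
    finally show ?thesis .
  qed
  have "sqrt (expectation (\<lambda>x. (f x + h x)^2)) \<le> a + b"
  proof (rule field_le_epsilon)
    fix e :: real assume "e > 0"
    then have "expectation (\<lambda>x. (f x + h x)^2) \<le> (a + b + e)^2" using le[of "e / 2"] by (simp add: algebra_simps)
    then show "sqrt (expectation (\<lambda>x. (f x + h x)^2)) \<le> a + b + e"
      using f(3) h(3) \<open>e > 0\<close> by (intro real_le_lsqrt) auto
  qed
  then have "sqrt (expectation (\<lambda>x. (f x + h x)^2))^2 \<le> (a + b)^2"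
    by (intro power_mono) auto
  then show ?thesis by simp
qed

text \<open>Cantelli's trick: as \<open>V\<close> is centered, shifting by \<open>u\<close> before applying
  Markov's inequality to the square gains over Chebyshev's inequality. The threshold noise
  \<open>W\<close> enters through its norm and may depend on the data.\<close>

lemma (in prob_space) one_sided_tail:
  fixes V W :: "'a \<Rightarrow> real"
  assumes m [measurable]: "V \<in> borel_measurable M" "W \<in> borel_measurable M"
    and V: "integrable M (\<lambda>x. (V x)^2)" "expectation V = 0" "expectation (\<lambda>x. (V x)^2) \<le> v"
    and W: "integrable M (\<lambda>x. (W x)^2)" "expectation (\<lambda>x. (W x)^2) \<le> w^2" "0 \<le> w"
    and u: "0 < t + u" and \<eta>: "sqrt (v + u^2) + w \<le> sqrt \<eta> * (t + u)" "0 \<le> \<eta>"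
  shows "prob {x \<in> space M. t \<le> V x + W x} \<le> \<eta>"
proof -
  have Vi: "integrable M V" by (rule integrable_of_square[OF m(1) V(1)])
  have Vu: "integrable M (\<lambda>x. (V x + u)^2)"
    using integrable_square_add[OF m(1) borel_measurable_const V(1), of u] by simp
  have "expectation (\<lambda>x. (V x + u)^2) = expectation (\<lambda>x. (V x)^2) + u^2"
  proof -
    have "expectation (\<lambda>x. (V x + u)^2) = expectation (\<lambda>x. (V x)^2 + (2 * u * V x + u^2))"
      by (simp add: power2_eq_square algebra_simps)
    also have "\<dots> = expectation (\<lambda>x. (V x)^2) + u^2" using V Vi by (simp add: prob_space)
    finally show ?thesis .
  qed
  moreover have "0 \<le> expectation (\<lambda>x. (V x)^2)" by simp
  then have "0 \<le> v + u^2" using V(3) by (smt (verit) zero_le_power2)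
  ultimately have Vle: "expectation (\<lambda>x. (V x + u)^2) \<le> (sqrt (v + u^2))^2" using V(3) by simp
  have "expectation (\<lambda>x. ((V x + u) + W x)^2) \<le> (sqrt (v + u^2) + w)^2"
    using Vle W Vu \<open>0 \<le> v + u^2\<close> by (intro square_sum_expectation_le) auto
  also have "\<dots> \<le> (sqrt \<eta> * (t + u))^2"
    using \<eta>(1) W(3) \<open>0 \<le> v + u^2\<close> by (intro power_mono) auto
  also have "\<dots> = \<eta> * (t + u)^2" using \<eta>(2) by (simp add: power_mult_distrib)
  finally have E: "expectation (\<lambda>x. ((V x + u) + W x)^2) \<le> \<eta> * (t + u)^2" .
  have int: "integrable M (\<lambda>x. ((V x + u) + W x)^2)"
    by (rule integrable_square_add[OF _ m(2) Vu W(1)]) measurable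
  have sq: "0 < (t + u)^2" using u by simp
  have "prob {x \<in> space M. t \<le> V x + W x} \<le> prob {x \<in> space M. (t + u)^2 \<le> ((V x + u) + W x)^2}"
    using u by (intro finite_measure_mono) (auto intro!: power_mono)
  also have "\<dots> \<le> expectation (\<lambda>x. ((V x + u) + W x)^2) / (t + u)^2"
    using int sq by (intro integral_Markov_inequality_measure[where A = "space M"]) auto
  also have "\<dots> \<le> \<eta>" using E sq by (simp add: divide_le_eq)
  finally show ?thesis .
qed

text \<open>Markov's inequality for an even moment. At threshold 0 the moment bound forces all values to
  vanish, so that the strict inequality never holds.\<close>

lemma mean_tail_le:
  fixes L :: "'b \<Rightarrow> real"
  assumes A: "finite A" "A \<noteq> {}" and k: "even k" "0 < k" and t: "0 \<le> t" and c: "0 \<le> c"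
    and le: "mean A (\<lambda>a. L a ^ k) \<le> c * t ^ k"
  shows "mean A (\<lambda>a. of_bool (t < L a)) \<le> c"
proof (cases "t = 0")
  case True
  have "mean A (\<lambda>a. L a ^ k) \<le> c * 0 ^ k" using le unfolding True .
  also have "\<dots> = 0" using k by (simp add: zero_power)
  finally have "mean A (\<lambda>a. L a ^ k) \<le> 0" .
  then have "(\<Sum>a\<in>A. L a ^ k) \<le> 0"
    using A unfolding mean_def by (simp add: divide_le_0_iff card_gt_0_iff)
  moreover have "0 \<le> L a ^ k" for a using k by (simp add: zero_le_even_power)
  ultimately have "(\<Sum>a\<in>A. L a ^ k) = 0" by (intro antisym sum_nonneg) auto
  then have "L a = 0" if "a \<in> A" for a
    using that A k by (subst (asm) sum_nonneg_eq_0_iff) (auto simp: zero_le_even_power)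
  then have "mean A (\<lambda>a. of_bool (t < L a)) = mean A (\<lambda>a. 0)" using True by (intro mean_cong) auto
  also have "\<dots> = 0" by (simp add: mean_def)
  finally show ?thesis using c by simp
next
  case False
  then have "t > 0" using t by simp
  have "mean A (\<lambda>a. of_bool (t < L a)) \<le> mean A (\<lambda>a. L a ^ k) / t ^ k"
    using \<open>t > 0\<close> k A by (intro mean_Markov) (auto simp: zero_le_even_power intro!: power_mono)
  also have "\<dots> \<le> c" using le \<open>t > 0\<close> by (simp add: divide_le_eq)
  finally show ?thesis .
qed

lemma sum_sqrt_le:
  assumes "finite I" "\<And>i. i \<in> I \<Longrightarrow> 0 \<le> a i"
  shows "(\<Sum>i\<in>I. sqrt (a i)) \<le> sqrt (real (card I) * (\<Sum>i\<in>I. a i))"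
proof -
  have "(\<Sum>i\<in>I. sqrt (a i) * 1)^2 \<le> (\<Sum>i\<in>I. (sqrt (a i))^2) * (\<Sum>i\<in>I. 1^2)"
    by (rule Cauchy_Schwarz_ineq_sum)
  also have "(\<Sum>i\<in>I. (sqrt (a i))^2) = (\<Sum>i\<in>I. a i)" using assms by (intro sum.cong) auto
  finally show ?thesis by (intro real_le_rsqrt) (simp add: mult.commute)
qed

section \<open>The statistic at random bin splits\<close>

context
  fixes n1 n2 s1 s2 m :: nat
  assumes n: "n1 = s1 * m" "n2 = s2 * m" and large: "2 \<le> n1" "2 \<le> n2" and s: "2 \<le> s1 + s2"
begin

private abbreviation "BinPerms \<equiv> {\<pi>. \<pi> permutes {..<s1 + s2}}"
private abbreviation "S \<equiv> bin_split n1 m"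
private abbreviation "inv_sizes \<equiv> 1 / real s1 + 1 / real s2"
private abbreviation "split_disc \<pi> \<equiv> disc n1 n2 (S \<pi>)"

lemma bins_pos: "0 < m" "0 < s1" "0 < s2"
  using n large by (auto intro: Nat.gr0I)

lemma split_is_split:
  assumes "\<pi> \<in> BinPerms"
  shows "S \<pi> \<subseteq> {..<n1 + n2}" "card (S \<pi>) = n1"
  using bin_split_properties(1,2)[OF bins_pos(1) _ n] assms by auto

lemma disc_bin: "\<pi> \<in> BinPerms \<Longrightarrow> split_disc \<pi> = bin_disc s1 s2 \<pi>"
  using bin_split_properties(5)[OF bins_pos(1) _ n] by auto

lemma mean_frac1: "mean BinPerms (\<lambda>\<pi>. frac1 n1 (S \<pi>)) = real s1 / (real s1 + real s2)"
proof -
  have "mean BinPerms (\<lambda>\<pi>. frac1 n1 (S \<pi>))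
      = mean BinPerms (\<lambda>\<pi>. real s1 / (real s1 + real s2) + real s2 / (real s1 + real s2) * bin_disc s1 s2 \<pi>)"
  proof (intro mean_cong)
    fix \<pi> assume \<pi>: "\<pi> \<in> BinPerms"
    then have "frac1 n1 (S \<pi>) = (\<Sum>i<s1. of_bool (\<pi> i < s1)) / real s1"
      by (intro bin_split_properties(3)[OF bins_pos(1) _ n]) auto
    also have "\<dots> = (real s1 + real s2 * bin_disc s1 s2 \<pi>) / (real s1 + real s2)"
      by (rule bin_disc_fractions(1)[OF bins_pos(2,3) \<pi>])
    finally show "frac1 n1 (S \<pi>) = real s1 / (real s1 + real s2) + real s2 / (real s1 + real s2) * bin_disc s1 s2 \<pi>"
      by (simp add: add_divide_distrib)
  qed
  also have "\<dots> = real s1 / (real s1 + real s2)"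
    unfolding mean_add mean_cmult bin_disc_mean[OF bins_pos(2,3)]
    using finite_perms[OF bins_pos(2,3)] by (simp add: mean_const)
  finally show ?thesis .
qed

lemma mean_frac2: "mean BinPerms (\<lambda>\<pi>. frac2 n1 n2 (S \<pi>)) = real s1 / (real s1 + real s2)"
proof -
  have "mean BinPerms (\<lambda>\<pi>. frac2 n1 n2 (S \<pi>))
      = mean BinPerms (\<lambda>\<pi>. frac1 n1 (S \<pi>) - bin_disc s1 s2 \<pi>)"
  proof (intro mean_cong)
    fix \<pi> assume \<pi>: "\<pi> \<in> BinPerms"
    show "frac2 n1 n2 (S \<pi>) = frac1 n1 (S \<pi>) - bin_disc s1 s2 \<pi>"
      using disc_bin[OF \<pi>] by (simp add: disc_def)
  qed
  also have "\<dots> = real s1 / (real s1 + real s2)"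
    unfolding mean_diff bin_disc_mean[OF bins_pos(2,3)] mean_frac1 by simp
  finally show ?thesis .
qed

lemma mean_disc2: "mean BinPerms (\<lambda>\<pi>. split_disc \<pi> ^ 2) = 1 / (real s1 + real s2 - 1)"
  unfolding bin_disc_mean_square[OF bins_pos(2,3) s, symmetric] by (intro mean_cong) (simp add: disc_bin)

lemma mean_disc4: "mean BinPerms (\<lambda>\<pi>. split_disc \<pi> ^ 4) \<le> 3 / 2 * inv_sizes / (real s1 + real s2 - 1)"
proof -
  have "mean BinPerms (\<lambda>\<pi>. split_disc \<pi> ^ 4) = mean BinPerms (\<lambda>\<pi>. bin_disc s1 s2 \<pi> ^ 4)"
    by (intro mean_cong) (simp add: disc_bin)
  then show ?thesis using bin_disc_mean_4[OF bins_pos(2,3) s] by simp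
qed

lemma mean_disc6: "mean BinPerms (\<lambda>\<pi>. split_disc \<pi> ^ 6) \<le> 15 / 4 * inv_sizes^2 / (real s1 + real s2 - 1)"
proof -
  have "mean BinPerms (\<lambda>\<pi>. split_disc \<pi> ^ 6) = mean BinPerms (\<lambda>\<pi>. bin_disc s1 s2 \<pi> ^ 6)"
    by (intro mean_cong) (simp add: disc_bin)
  then show ?thesis using bin_disc_mean_6[OF bins_pos(2,3) s] by simp
qed

lemma mean_label_weight2:
  "mean BinPerms (\<lambda>\<pi>. \<Sum>p\<in>{..<n1 + n2}. (label_weight n1 n2 (S \<pi>) p)^2)
    \<le> (1 / real n1 + 1 / real n2) / (real s1 + real s2 - 1)
      + real s1 / (real s1 + real s2) * (1 / (real n1 * (real n1 - 1)^2) + 1 / (real n2 * (real n2 - 1)^2))"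
proof -
  define a b c where "a = 1 / real n1 + 1 / real n2" and "b = 1 / (real n1 * (real n1 - 1)^2)"
    and "c = 1 / (real n2 * (real n2 - 1)^2)"
  have "mean BinPerms (\<lambda>\<pi>. \<Sum>p\<in>{..<n1 + n2}. (label_weight n1 n2 (S \<pi>) p)^2)
     \<le> mean BinPerms (\<lambda>\<pi>. a * split_disc \<pi> ^ 2 + (b * frac1 n1 (S \<pi>) + c * frac2 n1 n2 (S \<pi>)))"
  proof (rule mean_mono)
    fix \<pi> assume "\<pi> \<in> BinPerms"
    from label_weight_power2_sum[OF large split_is_split[OF this]]
    show "(\<Sum>p\<in>{..<n1 + n2}. (label_weight n1 n2 (S \<pi>) p)^2)
      \<le> a * split_disc \<pi> ^ 2 + (b * frac1 n1 (S \<pi>) + c * frac2 n1 n2 (S \<pi>))"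
      unfolding a_def b_def c_def by (simp add: mult.commute)
  qed
  also have "\<dots> = a * (1 / (real s1 + real s2 - 1)) + (b * (real s1 / (real s1 + real s2)) + c * (real s1 / (real s1 + real s2)))"
    unfolding mean_add mean_cmult mean_disc2 mean_frac1 mean_frac2 ..
  also have "\<dots> = a / (real s1 + real s2 - 1) + real s1 / (real s1 + real s2) * (b + c)"
  proof -
    have "a * (1 / h) + (b * k + c * k) = a / h + k * (b + c)" for h k by (simp add: algebra_simps)
    then show ?thesis .
  qed
  finally show ?thesis unfolding a_def b_def c_def .
qed

lemma mean_label_weight4:
  "mean BinPerms (\<lambda>\<pi>. \<Sum>p\<in>{..<n1 + n2}. (label_weight n1 n2 (S \<pi>) p)^4)
    \<le> 64 / 27 * (3 / 2 * inv_sizes / (real s1 + real s2 - 1)) * (1 / real n1 ^ 3 + 1 / real n2 ^ 3)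
      + 64 * (real s1 / (real s1 + real s2)) * (1 / (real n1 ^ 3 * (real n1 - 1)^4) + 1 / (real n2 ^ 3 * (real n2 - 1)^4))"
proof -
  define a b c where "a = 64 / 27 * (1 / real n1 ^ 3 + 1 / real n2 ^ 3)" and "b = 64 / (real n1 ^ 3 * (real n1 - 1)^4)"
    and "c = 64 / (real n2 ^ 3 * (real n2 - 1)^4)"
  have "mean BinPerms (\<lambda>\<pi>. \<Sum>p\<in>{..<n1 + n2}. (label_weight n1 n2 (S \<pi>) p)^4)
     \<le> mean BinPerms (\<lambda>\<pi>. a * split_disc \<pi> ^ 4 + (b * frac1 n1 (S \<pi>) + c * frac2 n1 n2 (S \<pi>)))"
  proof (rule mean_mono)
    fix \<pi> assume "\<pi> \<in> BinPerms"
    from label_weight_power4_sum[OF large split_is_split[OF this]]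
    show "(\<Sum>p\<in>{..<n1 + n2}. (label_weight n1 n2 (S \<pi>) p)^4)
      \<le> a * split_disc \<pi> ^ 4 + (b * frac1 n1 (S \<pi>) + c * frac2 n1 n2 (S \<pi>))"
      unfolding a_def b_def c_def by (simp add: add_divide_distrib algebra_simps)
  qed
  also have "\<dots> \<le> a * (3 / 2 * inv_sizes / (real s1 + real s2 - 1)) + (b * (real s1 / (real s1 + real s2)) + c * (real s1 / (real s1 + real s2)))"
    unfolding mean_add mean_cmult mean_frac1 mean_frac2
    by (intro add_right_mono mult_left_mono mean_disc4) (auto simp: a_def)
  also have "\<dots> = 64 / 27 * (3 / 2 * inv_sizes / (real s1 + real s2 - 1)) * (1 / real n1 ^ 3 + 1 / real n2 ^ 3)
      + 64 * (real s1 / (real s1 + real s2)) * (1 / (real n1 ^ 3 * (real n1 - 1)^4) + 1 / (real n2 ^ 3 * (real n2 - 1)^4))"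
  proof -
    have "64 / 27 * h * l + (64 / u * k + 64 / v * k) = 64 / 27 * l * h + 64 * k * (1 / u + 1 / v)"
      for h l u v k :: real by (simp add: algebra_simps)
    then show ?thesis unfolding a_def b_def c_def .
  qed
  finally show ?thesis .
qed

text \<open>Cauchy-Schwarz over the points, as the moments are known for the sum over all points only.\<close>

lemma sum_L4_label_weight:
  "(\<Sum>p\<in>{..<n1 + n2}. sqrt (mean BinPerms (\<lambda>\<pi>. (label_weight n1 n2 (S \<pi>) p)^4)))
    \<le> sqrt ((real n1 + real n2) * mean BinPerms (\<lambda>\<pi>. \<Sum>p\<in>{..<n1 + n2}. (label_weight n1 n2 (S \<pi>) p)^4))"
  unfolding mean_sum using sum_sqrt_le[of "{..<n1 + n2}" "\<lambda>p. mean BinPerms (\<lambda>\<pi>. (label_weight n1 n2 (S \<pi>) p)^4)"]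
  by (simp add: mean_nonneg)

end

lemma label_weight_identity:
  assumes "2 \<le> n1" "2 \<le> n2"
  shows "p < n1 \<Longrightarrow> label_weight n1 n2 {..<n1} p = 1 / real n1"
    and "n1 \<le> p \<Longrightarrow> p < n1 + n2 \<Longrightarrow> label_weight n1 n2 {..<n1} p = - 1 / real n2"
proof -
  have f: "frac1 n1 {..<n1} = 1" "frac2 n1 n2 {..<n1} = 0" using assms by (auto simp: frac1_def frac2_def)
  have d: "disc n1 n2 {..<n1} = 1" by (simp add: disc_def f)
  show "p < n1 \<Longrightarrow> label_weight n1 n2 {..<n1} p = 1 / real n1"
    using label_weight_in[OF assms, of "{..<n1}" p] by (simp add: f d)
  show "n1 \<le> p \<Longrightarrow> p < n1 + n2 \<Longrightarrow> label_weight n1 n2 {..<n1} p = - 1 / real n2"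
    using label_weight_out[OF assms, of "{..<n1}" p] by (simp add: f d)
qed

context two_sample_kernel
begin

lemma U_ho_decomposition:
  assumes x: "x \<in> space (two_sample P Q n1 n2)" and n: "2 \<le> n1" "2 \<le> n2"
  shows "U_ho n1 n2 g x (\<lambda>j. x (n1 + j)) = effect + lin n1 n2 {..<n1} x + quad n1 n2 {..<n1} x"
proof -
  have "U_ho n1 n2 g x (\<lambda>j. x (n1 + j)) = split_stat g n1 n2 {..<n1} x"
    using point_in_space[OF x] by (intro U_ho_eq_split_stat n g_sym) auto
  also have "\<dots> = effect * (\<Sum>p<n1. label_weight n1 n2 {..<n1} p) + lin n1 n2 {..<n1} x + quad n1 n2 {..<n1} x"
    by (rule split_stat_decomposition[OF n]) auto
  also have "(\<Sum>p<n1. label_weight n1 n2 {..<n1} p) = (\<Sum>p<n1. 1 / real n1)"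
    by (intro sum.cong refl label_weight_identity(1)[OF n]) auto
  also have "\<dots> = 1" using n by simp
  finally show ?thesis by simp
qed

lemma expected_U_eq_effect:
  assumes n: "2 \<le> n1" "2 \<le> n2"
  shows "expected_U P Q g n1 n2 = effect"
proof -
  interpret PM: prob_space "two_sample P Q n1 n2" by (rule two_sample_prob)
  have "expected_U P Q g n1 n2
      = (\<integral>x. effect + lin n1 n2 {..<n1} x + quad n1 n2 {..<n1} x \<partial>two_sample P Q n1 n2)"
    unfolding expected_U_def by (intro Bochner_Integration.integral_cong refl U_ho_decomposition n)
  also have "\<dots> = effect"
    using lin_integral[of n1 n2 "{..<n1}"] quad_integral[of n1 n2 "{..<n1}"] by (simp add: PM.prob_space)
  finally show ?thesis .
qed

text \<open>Permuting the bins of the data is the same as moving the split.\<close>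

lemma permuted_U_eq:
  assumes x: "x \<in> space (two_sample P Q n1 n2)" and n: "2 \<le> n1" "2 \<le> n2"
    and bins: "n1 = s1 * m" "n2 = s2 * m" and \<pi>: "\<pi> permutes {..<s1 + s2}"
  shows "permuted_stat (U_ho n1 n2 g) n1 m x \<pi> = split_stat g n1 n2 (bin_split n1 m \<pi>) x"
proof -
  have m: "0 < m" using bins n by (auto intro: Nat.gr0I)
  have nn: "n1 + n2 = (s1 + s2) * m" using bins by (simp add: add_mult_distrib)
  have bij: "bij_betw (bin_index m \<pi>) {..<n1 + n2} {..<n1 + n2}"
    unfolding nn by (rule bin_index_bij[OF m \<pi>])
  have inI: "bin_index m \<pi> k < n1 + n2" if "k < n1 + n2" for k
    using bij_betwE[OF bij] that by blast
  have "permuted_stat (U_ho n1 n2 g) n1 m x \<pi> = split_stat g n1 n2 {..<n1} (\<lambda>k. x (bin_index m \<pi> k))"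
    unfolding permuted_stat_def using point_in_space[OF x] inI
    by (intro U_ho_eq_split_stat[where v = "\<lambda>k. x (bin_index m \<pi> k)"] n g_sym) auto
  also have "\<dots> = split_stat g n1 n2 (bin_split n1 m \<pi>) x"
    unfolding bin_split_def by (rule split_stat_reindex[OF bij])
  finally show ?thesis .
qed

text \<open>The sign of the effect is what allows the label-weight sum to be replaced by its upper bound,
  the squared discrepancy.\<close>

lemma split_stat_le:
  assumes n: "2 \<le> n1" "2 \<le> n2" and S: "S \<subseteq> {..<n1 + n2}" "card S = n1" and e: "0 \<le> effect"
  shows "split_stat g n1 n2 S x \<le> effect * disc n1 n2 S ^ 2 + lin n1 n2 S x + quad n1 n2 S x"
  unfolding split_stat_decomposition[OF n S]
  using mult_left_mono[OF label_weight_sum_le[OF n S] e] by simp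

lemma split_stat_measurable:
  assumes n: "2 \<le> n1" "2 \<le> n2" and S: "S \<subseteq> {..<n1 + n2}" "card S = n1"
  shows "split_stat g n1 n2 S \<in> borel_measurable (two_sample P Q n1 n2)"
  unfolding split_stat_decomposition[OF n S, abs_def] by measurable

lemma noise_square_le:
  assumes n: "2 \<le> n1" "2 \<le> n2" and v: "\<And>b. witness_var b \<le> v"
    and S: "S \<subseteq> {..<n1 + n2}" "card S = n1"
  shows "(\<integral>x. (lin n1 n2 S x + quad n1 n2 S x)^2 \<partial>two_sample P Q n1 n2)
    \<le> 4 * v * (\<Sum>p\<in>{..<n1 + n2}. (label_weight n1 n2 S p)^2)
      + 2 * psi_YZ2 P Q g * (1 / (real n1 * (real n1 - 1)) + 1 / (real n2 * (real n2 - 1)) + 2 / (real n1 * real n2))"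
proof -
  have "(\<Sum>p\<in>{..<n1 + n2}. (label_weight n1 n2 S p)^2 * witness_var (p < n1))
      \<le> (\<Sum>p\<in>{..<n1 + n2}. v * (label_weight n1 n2 S p)^2)"
    using v by (intro sum_mono) (simp add: mult.commute mult_right_mono)
  also have "\<dots> = v * (\<Sum>p\<in>{..<n1 + n2}. (label_weight n1 n2 S p)^2)" by (simp add: sum_distrib_left)
  finally have "(\<Sum>p\<in>{..<n1 + n2}. (label_weight n1 n2 S p)^2 * witness_var (p < n1))
      \<le> v * (\<Sum>p\<in>{..<n1 + n2}. (label_weight n1 n2 S p)^2)" .
  then show ?thesis
    using lin_quad_sum_square(2)[of n1 n2 S] unfolding coef_square_sum[OF n S] by linarith
qed

text \<open>The error budget: one sixth of \<open>\<beta>\<close> pays for the randomness of the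
  permutations, the rest for the event that the permutation p-value of the data exceeds
  \<open>alpha_star\<close>.\<close>

lemma cheap_power_ge:
  assumes n: "2 \<le> n1" "2 \<le> n2" and bins: "n1 = s1 * m" "n2 = s2 * m"
    and ab: "0 < \<alpha>" "0 < \<beta>" and B: "1 \<le> \<alpha> * (real B + 1)"
    and tail: "measure (two_sample P Q n1 n2) {x \<in> space (two_sample P Q n1 n2).
      alpha_star \<alpha> \<beta> B < mean {\<pi>. \<pi> permutes {..<s1 + s2}}
        (\<lambda>\<pi>. of_bool (effect + lin n1 n2 {..<n1} x + quad n1 n2 {..<n1} x
          \<le> split_stat g n1 n2 (bin_split n1 m \<pi>) x))} \<le> 5 / 6 * \<beta>"
  shows "1 - \<beta> \<le> cheap_test_power (U_ho n1 n2 g) P Q n1 n2 (s1 + s2) B \<alpha>"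
proof -
  let ?M = "two_sample P Q n1 n2"
  let ?Perms = "{\<pi>. \<pi> permutes {..<s1 + s2}}"
  have m: "0 < m" and s: "0 < s1" "0 < s2" using bins n by (auto intro: Nat.gr0I)
  have nn: "(n1 + n2) div (s1 + s2) = m" using bins s by (simp add: add_mult_distrib[symmetric])
  define k where "k = nat \<lfloor>\<alpha> * (real B + 1)\<rfloor>"
  note bt = binomial_tail_le[OF ab B, folded k_def]
  define T0 where "T0 x = effect + lin n1 n2 {..<n1} x + quad n1 n2 {..<n1} x" for x
  define T where "T x \<pi> = split_stat g n1 n2 (bin_split n1 m \<pi>) x" for x \<pi>
  have fin: "finite {\<tau>. \<tau> permutes {0..B}}" "{\<tau>. \<tau> permutes {0..B}} \<noteq> {}"
    using finite_permutations[of "{0..B}"] permutes_id[of "{0..B}"] by blast+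
  have "1 - \<beta> / 6 - measure ?M {x \<in> space ?M. alpha_star \<alpha> \<beta> B < mean ?Perms (\<lambda>\<pi>. of_bool (T0 x \<le> T x \<pi>))}
    \<le> (\<integral>(x, ps, \<tau>). reject_prob B \<alpha> (test_rank B (\<lambda>b. if b = 0 then T0 x else T x (ps b)) \<tau>)
      \<partial>(?M \<Otimes>\<^sub>M (PiM {1..B} (\<lambda>_. uniform_count_measure ?Perms) \<Otimes>\<^sub>M uniform_count_measure {\<tau>. \<tau> permutes {0..B}})))"
  proof (rule randomized_test_power[OF two_sample_prob finite_perms[OF s] fin _ _ bt(2,3)])
    show "T0 \<in> borel_measurable ?M" unfolding T0_def by measurable
    show "(\<lambda>x. T x \<pi>) \<in> borel_measurable ?M" if "\<pi> \<in> ?Perms" for \<pi>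
      unfolding T_def using that bin_split_properties(1,2)[OF m _ bins]
      by (intro split_stat_measurable n) auto
  qed (use ab in auto)
  also have "\<dots> = cheap_test_power (U_ho n1 n2 g) P Q n1 n2 (s1 + s2) B \<alpha>"
    unfolding cheap_test_power_def cheap_experiment_def nn
  proof (intro Bochner_Integration.integral_cong refl)
    fix z assume z: "z \<in> space (?M \<Otimes>\<^sub>M (PiM {1..B} (\<lambda>_. uniform_count_measure ?Perms) \<Otimes>\<^sub>M uniform_count_measure {\<tau>. \<tau> permutes {0..B}}))"
    obtain x ps \<tau> where zz: "z = (x, ps, \<tau>)" by (cases z)
    have x: "x \<in> space ?M" and ps: "\<And>b. b \<in> {1..B} \<Longrightarrow> ps b permutes {..<s1 + s2}"
      using z unfolding zz by (auto simp: space_pair_measure space_PiM PiE_iff space_uniform_count_measure)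
    have t0: "T0 x = test_stats (U_ho n1 n2 g) n1 m x ps 0"
      unfolding T0_def test_stats_def using U_ho_decomposition[OF x n] by simp
    have tb: "T x (ps b) = test_stats (U_ho n1 n2 g) n1 m x ps b" if "b \<in> {1..B}" for b
      using that permuted_U_eq[OF x n bins ps[OF that]] unfolding T_def test_stats_def by simp
    have "test_rank B (\<lambda>b. if b = 0 then T0 x else T x (ps b)) \<tau> = test_rank B (test_stats (U_ho n1 n2 g) n1 m x ps) \<tau>"
    proof -
      have "{b \<in> {1..B}. (if b = 0 then T0 x else T x (ps b)) < (if (0::nat) = 0 then T0 x else T x (ps 0)) \<or>
            ((if b = 0 then T0 x else T x (ps b)) = (if (0::nat) = 0 then T0 x else T x (ps 0)) \<and> \<tau> b < \<tau> 0)}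
        = {b \<in> {1..B}. test_stats (U_ho n1 n2 g) n1 m x ps b < test_stats (U_ho n1 n2 g) n1 m x ps 0 \<or>
            (test_stats (U_ho n1 n2 g) n1 m x ps b = test_stats (U_ho n1 n2 g) n1 m x ps 0 \<and> \<tau> b < \<tau> 0)}"
        using t0 tb by (intro Collect_cong conj_cong refl) auto
      then show ?thesis unfolding test_rank_def by simp
    qed
    then show "(case z of (x, ps, \<tau>) \<Rightarrow> reject_prob B \<alpha> (test_rank B (\<lambda>b. if b = 0 then T0 x else T x (ps b)) \<tau>))
      = (case z of (x, ps, \<tau>) \<Rightarrow> reject_prob B \<alpha> (test_rank B (test_stats (U_ho n1 n2 g) n1 m x ps) \<tau>))"
      unfolding zz by simp
  qed
  finally show ?thesis using tail unfolding T0_def T_def by linarith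
qed

end

section \<open>Numerical inequalities\<close>

lemma coef_square_sum_le:
  fixes a b :: real
  assumes "1 < a" "1 < b"
  shows "1 / (a * (a - 1)) + 1 / (b * (b - 1)) + 2 / (a * b) \<le> (a + b)^2 / (a * (a - 1) * b * (b - 1))"
proof -
  have e: "1 / (a * u) + 1 / (b * v) + 2 / (a * b) = (b * v + a * u + 2 * (u * v)) / (a * u * b * v)"
    if "0 < u" "0 < v" for u v
    using assms that by (simp add: field_simps)
  have "1 / (a * (a - 1)) + 1 / (b * (b - 1)) + 2 / (a * b)
      = (b * (b - 1) + a * (a - 1) + 2 * ((a - 1) * (b - 1))) / (a * (a - 1) * b * (b - 1))"
    using assms by (intro e) auto
  also have "\<dots> \<le> (a + b)^2 / (a * (a - 1) * b * (b - 1))"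
  proof (rule divide_right_mono)
    have "b * (b - 1) + a * (a - 1) + 2 * ((a - 1) * (b - 1)) = (a + b)^2 - 3 * (a + b) + 2"
      by (simp add: power2_eq_square algebra_simps)
    moreover have "0 \<le> 3 * (a + b) - 2" using assms by simp
    ultimately show "b * (b - 1) + a * (a - 1) + 2 * ((a - 1) * (b - 1)) \<le> (a + b)^2"
      by linarith
    show "0 \<le> a * (a - 1) * b * (b - 1)" using assms by (intro mult_nonneg_nonneg) auto
  qed
  finally show ?thesis .
qed

text \<open>The left side bounds the second moment of a permuted statistic when every point is a bin of its
  own, and the fraction on the right is the coefficient under the second square root of the
  separation threshold. The factor 5/4 converts \<open>1 / a\<close> into odds.\<close>

lemma unbinned_second_moment_numeric:
  fixes a b :: real
  assumes ab: "4 \<le> a" "a \<le> b"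
  shows "5 / 4 * (16 * (3 / 2 * (1 / a + 1 / b) / (a + b - 1))
      + 16 * ((1 / a + 1 / b) / (a + b - 1) + a / (a + b) * (1 / (a * (a - 1)^2) + 1 / (b * (b - 1)^2)))
      + 2 * (1 / (a * (a - 1)) + 1 / (b * (b - 1)) + 2 / (a * b)))
    \<le> 9 / 25 * ((36 * a^2 + 36 * b^2 + 198 * a * b) / (a * (a - 1) * b * (b - 1)))"
proof -
  define q where "q = 1 / (a * b)"
  define pr where "pr = a * (a - 1) * b * (b - 1)"
  have q0: "0 < q" using ab by (simp add: q_def)
  have pr0: "0 < pr" using ab by (simp add: pr_def)
  have i: "(1 / a + 1 / b) / (a + b - 1) \<le> 8 / 7 * q"
  proof -
    have "1 / a + 1 / b = (a + b) * q" using ab by (simp add: q_def field_simps)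
    moreover have "(a + b) / (a + b - 1) \<le> 8 / 7" using ab by (simp add: divide_le_eq)
    then have "(a + b) / (a + b - 1) * q \<le> 8 / 7 * q" using q0 by (intro mult_right_mono) auto
    ultimately show ?thesis by simp
  qed
  have sq: "y / (y - 1)^2 \<le> 4 / 9" if "4 \<le> y" for y :: real
  proof -
    have "0 \<le> (4 * y - 1) * (y - 4)" using that by (intro mult_nonneg_nonneg) auto
    then have "9 * y \<le> 4 * (y - 1)^2" by (simp add: power2_eq_square algebra_simps)
    then show ?thesis using that by (simp add: divide_le_eq)
  qed
  have ii: "a / (a + b) * (1 / (a * (a - 1)^2) + 1 / (b * (b - 1)^2)) \<le> 4 / 9 * q"
  proof -
    have A: "1 / (a * (a - 1)^2) \<le> 4 / 9 * (1 / a^2)"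
    proof -
      have "1 / (a * (a - 1)^2) = a / (a - 1)^2 * (1 / a^2)" using ab by (simp add: power2_eq_square)
      also have "\<dots> \<le> 4 / 9 * (1 / a^2)" using ab by (intro mult_right_mono sq) auto
      finally show ?thesis .
    qed
    have B: "1 / (b * (b - 1)^2) \<le> 4 / 9 * (1 / b^2)"
    proof -
      have "1 / (b * (b - 1)^2) = b / (b - 1)^2 * (1 / b^2)" using ab by (simp add: power2_eq_square)
      also have "\<dots> \<le> 4 / 9 * (1 / b^2)" using ab by (intro mult_right_mono sq) auto
      finally show ?thesis .
    qed
    have "a / (a + b) * (1 / (a * (a - 1)^2) + 1 / (b * (b - 1)^2)) \<le> a / (a + b) * (4 / 9 * (1 / a^2) + 4 / 9 * (1 / b^2))"
      using A B ab by (intro mult_left_mono) auto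
    also have "\<dots> = 4 / 9 * ((a / (a + b)) * (1 / a^2 + 1 / b^2))" by (simp add: algebra_simps)
    also have "(a / (a + b)) * (1 / a^2 + 1 / b^2) \<le> q"
    proof -
      have "(a / (a + b)) * (1 / a^2 + 1 / b^2) = (a^2 + b^2) / ((a + b) * (a * b^2))"
      proof -
        have "a / c * (1 / a^2 + 1 / b^2) = (a^2 + b^2) / (c * (a * b^2))" if "0 < c" for c
          using ab that by (simp add: power2_eq_square field_simps)
        then show ?thesis using ab by simp
      qed
      also have "\<dots> \<le> (b * (a + b)) / ((a + b) * (a * b^2))"
        using ab mult_left_mono[of a b a] by (intro divide_right_mono) (auto simp: power2_eq_square algebra_simps)
      also have "\<dots> = q" using ab by (simp add: q_def power2_eq_square)
      finally show ?thesis .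
    qed
    finally show ?thesis by simp
  qed
  have iii: "1 / (a * (a - 1)) + 1 / (b * (b - 1)) + 2 / (a * b) \<le> (a + b)^2 / pr"
    unfolding pr_def using ab by (intro coef_square_sum_le) auto
  have iv: "q \<le> a * b / pr"
  proof -
    have "pr \<le> (a * b) * (a * b)"
    proof -
      have "pr = (a * b) * ((a - 1) * (b - 1))" by (simp add: pr_def)
      also have "\<dots> \<le> (a * b) * (a * b)" using ab by (intro mult_left_mono mult_mono) auto
      finally show ?thesis .
    qed
    then show ?thesis unfolding q_def using pr0 ab by (simp add: field_simps)
  qed
  have "5 / 4 * (16 * (3 / 2 * (1 / a + 1 / b) / (a + b - 1))
      + 16 * ((1 / a + 1 / b) / (a + b - 1) + a / (a + b) * (1 / (a * (a - 1)^2) + 1 / (b * (b - 1)^2)))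
      + 2 * (1 / (a * (a - 1)) + 1 / (b * (b - 1)) + 2 / (a * b)))
    \<le> 5 / 4 * (24 * (8 / 7 * q) + 16 * (8 / 7 * q + 4 / 9 * q) + 2 * ((a + b)^2 / pr))"
  proof -
    have gen: "5 / 4 * (16 * (3 / 2 * X) + 16 * (X + Y) + 2 * Z) \<le> 5 / 4 * (24 * U + 16 * (U + V) + 2 * W)"
      if "X \<le> U" "Y \<le> V" "Z \<le> W" for X Y Z U V W :: real
      using that by simp
    have "3 / 2 * (1 / a + 1 / b) / (a + b - 1) = 3 / 2 * ((1 / a + 1 / b) / (a + b - 1))" by simp
    then show ?thesis using gen[OF i ii iii] by (simp only:)
  qed
  also have "\<dots> = 5 / 4 * (24 * 8 / 7 + 16 * (8 / 7 + 4 / 9)) * q + 5 / 2 * ((a + b)^2 / pr)" by simp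
  also have "\<dots> \<le> 5 / 4 * (24 * 8 / 7 + 16 * (8 / 7 + 4 / 9)) * (a * b / pr) + 5 / 2 * ((a + b)^2 / pr)"
    using iv by simp
  also have "\<dots> = (5 / 4 * (24 * 8 / 7 + 16 * (8 / 7 + 4 / 9)) * (a * b) + 5 / 2 * (a + b)^2) / pr"
    by (simp add: add_divide_distrib)
  also have "\<dots> \<le> (9 / 25 * (36 * a^2 + 36 * b^2 + 198 * a * b)) / pr"
  proof (rule divide_right_mono)
    have "0 \<le> a * b" "0 \<le> a^2" "0 \<le> b^2" using ab by auto
    moreover have "(a + b)^2 = a^2 + b^2 + 2 * (a * b)" by (simp add: power2_sum)
    ultimately show "5 / 4 * (24 * 8 / 7 + 16 * (8 / 7 + 4 / 9)) * (a * b) + 5 / 2 * (a + b)^2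
        \<le> 9 / 25 * (36 * a^2 + 36 * b^2 + 198 * a * b)"
    proof -
      have c: "5 / 4 * (24 * 8 / 7 + 16 * (8 / 7 + 4 / 9)) = (4160 / 63 :: real)" by simp
      have gen: "4160 / 63 * z + 5 / 2 * (x + y + 2 * z) \<le> 9 / 25 * (36 * x + 36 * y + 198 * z)"
        if "0 \<le> x" "0 \<le> y" "0 \<le> z" for x y z :: real
      proof -
        have "9 / 25 * (36 * x + 36 * y + 198 * z) - (4160 / 63 * z + 5 / 2 * (x + y + 2 * z))
            = 523 / 50 * x + 523 / 50 * y + 391 / 1575 * z" by (simp add: field_simps)
        then show ?thesis using that by (smt (verit) mult_nonneg_nonneg divide_nonneg_nonneg)
      qed
      assume "0 \<le> a * b" "0 \<le> a^2" "0 \<le> b^2" "(a + b)^2 = a^2 + b^2 + 2 * (a * b)"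
      then show ?thesis unfolding c mult.assoc[of 198] using gen[of "a^2" "b^2" "a * b"] by simp
    qed
  qed (use pr0 in simp)
  finally show ?thesis unfolding pr_def by simp
qed

text \<open>Up to the factor 5, the right side is the square of the combination of sample sizes that the
  product of \<open>A\<close> and \<open>rr / D\<close> yields in \<open>lin_threshold\<close>.
  The assumption that \<open>a\<close> is at least 10 makes the diagonal correction, of order
  \<open>a\<close> to the power -7, negligible.\<close>

lemma binned_fourth_moment_numeric:
  fixes a b s :: real
  assumes ab: "10 \<le> a" "a \<le> b" and s: "4 \<le> s" "2 * s \<le> a + b"
  shows "(a + b) * (64 / 27 * (3 / 2 * ((a + b)^2 / (s * (a * b))) / (s - 1)) * (1 / a^3 + 1 / b^3)
      + 64 * (a / (a + b)) * (1 / (a^3 * (a - 1)^4) + 1 / (b^3 * (b - 1)^4)))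
    \<le> 5 * ((a + b)^3 / ((a * b)^2 * s))^2"
proof -
  define n where "n = a + b"
  define q where "q = a * b"
  have n0: "0 < n" and q0: "0 < q" using ab by (auto simp: n_def q_def)
  have cub: "1 / a^3 + 1 / b^3 \<le> n^3 / q^3"
  proof -
    have "1 / a^3 + 1 / b^3 = (a^3 + b^3) / q^3" using ab by (simp add: q_def power_mult_distrib field_simps)
    also have "a^3 + b^3 \<le> n^3"
    proof -
      have "n^3 = a^3 + b^3 + 3 * (a * b * n)" by (simp add: n_def power3_eq_cube algebra_simps)
      then show ?thesis using n0 ab by simp
    qed
    finally show ?thesis using q0 by (simp add: divide_right_mono)
  qed
  have T1: "64 / 27 * (3 / 2 * (n^2 / (s * q)) / (s - 1)) \<le> 128 / 27 * (n^2 / (s^2 * q))"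
  proof -
    have "1 / (s - 1) \<le> 4 / 3 * (1 / s)" using s by (simp add: field_simps)
    then have "32 / 9 * (n^2 / (s * q)) * (1 / (s - 1)) \<le> 32 / 9 * (n^2 / (s * q)) * (4 / 3 * (1 / s))"
      using s q0 by (intro mult_left_mono) auto
    moreover have "64 / 27 * (3 / 2 * (n^2 / (s * q)) / (s - 1)) = 32 / 9 * (n^2 / (s * q)) * (1 / (s - 1))"
      by simp
    moreover have "32 / 9 * (n^2 / (s * q)) * (4 / 3 * (1 / s)) = 128 / 27 * (n^2 / (s^2 * q))"
      by (simp add: power2_eq_square)
    ultimately show ?thesis by (simp only:)
  qed
  have T2: "64 * (a / n) * (1 / (a^3 * (a - 1)^4) + 1 / (b^3 * (b - 1)^4)) \<le> 64 * (a / n) * (1 / (a - 1)^4) * (n^3 / q^3)"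
  proof -
    have "1 / (b^3 * (b - 1)^4) \<le> 1 / (b^3 * (a - 1)^4)"
      using ab by (intro divide_left_mono mult_left_mono power_mono) auto
    then have "1 / (a^3 * (a - 1)^4) + 1 / (b^3 * (b - 1)^4) \<le> 1 / (a - 1)^4 * (1 / a^3 + 1 / b^3)"
      by (simp add: algebra_simps)
    also have "\<dots> \<le> 1 / (a - 1)^4 * (n^3 / q^3)" using cub by (intro mult_left_mono) auto
    finally have "64 * (a / n) * (1 / (a^3 * (a - 1)^4) + 1 / (b^3 * (b - 1)^4)) \<le> 64 * (a / n) * (1 / (a - 1)^4 * (n^3 / q^3))"
      using ab n0 by (intro mult_left_mono) auto
    then show ?thesis by (simp only: mult.assoc)
  qed
  have T3: "64 * (a / n) * (1 / (a - 1)^4) \<le> 1 / 4 * (n^2 / (s^2 * q))"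
  proof -
    have 81: "81 * a \<le> 10 * (a - 1)^2"
    proof -
      have "0 \<le> (10 * a - 1) * (a - 10)" using ab by (intro mult_nonneg_nonneg) auto
      then show ?thesis by (simp add: power2_eq_square algebra_simps)
    qed
    have "(81 * a)^2 \<le> (10 * (a - 1)^2)^2" using 81 ab by (intro power_mono) auto
    then have "6561 * a^2 \<le> 100 * (a - 1)^4" by (simp add: power_mult_distrib)
    moreover have "0 \<le> a^2" by simp
    ultimately have a4: "64 * a^2 \<le> (a - 1)^4" by linarith
    have "64 * (a / n) * (1 / (a - 1)^4) \<le> 1 / (n * a)"
      using a4 ab n0 by (simp add: field_simps power2_eq_square)
    also have "\<dots> \<le> 1 / q"
    proof (rule divide_left_mono)
      show "q \<le> n * a" using ab by (simp add: n_def q_def algebra_simps)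
      show "0 < n * a * q" using ab n0 q0 by (intro mult_pos_pos) auto
    qed simp
    also have "\<dots> \<le> 1 / 4 * (n^2 / (s^2 * q))"
    proof -
      have "(2 * s)^2 \<le> n^2" using s unfolding n_def by (intro power_mono) auto
      then show ?thesis using s q0 by (simp add: field_simps)
    qed
    finally show ?thesis .
  qed
  have "n * (64 / 27 * (3 / 2 * (n^2 / (s * q)) / (s - 1)) * (1 / a^3 + 1 / b^3)
      + 64 * (a / n) * (1 / (a^3 * (a - 1)^4) + 1 / (b^3 * (b - 1)^4)))
    \<le> n * (128 / 27 * (n^2 / (s^2 * q)) * (n^3 / q^3) + 1 / 4 * (n^2 / (s^2 * q)) * (n^3 / q^3))"
  proof (intro mult_left_mono add_mono)
    show "64 / 27 * (3 / 2 * (n^2 / (s * q)) / (s - 1)) * (1 / a^3 + 1 / b^3) \<le> 128 / 27 * (n^2 / (s^2 * q)) * (n^3 / q^3)"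
      by (rule mult_mono[OF T1 cub]) (use q0 s ab in auto)
    show "64 * (a / n) * (1 / (a^3 * (a - 1)^4) + 1 / (b^3 * (b - 1)^4)) \<le> 1 / 4 * (n^2 / (s^2 * q)) * (n^3 / q^3)"
      using T2 mult_right_mono[OF T3, of "n^3 / q^3"] n0 q0 by simp
  qed (use n0 in auto)
  also have "\<dots> = (128 / 27 + 1 / 4) * (n * (n^2 / (s^2 * q)) * (n^3 / q^3))" by (simp add: algebra_simps)
  also have "\<dots> \<le> 5 * (n * (n^2 / (s^2 * q)) * (n^3 / q^3))"
    using n0 q0 by (intro mult_right_mono) auto
  also have "n * (n^2 / (s^2 * q)) * (n^3 / q^3) = (n^3 / (q^2 * s))^2"
  proof -
    have "n * (n^2 / (s^2 * q)) * (n^3 / q^3) = (n * n^2 * n^3) / (s^2 * (q * q^3))" by simp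
    also have "n * n^2 * n^3 = (n^3)^2" by (simp add: power2_eq_square power3_eq_cube)
    also have "s^2 * (q * q^3) = (q^2 * s)^2" by (simp add: power2_eq_square power3_eq_cube)
    finally show ?thesis by (simp add: power_divide)
  qed
  finally show ?thesis unfolding n_def q_def by (simp add: mult.assoc)
qed

lemma binned_sixth_moment_numeric:
  fixes a b s :: real
  assumes ab: "0 < a" "0 < b" and s: "4 \<le> s"
  shows "15 / 4 * ((a + b)^2 / (s * (a * b)))^2 / (s - 1) \<le> 5 / 4 * ((a + b)^6 / ((a * b)^3 * s^3))"
proof -
  define n where "n = a + b"
  define q where "q = a * b"
  have n0: "0 < n" and q0: "0 < q" using ab by (auto simp: n_def q_def)
  have q4: "4 * q \<le> n^2"
    using sum_squares_bound[of a b] by (simp add: n_def q_def power2_sum)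
  have "1 / (s - 1) \<le> 4 / 3 * (1 / s)" using s by (simp add: field_simps)
  then have "15 / 4 * (n^2 / (s * q))^2 * (1 / (s - 1)) \<le> 15 / 4 * (n^2 / (s * q))^2 * (4 / 3 * (1 / s))"
    by (intro mult_left_mono) auto
  also have "\<dots> = 5 / 4 * (n^4 / (q^3 * s^3)) * (4 * q)"
    using q0 s by (simp add: power2_eq_square power3_eq_cube power4_eq_xxxx field_simps)
  also have "\<dots> \<le> 5 / 4 * (n^4 / (q^3 * s^3)) * n^2"
    using q4 q0 s by (intro mult_left_mono) auto
  also have "\<dots> = 5 / 4 * (n^6 / (q^3 * s^3))" by (simp add: eval_nat_numeral)
  finally show ?thesis unfolding n_def q_def by simp
qed

section \<open>Tail of the permutation p-value\<close>

text \<open>The upper bound gives \<open>1 / a \<le> 5 / 4 * ((1 - a) / a)\<close>, which lets tail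
  probabilities be paid with the odds that occur in the separation threshold.\<close>

lemma alpha_star_bounds:
  assumes "0 < \<alpha>" "\<alpha> < 1" "0 < \<beta>" "\<beta> < 1" and B: "1 \<le> \<alpha> * (real B + 1)"
  shows "0 < alpha_star \<alpha> \<beta> B" "alpha_star \<alpha> \<beta> B \<le> 1 / 5"
proof -
  show "0 < alpha_star \<alpha> \<beta> B" using assms by (simp add: alpha_star_def)
  have fl: "0 \<le> 1 / real_of_int \<lfloor>\<alpha> * (real B + 1)\<rfloor>" using B by (simp add: le_floor_iff)
  have p: "(\<beta> / 3) powr (1 / real_of_int \<lfloor>\<alpha> * (real B + 1)\<rfloor>) \<le> 1"
    using assms fl by (intro powr_le1) auto
  have e: "5 / 2 \<le> exp (1::real)" using exp_lower_Taylor_quadratic[of 1] by simp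
  have "\<alpha> / (2 * exp 1) \<le> 1 / 5" using assms e by (simp add: divide_le_eq)
  then have "alpha_star \<alpha> \<beta> B \<le> 1 / 5 * 1"
    unfolding alpha_star_def using p assms by (intro mult_mono) auto
  then show "alpha_star \<alpha> \<beta> B \<le> 1 / 5" by simp
qed

text \<open>The degenerate noise uses one eighteenth of the second-order budget of the threshold.\<close>

lemma quad_noise_budget:
  fixes a b x \<psi> :: real
  assumes ab: "1 < a" "1 < b" and x: "0 \<le> x" and \<psi>: "0 \<le> \<psi>"
  shows "x * (2 * \<psi> * (1 / (a * (a - 1)) + 1 / (b * (b - 1)) + 2 / (a * b)))
    \<le> x * ((36 * a^2 + 36 * b^2 + 198 * a * b) * \<psi> / (a * (a - 1) * b * (b - 1))) / 18"
proof -
  define pr where "pr = a * (a - 1) * b * (b - 1)"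
  have pr: "0 < pr" using ab by (simp add: pr_def)
  have "2 * \<psi> * (1 / (a * (a - 1)) + 1 / (b * (b - 1)) + 2 / (a * b)) \<le> 2 * \<psi> * ((a + b)^2 / pr)"
    unfolding pr_def using ab \<psi> by (intro mult_left_mono coef_square_sum_le) auto
  also have "\<dots> = (2 * (a + b)^2 * \<psi>) / pr" by simp
  also have "\<dots> \<le> ((36 * a^2 + 36 * b^2 + 198 * a * b) / 18 * \<psi>) / pr"
  proof (intro divide_right_mono mult_right_mono)
    have "0 \<le> a * b" using ab by simp
    then show "2 * (a + b)^2 \<le> (36 * a^2 + 36 * b^2 + 198 * a * b) / 18" by (simp add: power2_sum)
  qed (use pr \<psi> in auto)
  finally have "2 * \<psi> * (1 / (a * (a - 1)) + 1 / (b * (b - 1)) + 2 / (a * b))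
      \<le> (36 * a^2 + 36 * b^2 + 198 * a * b) * \<psi> / pr / 18" by simp
  from mult_left_mono[OF this x] show ?thesis unfolding pr_def by simp
qed

lemma sqrt_sum3_le:
  assumes "0 \<le> a" "0 \<le> b" "0 \<le> (c::real)"
  shows "sqrt (a + b + c) \<le> sqrt (a + c) + sqrt b"
  using sqrt_add_le_add_sqrt[of "a + c" b] assms by (simp add: algebra_simps)

context two_sample_kernel
begin

text \<open>The common value of \<open>psi_Y1\<close> and \<open>psi_Z1\<close>.\<close>

definition vmax :: real where
  "vmax = max (witness_var True) (witness_var False)"

lemma witness_var_le_vmax: "witness_var b \<le> vmax"
  by (cases b) (auto simp: vmax_def)

lemma vmax_nonneg: "0 \<le> vmax"
  using witness_var_nonneg[of True] witness_var_le_vmax[of True] by linarith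

lemma vmax_le: "vmax \<le> 4 * psi_YZ2 P Q g"
  using witness_var_le[of True] witness_var_le[of False] by (simp add: vmax_def)

context
  fixes n1 n2 s1 s2 m :: nat
  assumes n: "4 \<le> n1" "n1 \<le> n2" and bins: "n1 = s1 * m" "n2 = s2 * m" and s4: "4 \<le> s1 + s2"
begin

private abbreviation "Data \<equiv> two_sample P Q n1 n2"
private abbreviation "I0 \<equiv> {..<n1}"
private abbreviation "Bperms \<equiv> {\<pi>. \<pi> permutes {..<s1 + s2}}"
private abbreviation "Sb \<equiv> bin_split n1 m"
private abbreviation "psi \<equiv> psi_YZ2 P Q g"
private abbreviation "N2 \<equiv> 2 * psi * (1 / (real n1 * (real n1 - 1)) + 1 / (real n2 * (real n2 - 1)) + 2 / (real n1 * real n2))"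
private abbreviation "V1 \<equiv> 4 * vmax * (1 / real n1 + 1 / real n2)"
private abbreviation "pval x \<equiv> mean Bperms (\<lambda>\<pi>. of_bool (effect + lin n1 n2 I0 x + quad n1 n2 I0 x
          \<le> split_stat g n1 n2 (Sb \<pi>) x))"

lemma sizes: "2 \<le> n1" "2 \<le> n2" "0 < m" "0 < s1" "0 < s2" "2 \<le> s1 + s2"
proof -
  show "2 \<le> n1" "2 \<le> n2" "2 \<le> s1 + s2" using n s4 by auto
  then show "0 < m" "0 < s1" "0 < s2" using bins by (auto intro: Nat.gr0I)
qed

lemma perms_finite: "finite Bperms" "Bperms \<noteq> {}"
  using finite_perms[OF sizes(4,5)] by auto

lemma split_ok: "\<pi> \<in> Bperms \<Longrightarrow> Sb \<pi> \<subseteq> {..<n1 + n2}" "\<pi> \<in> Bperms \<Longrightarrow> card (Sb \<pi>) = n1"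
  using split_is_split[OF bins sizes(1,2,6)] by auto

lemma N2_nonneg: "0 \<le> N2"
  using psi_YZ2_nonneg n by (intro mult_nonneg_nonneg add_nonneg_nonneg) auto

lemma V1_nonneg: "0 \<le> V1"
  using vmax_nonneg by (intro mult_nonneg_nonneg add_nonneg_nonneg) auto

text \<open>Small p-values are guaranteed once the observed statistic exceeds a data-dependent threshold
  \<open>t + W x\<close>. So it suffices to bound the probability that the statistic falls below
  it, and that is a one-sided tail of centered noise.\<close>

lemma tail_bound:
  assumes W: "W \<in> borel_measurable Data" "integrable Data (\<lambda>x. (W x)^2)" "(\<integral>x. (W x)^2 \<partial>Data) \<le> w^2" "0 \<le> w"
    and u: "0 < effect - t + u" and \<eta>: "0 \<le> \<eta>"
    and num: "sqrt (V1 + N2 + u^2) + w \<le> sqrt \<eta> * (effect - t + u)"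
    and pt: "\<And>x. x \<in> space Data \<Longrightarrow> t + W x < effect + lin n1 n2 I0 x + quad n1 n2 I0 x \<Longrightarrow> pval x \<le> a"
  shows "measure Data {x \<in> space Data. a < pval x} \<le> \<eta>"
proof -
  interpret PM: prob_space Data by (rule two_sample_prob)
  define V where "V x = - (lin n1 n2 I0 x + quad n1 n2 I0 x)" for x
  have Vm [measurable]: "V \<in> borel_measurable Data" unfolding V_def by measurable
  note [measurable] = W(1)
  have V2: "(V x)^2 = (lin n1 n2 I0 x + quad n1 n2 I0 x)^2" for x by (simp add: V_def power2_eq_square algebra_simps)
  have dsum: "(\<Sum>p\<in>{..<n1 + n2}. (label_weight n1 n2 I0 p)^2) = 1 / real n1 + 1 / real n2"
  proof -
    have "(\<Sum>p\<in>{..<n1 + n2}. (label_weight n1 n2 I0 p)^2)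
      = (\<Sum>p<n1. (label_weight n1 n2 I0 p)^2) + (\<Sum>j<n2. (label_weight n1 n2 I0 (n1 + j))^2)"
      by (rule sum_lessThan_add)
    also have "\<dots> = (\<Sum>p<n1. (1 / real n1)^2) + (\<Sum>j<n2. (- 1 / real n2)^2)"
      using label_weight_identity[OF sizes(1,2)] by simp
    finally show ?thesis using sizes by (simp add: power2_eq_square)
  qed
  have "(\<integral>x. (V x)^2 \<partial>Data) \<le> V1 + N2"
    unfolding V2 using noise_square_le[OF sizes(1,2) witness_var_le_vmax, of I0] unfolding dsum by simp
  moreover have "(\<integral>x. V x \<partial>Data) = 0"
    unfolding V_def using lin_integral[of n1 n2 I0] quad_integral[of n1 n2 I0] by simp
  ultimately have tail: "PM.prob {x \<in> space Data. effect - t \<le> V x + W x} \<le> \<eta>"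
    using num u \<eta> W lin_quad_sum_square(1)[of n1 n2 I0]
    by (intro PM.one_sided_tail[where v = "V1 + N2" and u = u and w = w]) (auto simp: V2)
  have "{x \<in> space Data. a < pval x} \<subseteq> {x \<in> space Data. effect - t \<le> V x + W x}"
  proof (rule subsetI)
    fix x assume "x \<in> {x \<in> space Data. a < pval x}"
    then have x: "x \<in> space Data" "a < pval x" by auto
    have "effect - t \<le> V x + W x"
      using pt[OF x(1)] x(2) unfolding V_def by linarith
    with x(1) show "x \<in> {x \<in> space Data. effect - t \<le> V x + W x}" by simp
  qed
  then have "PM.prob {x \<in> space Data. a < pval x} \<le> PM.prob {x \<in> space Data. effect - t \<le> V x + W x}"
    by (intro PM.finite_measure_mono) auto
  then show ?thesis using tail by linarith
qed

lemma lin_quad_mean_measurable: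
  assumes "\<And>\<pi>. \<pi> \<in> Bperms \<Longrightarrow> F \<pi> \<in> borel_measurable Data"
  shows "(\<lambda>x. mean Bperms (\<lambda>\<pi>. F \<pi> x)) \<in> borel_measurable Data"
  unfolding mean_def using assms
  by (intro borel_measurable_divide borel_measurable_sum borel_measurable_const)

lemma mean_integral:
  assumes "\<And>\<pi>. \<pi> \<in> Bperms \<Longrightarrow> integrable Data (F \<pi>)"
  shows "integrable Data (\<lambda>x. mean Bperms (\<lambda>\<pi>. F \<pi> x))"
    and "(\<integral>x. mean Bperms (\<lambda>\<pi>. F \<pi> x) \<partial>Data) = mean Bperms (\<lambda>\<pi>. \<integral>x. F \<pi> x \<partial>Data)"
proof -
  show "integrable Data (\<lambda>x. mean Bperms (\<lambda>\<pi>. F \<pi> x))"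
    unfolding mean_def using assms by (intro integrable_divide Bochner_Integration.integrable_sum)
  show "(\<integral>x. mean Bperms (\<lambda>\<pi>. F \<pi> x) \<partial>Data) = mean Bperms (\<lambda>\<pi>. \<integral>x. F \<pi> x \<partial>Data)"
    unfolding mean_def using assms by (simp add: Bochner_Integration.integral_sum)
qed

context
  fixes a \<beta> A Bq :: real
  assumes a: "0 < a" "a \<le> 1 / 5" and \<beta>: "0 < \<beta>" "\<beta> < 1"
    and A: "A = sqrt ((3 - \<beta>) / \<beta> * (4 * vmax / real n1 + 4 * vmax / real n2))"
    and Bq: "Bq = sqrt ((1 - a) / a * ((36 * real n1 ^ 2 + 36 * real n2 ^ 2 + 198 * real n1 * real n2) * psi
        / (\<beta> * real n1 * (real n1 - 1) * real n2 * (real n2 - 1))))"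
begin

private abbreviation "odds \<equiv> (1 - a) / a"

lemma odds_bounds: "4 \<le> odds" "1 / a \<le> 5 / 4 * odds"
  using a by (auto simp: field_simps)

lemma AB_nonneg: "0 \<le> A" "0 \<le> Bq"
proof -
  show "0 \<le> A" unfolding A using \<beta> vmax_nonneg
    by (intro real_sqrt_ge_zero mult_nonneg_nonneg add_nonneg_nonneg divide_nonneg_nonneg) auto
  show "0 \<le> Bq" unfolding Bq using \<beta> a psi_YZ2_nonneg n
    by (intro real_sqrt_ge_zero mult_nonneg_nonneg add_nonneg_nonneg divide_nonneg_nonneg) auto
qed

lemma V1_eq: "V1 = \<beta> / (3 - \<beta>) * A^2"
proof -
  have nn: "0 \<le> (3 - \<beta>) / \<beta> * V1" using \<beta> by (intro mult_nonneg_nonneg[OF _ V1_nonneg]) auto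
  have e: "4 * vmax / real n1 + 4 * vmax / real n2 = V1" by (simp add: distrib_left)
  have A2: "A^2 = (3 - \<beta>) / \<beta> * V1" unfolding A e by (rule real_sqrt_pow2[OF nn])
  have gen: "v = b / k * (k / b * v)" if "0 < b" "0 < k" for b k v :: real using that by simp
  show ?thesis unfolding A2 using \<beta> by (intro gen) auto
qed

lemma Bq_square:
  "\<beta> * Bq^2 = odds * ((36 * real n1 ^ 2 + 36 * real n2 ^ 2 + 198 * real n1 * real n2) * psi
        / (real n1 * (real n1 - 1) * real n2 * (real n2 - 1)))"
proof -
  define K where "K = (36 * real n1 ^ 2 + 36 * real n2 ^ 2 + 198 * real n1 * real n2) * psi"
  define pr where "pr = real n1 * (real n1 - 1) * real n2 * (real n2 - 1)"
  have "0 \<le> K" "0 \<le> pr" using psi_YZ2_nonneg n unfolding K_def pr_def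
    by (auto intro!: mult_nonneg_nonneg add_nonneg_nonneg)
  moreover have "Bq = sqrt (odds * (K / (\<beta> * pr)))" unfolding Bq K_def pr_def by (simp add: mult.assoc)
  ultimately have "Bq^2 = odds * (K / (\<beta> * pr))" using a \<beta> by simp
  then have "\<beta> * Bq^2 = odds * (K / pr)" using \<beta> by simp
  then show ?thesis unfolding K_def pr_def .
qed

lemma N2_le: "odds * N2 \<le> \<beta> * Bq^2 / 18" "sqrt N2 \<le> 12 / 100 * (sqrt \<beta> * Bq)"
proof -
  show 1: "odds * N2 \<le> \<beta> * Bq^2 / 18"
    unfolding Bq_square using n a psi_YZ2_nonneg by (intro quad_noise_budget) auto
  have "4 * N2 \<le> odds * N2" using odds_bounds(1) N2_nonneg by (intro mult_right_mono)
  then have "N2 \<le> \<beta> * Bq^2 / 72" using 1 by linarith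
  also have "\<dots> \<le> (12 / 100 * (sqrt \<beta> * Bq))^2"
  proof -
    have "(12 / 100 * (sqrt \<beta> * Bq))^2 = 144 / 10000 * (\<beta> * Bq^2)"
      using \<beta> by (simp add: power_mult_distrib power_divide)
    moreover have "0 \<le> \<beta> * Bq^2" using \<beta> by simp
    ultimately show ?thesis by linarith
  qed
  finally show "sqrt N2 \<le> 12 / 100 * (sqrt \<beta> * Bq)"
    using AB_nonneg \<beta> by (intro real_le_lsqrt) auto
qed

text \<open>With bins of single points even Markov's inequality for the second moment of the permuted
  statistic suffices, because the second-order part of the threshold dominates that moment.\<close>

lemma unbinned_tail:
  assumes m1: "m = 1" and eff: "A + Bq \<le> effect" "0 < effect"
  shows "measure Data {x \<in> space Data. a < pval x} \<le> 5 / 6 * \<beta>"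
proof -
  interpret PM: prob_space Data by (rule two_sample_prob)
  have ns: "s1 = n1" "s2 = n2" using bins m1 by auto
  define Z where "Z \<pi> x = effect * disc n1 n2 (Sb \<pi>)^2 + (lin n1 n2 (Sb \<pi>) x + quad n1 n2 (Sb \<pi>) x)" for \<pi> x
  define W where "W x = sqrt (mean Bperms (\<lambda>\<pi>. (Z \<pi> x)^2) / a)" for x
  \<comment> \<open>the square of 3/5 is the factor 9/25 of \<open>unbinned_second_moment_numeric\<close>\<close>
  define w where "w = 3 / 5 * (sqrt \<beta> * Bq)"
  have Zm [measurable]: "Z \<pi> \<in> borel_measurable Data" for \<pi> unfolding Z_def by measurable
  have W2: "(W x)^2 = mean Bperms (\<lambda>\<pi>. (Z \<pi> x)^2) / a" for x
    unfolding W_def using a mean_nonneg[of Bperms "\<lambda>\<pi>. (Z \<pi> x)^2"] by simp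
  have Z2: "integrable Data (\<lambda>x. (Z \<pi> x)^2)"
    "(\<integral>x. (Z \<pi> x)^2 \<partial>Data) = effect^2 * disc n1 n2 (Sb \<pi>)^4
      + (\<integral>x. (lin n1 n2 (Sb \<pi>) x + quad n1 n2 (Sb \<pi>) x)^2 \<partial>Data)" for \<pi>
  proof -
    define c where "c = effect * disc n1 n2 (Sb \<pi>)^2"
    define Y where "Y x = lin n1 n2 (Sb \<pi>) x + quad n1 n2 (Sb \<pi>) x" for x
    have Y: "integrable Data Y" "(\<integral>x. Y x \<partial>Data) = 0" "integrable Data (\<lambda>x. (Y x)^2)"
      unfolding Y_def using lin_integral[of n1 n2 "Sb \<pi>"] quad_integral[of n1 n2 "Sb \<pi>"]
        lin_quad_sum_square(1)[of n1 n2 "Sb \<pi>"] by auto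
    have e: "(Z \<pi> x)^2 = c^2 + 2 * c * Y x + (Y x)^2" for x
      unfolding Z_def c_def Y_def by (simp add: power2_sum)
    show "integrable Data (\<lambda>x. (Z \<pi> x)^2)" unfolding e using Y by simp
    have "(\<integral>x. (Z \<pi> x)^2 \<partial>Data) = c^2 + (\<integral>x. (Y x)^2 \<partial>Data)"
      unfolding e using Y by (simp add: PM.prob_space)
    then show "(\<integral>x. (Z \<pi> x)^2 \<partial>Data) = effect^2 * disc n1 n2 (Sb \<pi>)^4
      + (\<integral>x. (lin n1 n2 (Sb \<pi>) x + quad n1 n2 (Sb \<pi>) x)^2 \<partial>Data)"
      unfolding c_def Y_def by (simp add: power_mult_distrib)
  qed
  have EZ: "mean Bperms (\<lambda>\<pi>. \<integral>x. (Z \<pi> x)^2 \<partial>Data) \<le> psi * (16 * (3 / 2 * (1 / real n1 + 1 / real n2) / (real n1 + real n2 - 1))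
      + 16 * ((1 / real n1 + 1 / real n2) / (real n1 + real n2 - 1) + real n1 / (real n1 + real n2) * (1 / (real n1 * (real n1 - 1)^2) + 1 / (real n2 * (real n2 - 1)^2)))
      + 2 * (1 / (real n1 * (real n1 - 1)) + 1 / (real n2 * (real n2 - 1)) + 2 / (real n1 * real n2)))"
  proof -
    define d2 where "d2 \<pi> = (\<Sum>p\<in>{..<n1 + n2}. (label_weight n1 n2 (Sb \<pi>) p)^2)" for \<pi>
    have "mean Bperms (\<lambda>\<pi>. \<integral>x. (Z \<pi> x)^2 \<partial>Data)
        \<le> mean Bperms (\<lambda>\<pi>. (16 * psi) * disc n1 n2 (Sb \<pi>)^4 + ((16 * psi) * d2 \<pi> + N2))"
    proof (rule mean_mono)
      fix \<pi> assume \<pi>: "\<pi> \<in> Bperms"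
      have "effect^2 * disc n1 n2 (Sb \<pi>)^4 \<le> (16 * psi) * disc n1 n2 (Sb \<pi>)^4"
        using effect_square_le by (intro mult_right_mono) auto
      moreover have "(\<integral>x. (lin n1 n2 (Sb \<pi>) x + quad n1 n2 (Sb \<pi>) x)^2 \<partial>Data) \<le> 4 * vmax * d2 \<pi> + N2"
        unfolding d2_def by (rule noise_square_le[OF sizes(1,2) witness_var_le_vmax split_ok[OF \<pi>]])
      moreover have "4 * vmax * d2 \<pi> \<le> (16 * psi) * d2 \<pi>"
        using vmax_le by (intro mult_right_mono) (auto simp: d2_def sum_nonneg)
      ultimately show "(\<integral>x. (Z \<pi> x)^2 \<partial>Data) \<le> (16 * psi) * disc n1 n2 (Sb \<pi>)^4 + ((16 * psi) * d2 \<pi> + N2)"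
        unfolding Z2 by linarith
    qed
    also have "\<dots> = (16 * psi) * mean Bperms (\<lambda>\<pi>. disc n1 n2 (Sb \<pi>)^4) + ((16 * psi) * mean Bperms d2 + N2)"
      unfolding mean_add mean_cmult using perms_finite by (simp add: mean_const)
    also have "\<dots> \<le> (16 * psi) * (3 / 2 * (1 / real n1 + 1 / real n2) / (real n1 + real n2 - 1))
      + ((16 * psi) * ((1 / real n1 + 1 / real n2) / (real n1 + real n2 - 1) + real n1 / (real n1 + real n2) * (1 / (real n1 * (real n1 - 1)^2) + 1 / (real n2 * (real n2 - 1)^2))) + N2)"
      using mean_disc4[OF bins sizes(1,2,6)] mean_label_weight2[OF bins sizes(1,2,6)] psi_YZ2_nonneg
      unfolding d2_def ns by (intro add_mono mult_left_mono order_refl) auto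
    finally show ?thesis by (simp add: algebra_simps)
  qed
  have EW: "(\<integral>x. (W x)^2 \<partial>Data) \<le> w^2"
  proof -
    define T where "T = 16 * (3 / 2 * (1 / real n1 + 1 / real n2) / (real n1 + real n2 - 1))
      + 16 * ((1 / real n1 + 1 / real n2) / (real n1 + real n2 - 1) + real n1 / (real n1 + real n2) * (1 / (real n1 * (real n1 - 1)^2) + 1 / (real n2 * (real n2 - 1)^2)))
      + 2 * (1 / (real n1 * (real n1 - 1)) + 1 / (real n2 * (real n2 - 1)) + 2 / (real n1 * real n2))"
    define K where "K = (36 * real n1 ^ 2 + 36 * real n2 ^ 2 + 198 * real n1 * real n2) / (real n1 * (real n1 - 1) * real n2 * (real n2 - 1))"
    have TK: "5 / 4 * T \<le> 9 / 25 * K"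
      unfolding T_def K_def using n by (intro unbinned_second_moment_numeric) auto
    have T0: "0 \<le> T" unfolding T_def using n
      by (intro add_nonneg_nonneg mult_nonneg_nonneg divide_nonneg_nonneg) auto
    have "(\<integral>x. (W x)^2 \<partial>Data) = mean Bperms (\<lambda>\<pi>. \<integral>x. (Z \<pi> x)^2 \<partial>Data) * (1 / a)"
      unfolding W2 using mean_integral(2)[OF Z2(1)] by simp
    also have "\<dots> \<le> (psi * T) * (5 / 4 * odds)"
      using EZ odds_bounds a T0 psi_YZ2_nonneg unfolding T_def[symmetric] by (intro mult_mono) auto
    also have "\<dots> = (odds * psi) * (5 / 4 * T)" by (simp only: mult_ac)
    also have "\<dots> \<le> (odds * psi) * (9 / 25 * K)"
      using TK a psi_YZ2_nonneg by (intro mult_left_mono) auto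
    also have "\<dots> = 9 / 25 * (\<beta> * Bq^2)"
    proof -
      have "(o' * p) * (9 / 25 * (k / r)) = 9 / 25 * (o' * (k * p / r))" for o' p k r :: real by simp
      then show ?thesis unfolding Bq_square K_def .
    qed
    also have "\<dots> = w^2" using \<beta> unfolding w_def by (simp add: power_mult_distrib power_divide)
    finally show ?thesis .
  qed
  show ?thesis
  proof (rule tail_bound[where W = W and w = w and u = 0 and t = 0])
    have [measurable]: "(\<lambda>x. mean Bperms (\<lambda>\<pi>. (Z \<pi> x)^2)) \<in> borel_measurable Data"
      by (intro lin_quad_mean_measurable) measurable
    show "W \<in> borel_measurable Data" unfolding W_def by measurable
    show "integrable Data (\<lambda>x. (W x)^2)" unfolding W2 using mean_integral(1)[OF Z2(1)] by simp
    show "0 \<le> w" unfolding w_def using \<beta> AB_nonneg by simp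
    show "sqrt (V1 + N2 + 0^2) + w \<le> sqrt (5 / 6 * \<beta>) * (effect - 0 + 0)"
    proof -
      have "V1 \<le> (71 / 100 * (sqrt \<beta> * A))^2"
      proof -
        have "\<beta> / (3 - \<beta>) \<le> \<beta> / 2" using \<beta> by (intro divide_left_mono) auto
        then have "V1 \<le> \<beta> / 2 * A^2" unfolding V1_eq by (intro mult_right_mono) auto
        also have "\<dots> = (\<beta> * A^2) / 2" by simp
        also have "\<dots> \<le> 5041 / 10000 * (\<beta> * A^2)"
        proof -
          have "0 \<le> \<beta> * A^2" using \<beta> by simp
          then show ?thesis by linarith
        qed
        also have "\<dots> = (71 / 100 * (sqrt \<beta> * A))^2" using \<beta> by (simp add: power_mult_distrib power_divide)
        finally show ?thesis .
      qed
      then have V: "sqrt V1 \<le> 71 / 100 * (sqrt \<beta> * A)"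
        using \<beta> AB_nonneg by (intro real_le_lsqrt) auto
      have c: "91 / 100 \<le> sqrt (5 / 6)" by (rule real_le_rsqrt) (simp add: power2_eq_square)
      have "sqrt (V1 + N2 + 0^2) + w \<le> 71 / 100 * (sqrt \<beta> * A) + 12 / 100 * (sqrt \<beta> * Bq) + w"
        using sqrt_sum3_le[OF V1_nonneg N2_nonneg, of 0] V N2_le(2) by simp
      also have "\<dots> \<le> 91 / 100 * (sqrt \<beta> * (A + Bq))"
      proof -
        have "0 \<le> sqrt \<beta> * A" "0 \<le> sqrt \<beta> * Bq" using \<beta> AB_nonneg by auto
        then show ?thesis unfolding w_def distrib_left by linarith
      qed
      also have "\<dots> \<le> sqrt (5 / 6) * (sqrt \<beta> * effect)"
        using c eff \<beta> AB_nonneg by (intro mult_mono mult_left_mono) auto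
      also have "\<dots> = sqrt (5 / 6 * \<beta>) * (effect - 0 + 0)"
        by (simp only: real_sqrt_mult mult.assoc diff_0_right add_0_right)
      finally show ?thesis .
    qed
    fix x assume x: "x \<in> space Data" and lt: "0 + W x < effect + lin n1 n2 I0 x + quad n1 n2 I0 x"
    have "pval x \<le> mean Bperms (\<lambda>\<pi>. of_bool (W x < Z \<pi> x))"
    proof (rule mean_mono)
      fix \<pi> assume \<pi>: "\<pi> \<in> Bperms"
      have "split_stat g n1 n2 (Sb \<pi>) x \<le> Z \<pi> x"
        unfolding Z_def add.assoc[symmetric] using eff(2)
        by (intro split_stat_le[OF sizes(1,2) split_ok[OF \<pi>]]) simp
      then show "of_bool (effect + lin n1 n2 I0 x + quad n1 n2 I0 x \<le> split_stat g n1 n2 (Sb \<pi>) x)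
          \<le> (of_bool (W x < Z \<pi> x) :: real)" using lt by auto
    qed
    also have "\<dots> \<le> a"
    proof (rule mean_tail_le[OF perms_finite, where k = 2])
      show "0 \<le> W x" unfolding W_def using a by (intro real_sqrt_ge_zero divide_nonneg_nonneg mean_nonneg) auto
      show "mean Bperms (\<lambda>\<pi>. (Z \<pi> x)^2) \<le> a * (W x)^2" unfolding W2 using a by simp
    qed (use a in auto)
    finally show "pval x \<le> a" .
  qed (use EW eff \<beta> in auto)
qed

context
  fixes D rr :: real
  assumes m2: "2 \<le> m" and D1: "1 < D"
    and D: "D^2 = (real s1 + real s2)^3 * (\<beta> * a / (24 * (1 - a))) * rho n1 n2"
    and rr: "0 \<le> rr" "12 * (real s1 + real s2) / (real n1 + real n2) * vmax \<le> rr^2"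
    and eff: "A + Bq + rr / D \<le> effect * (1 - 1 / D)" "0 < effect"
begin

private abbreviation "N \<equiv> real n1 + real n2"
private abbreviation "q \<equiv> real n1 * real n2"
private abbreviation "sr \<equiv> real s1 + real s2"
private abbreviation "\<rho> \<equiv> rr / D"

lemma real_bins: "real n1 = real s1 * real m" "real n2 = real s2 * real m" "N = sr * real m"
    "2 * sr \<le> N" "0 < N" "0 < q" "4 \<le> sr"
proof -
  show 1: "real n1 = real s1 * real m" "real n2 = real s2 * real m" using bins by simp_all
  show 3: "N = sr * real m" unfolding 1 by (simp add: distrib_right)
  show "4 \<le> sr" using s4 by linarith
  then show "2 * sr \<le> N" unfolding 3 using mult_left_mono[of 2 "real m" sr] m2 by simp
  show "0 < N" "0 < q" using n by auto
qed

lemma real_bins_power: "0 < sr^3" "0 < q^3" "0 < N^6" "0 < q^3 * sr^3"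
proof -
  show s: "0 < sr^3" by (rule zero_less_power) (use real_bins(7) in linarith)
  show q: "0 < q^3" by (rule zero_less_power[OF real_bins(6)])
  show "0 < N^6" by (rule zero_less_power[OF real_bins(5)])
  show "0 < q^3 * sr^3" by (rule mult_pos_pos[OF q s])
qed

lemma rho_le: "rho n1 n2 \<le> q^3 / N^6" "0 < rho n1 n2"
proof -
  have p: "(real n1 - 1)^2 \<le> real n1 ^ 2" "(real n2 - 1)^2 \<le> real n2 ^ 2"
    using n by (auto intro!: power_mono)
  have "real n1 * (real n1 - 1)^2 * real n2 * (real n2 - 1)^2
      \<le> real n1 * real n1 ^ 2 * real n2 * real n2 ^ 2"
    using p by (intro mult_mono mult_nonneg_nonneg) auto
  also have "\<dots> = q^3" by (simp add: power2_eq_square power3_eq_cube)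
  finally show "rho n1 n2 \<le> q^3 / N^6" unfolding rho_def by (simp add: divide_right_mono)
  show "0 < rho n1 n2" unfolding rho_def using n by (intro divide_pos_pos mult_pos_pos) auto
qed

text \<open>The fraction on the left is the order of the sixth moment of the discrepancy. In
  \<open>D\<close> the function \<open>rho\<close> of the sample sizes is at most \<open>q\<^sup>3
  / N ^ 6\<close>.\<close>

lemma inverse_D_square: "24 * odds * (N^6 / (q^3 * sr^3)) \<le> \<beta> * (1 / D^2)"
proof -
  have D2: "D^2 = sr^3 * \<beta> * rho n1 n2 / (24 * odds)" unfolding D using a by (simp add: field_simps)
  have cancel: "24 * o' * (x / (24 * o')) = x" if "4 \<le> o'" for o' x :: real using that by simp
  have "24 * odds * D^2 = sr^3 * \<beta> * rho n1 n2" unfolding D2 by (rule cancel[OF odds_bounds(1)])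
  also have "\<dots> \<le> sr^3 * \<beta> * (q^3 / N^6)"
    using rho_le(1) \<beta> real_bins(7) by (intro mult_left_mono) auto
  finally have "24 * odds * D^2 * (N^6 / (q^3 * sr^3)) \<le> sr^3 * \<beta> * (q^3 / N^6) * (N^6 / (q^3 * sr^3))"
    using real_bins by (intro mult_right_mono) auto
  also have "\<dots> = \<beta>"
  proof -
    have "s * \<beta> * (k / l) * (l / (k * s)) = \<beta>" if "0 < s" "0 < k" "0 < l" for s k l :: real using that by simp
    from this[OF real_bins_power(1-3)] show ?thesis .
  qed
  finally have "24 * odds * (N^6 / (q^3 * sr^3)) * D^2 \<le> \<beta>" by (simp only: mult_ac)
  then show ?thesis using D1 by (simp add: field_simps)
qed

text \<open>A bin factor above 1 is only possible if the first sample has at least five bins, and binning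
  means at least two points per bin.\<close>

lemma n1_ge: "10 \<le> real n1"
proof -
  have "1 / D^2 \<le> 1" using D1 by (simp add: one_le_power)
  then have "\<beta> * (1 / D^2) \<le> 1 * 1" using \<beta> by (intro mult_mono) auto
  then have "24 * odds * (N^6 / (q^3 * sr^3)) \<le> 1" using inverse_D_square by linarith
  moreover have "24 * 4 * (N^6 / (q^3 * sr^3)) \<le> 24 * odds * (N^6 / (q^3 * sr^3))"
    using odds_bounds(1) real_bins by (intro mult_right_mono mult_left_mono) auto
  ultimately have "96 * (N^6 / (q^3 * sr^3)) \<le> 1" by simp
  moreover have "96 * k \<le> l" if "96 * (k / l) \<le> 1" "0 < l" for k l :: real using that by (simp add: divide_le_eq)
  ultimately have "96 * N^6 \<le> q^3 * sr^3" using real_bins_power(4) by blast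
  also have "q^3 * sr^3 = (real s1 * real n2 * N)^3"
  proof -
    have "q * sr = real s1 * real n2 * N" unfolding real_bins(3) unfolding real_bins(1) by (simp only: mult_ac)
    then show ?thesis by (metis power_mult_distrib)
  qed
  also have "\<dots> \<le> (real s1 * N * N)^3"
    by (intro power_mono mult_right_mono mult_left_mono) auto
  also have "\<dots> = real s1 ^ 3 * N^6" by (simp add: power_mult_distrib eval_nat_numeral)
  finally have "96 \<le> real s1 ^ 3" using real_bins(5) by simp
  then have "\<not> real s1 \<le> 4" using power_mono[of "real s1" 4 3] by auto
  then have "5 \<le> s1" by linarith
  then have "5 * 2 \<le> s1 * m" using m2 by (intro mult_le_mono)
  then show ?thesis using bins by linarith
qed

lemma lam_eq: "1 / real s1 + 1 / real s2 = N^2 / (sr * q)"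
proof -
  have gen: "1 / x + 1 / y = ((x + y) * k)^2 / ((x + y) * ((x * k) * (y * k)))"
    if "0 < x" "0 < y" "0 < k" for x y k :: real
  proof -
    define z where "z = x + y"
    have z: "0 < z" using that by (simp add: z_def)
    have "(z * k)^2 / (z * ((x * k) * (y * k))) = z / (x * y)"
      using that z by (simp add: power2_eq_square)
    also have "\<dots> = 1 / x + 1 / y" using that by (simp add: z_def add_divide_distrib)
    finally show ?thesis unfolding z_def ..
  qed
  have "0 < real s1" "0 < real s2" "0 < real m" using sizes by auto
  from gen[OF this] show ?thesis unfolding real_bins(3) unfolding real_bins(1,2) .
qed

text \<open>Markov's inequality for the sixth moment of the discrepancy. The threshold exceeds \<open>1 /
  D\<close> by a tenth of the remaining distance to 1: by \<open>cube_add_ge\<close> its cube is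
  then of order \<open>1 / D\<^sup>2\<close>, and the sixth moment is of that order by
  \<open>inverse_D_square\<close>.\<close>

lemma disc_large_deviation:
  "mean Bperms (\<lambda>\<pi>. of_bool (effect * (1 / 10 + 9 / 10 * (1 / D)) < effect * disc n1 n2 (Sb \<pi>)^2)) \<le> a / 4"
proof -
  define \<tau> where "\<tau> = 1 / 10 + 9 / 10 * (1 / D)"
  have \<tau>: "0 < \<tau>" unfolding \<tau>_def using D1 by (intro add_pos_nonneg) auto
  have "mean Bperms (\<lambda>\<pi>. of_bool (effect * \<tau> < effect * disc n1 n2 (Sb \<pi>)^2))
     \<le> mean Bperms (\<lambda>\<pi>. of_bool (sqrt \<tau> < \<bar>disc n1 n2 (Sb \<pi>)\<bar>))"
  proof (rule mean_mono)
    fix \<pi>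
    have "sqrt \<tau> < \<bar>disc n1 n2 (Sb \<pi>)\<bar>" if "effect * \<tau> < effect * disc n1 n2 (Sb \<pi>)^2"
    proof -
      have "\<tau> < disc n1 n2 (Sb \<pi>)^2" using that eff(2) by (simp add: mult_less_cancel_left)
      then have "sqrt \<tau> < sqrt (disc n1 n2 (Sb \<pi>)^2)" by (rule real_sqrt_less_mono)
      then show ?thesis by simp
    qed
    then show "of_bool (effect * \<tau> < effect * disc n1 n2 (Sb \<pi>)^2)
        \<le> (of_bool (sqrt \<tau> < \<bar>disc n1 n2 (Sb \<pi>)\<bar>) :: real)" by auto
  qed
  also have "\<dots> \<le> a / 4"
  proof (rule mean_tail_le[OF perms_finite, where k = 6])
    have "mean Bperms (\<lambda>\<pi>. \<bar>disc n1 n2 (Sb \<pi>)\<bar>^6) = mean Bperms (\<lambda>\<pi>. disc n1 n2 (Sb \<pi>)^6)"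
      by (intro mean_cong) simp
    also have "\<dots> \<le> 15 / 4 * (N^2 / (sr * q))^2 / (sr - 1)"
      using mean_disc6[OF bins sizes(1,2,6)] unfolding lam_eq .
    also have "\<dots> \<le> 5 / 4 * (N^6 / (q^3 * sr^3))"
      using n real_bins(7) by (intro binned_sixth_moment_numeric) auto
    also have "\<dots> \<le> a / 4 * \<tau>^3"
    proof -
      define Y where "Y = N^6 / (q^3 * sr^3)"
      have Y: "0 \<le> Y" unfolding Y_def using real_bins by auto
      have "27 / 4 * (1 / 10) * (9 / 10 * (1 / D))^2 \<le> \<tau>^3"
        unfolding \<tau>_def using D1 by (intro cube_add_ge) auto
      then have t3: "54675 / 100000 * (1 / D^2) \<le> \<tau>^3" by (simp add: power_mult_distrib power_divide)
      have "24 * odds * Y \<le> \<beta> * (1 / D^2)" unfolding Y_def by (rule inverse_D_square)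
      also have "\<dots> \<le> 1 * (1 / D^2)" using \<beta> by (intro mult_right_mono) auto
      finally have "24 * odds * Y \<le> 1 / D^2" unfolding mult_1 .
      then have "54675 / 100000 * (24 * odds * Y) \<le> 54675 / 100000 * (1 / D^2)" by (rule mult_left_mono) simp
      then have "54675 / 100000 * (24 * odds * Y) \<le> \<tau>^3" using t3 by (rule order.trans)
      then have "a / 4 * (54675 / 100000 * (24 * odds * Y)) \<le> a / 4 * \<tau>^3"
        using a by (intro mult_left_mono) auto
      moreover have "a / 4 * (54675 / 100000 * (24 * odds * Y)) = 32805 / 10000 * ((1 - a) * Y)"
        using a by (simp add: field_simps)
      moreover have "8 / 10 * Y \<le> (1 - a) * Y" using a Y by (intro mult_right_mono) auto
      ultimately show ?thesis using Y unfolding Y_def[symmetric] by linarith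
    qed
    also have "\<tau>^3 = sqrt \<tau> ^ 6"
    proof -
      have "sqrt \<tau> ^ 6 = (sqrt \<tau> ^ 2)^3" by (simp add: power_mult[symmetric])
      then show ?thesis using \<tau> by simp
    qed
    finally show "mean Bperms (\<lambda>\<pi>. \<bar>disc n1 n2 (Sb \<pi>)\<bar>^6) \<le> a / 4 * sqrt \<tau> ^ 6" .
  qed (use a \<tau> in auto)
  finally show ?thesis unfolding \<tau>_def .
qed

text \<open>The fourth-moment threshold of the linear part is of the order of the geometric mean of the two
  first-order quantities \<open>A\<close> and \<open>rr / D\<close> of the separation threshold.
  The inequality between arithmetic and geometric mean splits it into a share of each.\<close>

lemma lin_threshold:
  "sqrt (2 / a) * (\<integral>x. sqrt (mean Bperms (\<lambda>\<pi>. (lin n1 n2 (Sb \<pi>) x)^4)) \<partial>Data)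
    \<le> (sqrt \<beta> * (727 / 1000 * (A / (3 - \<beta>)) + 82 / 100 * \<rho>))^2"
proof -
  define Y where "Y = N^3 / (q^2 * sr)"
  have Y: "0 \<le> Y" unfolding Y_def using real_bins by auto
  define E where "E = (\<integral>x. sqrt (mean Bperms (\<lambda>\<pi>. (lin n1 n2 (Sb \<pi>) x)^4)) \<partial>Data)"
  have E0: "0 \<le> E" unfolding E_def by (intro integral_nonneg_AE AE_I2 real_sqrt_ge_zero mean_nonneg) auto
  have "(\<Sum>p\<in>{..<n1 + n2}. sqrt (mean Bperms (\<lambda>\<pi>. (label_weight n1 n2 (Sb \<pi>) p)^4)))
      \<le> sqrt (N * mean Bperms (\<lambda>\<pi>. \<Sum>p\<in>{..<n1 + n2}. (label_weight n1 n2 (Sb \<pi>) p)^4))"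
    by (rule sum_L4_label_weight[OF bins sizes(1,2,6)])
  also have "\<dots> \<le> sqrt (5 * Y^2)"
  proof (rule real_sqrt_le_mono)
    have "N * mean Bperms (\<lambda>\<pi>. \<Sum>p\<in>{..<n1 + n2}. (label_weight n1 n2 (Sb \<pi>) p)^4)
      \<le> N * (64 / 27 * (3 / 2 * (N^2 / (sr * q)) / (sr - 1)) * (1 / real n1 ^ 3 + 1 / real n2 ^ 3)
      + 64 * (real n1 / N) * (1 / (real n1 ^ 3 * (real n1 - 1)^4) + 1 / (real n2 ^ 3 * (real n2 - 1)^4)))"
    proof (rule mult_left_mono)
      have "real s1 / sr = real n1 / N" unfolding real_bins(3) unfolding real_bins(1) using sizes by simp
      then show "mean Bperms (\<lambda>\<pi>. \<Sum>p\<in>{..<n1 + n2}. (label_weight n1 n2 (Sb \<pi>) p)^4)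
      \<le> 64 / 27 * (3 / 2 * (N^2 / (sr * q)) / (sr - 1)) * (1 / real n1 ^ 3 + 1 / real n2 ^ 3)
      + 64 * (real n1 / N) * (1 / (real n1 ^ 3 * (real n1 - 1)^4) + 1 / (real n2 ^ 3 * (real n2 - 1)^4))"
        using mean_label_weight4[OF bins sizes(1,2,6)] unfolding lam_eq by simp
    qed (use real_bins in auto)
    also have "\<dots> \<le> 5 * Y^2" unfolding Y_def
      using n1_ge n real_bins by (intro binned_fourth_moment_numeric) auto
    finally show "N * mean Bperms (\<lambda>\<pi>. \<Sum>p\<in>{..<n1 + n2}. (label_weight n1 n2 (Sb \<pi>) p)^4) \<le> 5 * Y^2" .
  qed
  finally have "E \<le> 12 * vmax * sqrt (5 * Y^2)"
    using lin_L4_norm_expectation(2)[OF perms_finite witness_var_le_vmax, of n1 n2 Sb] vmax_nonneg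
      mult_left_mono[of _ "sqrt (5 * Y^2)" "12 * vmax"] unfolding E_def by fastforce
  then have "E^2 \<le> (12 * vmax * sqrt (5 * Y^2))^2" using E0 by (intro power_mono)
  then have E2: "E^2 \<le> 720 * (vmax * Y)^2" by (simp add: power_mult_distrib)
  have "(sqrt (2 / a) * E)^2 = 2 * (1 / a) * E^2" using a by (simp add: power_mult_distrib)
  also have "\<dots> \<le> 2 * (5 / 4 * odds) * (720 * (vmax * Y)^2)"
    using E2 odds_bounds a by (intro mult_mono) auto
  also have "\<dots> = 1800 * (odds * (vmax * Y)^2)"
  proof -
    have "2 * (5 / 4 * o') * (720 * y) = 1800 * (o' * y)" for o' y :: real by simp
    then show ?thesis .
  qed
  finally have lhs: "(sqrt (2 / a) * E)^2 \<le> 1800 * (odds * (vmax * Y)^2)" .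
  have AR: "1152 * (3 - \<beta>) * (odds * (vmax * Y)^2) \<le> (\<beta> * (A * \<rho>))^2"
  proof -
    have A2: "\<beta> * A^2 = (3 - \<beta>) * (4 * vmax * (N / q))"
    proof -
      have "1 / real n1 + 1 / real n2 = N / q" using n by (simp add: field_simps)
      then have "\<beta> / (3 - \<beta>) * A^2 = 4 * vmax * (N / q)" using V1_eq by simp
      then show ?thesis using \<beta> by (simp add: field_simps)
    qed
    have "12 * sr / N * vmax * (24 * odds * (N^6 / (q^3 * sr^3))) \<le> rr^2 * (\<beta> * (1 / D^2))"
    proof (rule mult_mono[OF rr(2) inverse_D_square zero_le_power2])
      show "0 \<le> 24 * odds * (N^6 / (q^3 * sr^3))"
        using a by (intro mult_nonneg_nonneg divide_nonneg_nonneg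
            less_imp_le[OF real_bins_power(3)] less_imp_le[OF real_bins_power(4)]) auto
    qed
    also have "\<dots> = \<beta> * \<rho>^2" by (simp add: power_divide)
    finally have R2: "12 * sr / N * vmax * (24 * odds * (N^6 / (q^3 * sr^3))) \<le> \<beta> * \<rho>^2" .
    have "1152 * (3 - \<beta>) * (odds * (vmax * Y)^2)
       = (3 - \<beta>) * (4 * vmax * (N / q)) * (12 * sr / N * vmax * (24 * odds * (N^6 / (q^3 * sr^3))))"
    proof -
      have Y2: "(N / q) * (sr / N) * (N^6 / (q^3 * sr^3)) = Y^2"
      proof -
        have "(k / l) * (r / k) * (k^6 / (l^3 * r^3)) = (k^3 / (l^2 * r))^2" if "0 < k" "0 < l" "0 < r" for k l r :: real
          using that by (simp add: power_mult_distrib power_divide eval_nat_numeral field_simps)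
        moreover have "0 < sr" using real_bins(7) by linarith
        ultimately show ?thesis unfolding Y_def using real_bins(5,6) by blast
      qed
      have rearrange: "b * (4 * v * x) * (12 * r / k * v * (24 * o' * z)) = 1152 * b * (o' * (v^2 * (x * (r / k) * z)))"
        for b v x r k o' z :: real by (simp add: power2_eq_square)
      show ?thesis by (simp only: rearrange Y2 power_mult_distrib[of vmax Y 2])
    qed
    also have "\<dots> \<le> (\<beta> * A^2) * (\<beta> * \<rho>^2)"
      unfolding A2[symmetric] using R2 \<beta> by (intro mult_left_mono) auto
    also have "\<dots> = (\<beta> * (A * \<rho>))^2" by (simp add: power_mult_distrib power2_eq_square)
    finally show ?thesis .
  qed
  have Ar0: "0 \<le> A" "0 \<le> \<rho>" using AB_nonneg rr D1 by auto
  have "(sqrt (2 / a) * E)^2 \<le> (238 / 100 * (\<beta> * (A * \<rho>) / (3 - \<beta>)))^2"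
  proof -
    have b3: "0 < 3 - \<beta>" "3 - \<beta> \<le> 3" using \<beta> by auto
    have "1800 * (odds * (vmax * Y)^2) * (3 - \<beta>)^2 \<le> (238 / 100)^2 * (1152 * (3 - \<beta>) * (odds * (vmax * Y)^2))"
    proof -
      have gen: "1800 * x * b^2 \<le> (238 / 100)^2 * (1152 * b * x)" if "0 \<le> x" "0 \<le> b" "b \<le> 3" for x b :: real
      proof -
        have "0 \<le> x * b" using that by simp
        moreover have "(x * b) * b \<le> (x * b) * 3" using that by (intro mult_left_mono) auto
        moreover have "1800 * x * b^2 = 1800 * ((x * b) * b)" by (simp add: power2_eq_square)
        moreover have "(238 / 100)^2 * (1152 * b * x) = 65253888 / 10000 * (x * b)" by (simp add: power2_eq_square)
        ultimately show ?thesis by linarith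
      qed
      have "0 \<le> odds * (vmax * Y)^2" using odds_bounds(1) by (intro mult_nonneg_nonneg zero_le_power2) linarith
      then show ?thesis using b3 by (intro gen) auto
    qed
    also have "\<dots> \<le> (238 / 100)^2 * (\<beta> * (A * \<rho>))^2" using AR by (intro mult_left_mono) auto
    finally have "1800 * (odds * (vmax * Y)^2) \<le> (238 / 100)^2 * (\<beta> * (A * \<rho>))^2 / (3 - \<beta>)^2"
      using b3 by (simp add: le_divide_eq)
    also have "\<dots> = (238 / 100 * (\<beta> * (A * \<rho>) / (3 - \<beta>)))^2" by (simp add: power_mult_distrib power_divide)
    finally show ?thesis using lhs by linarith
  qed
  moreover have "0 \<le> 238 / 100 * (\<beta> * (A * \<rho>) / (3 - \<beta>))"
    using Ar0 \<beta> rr(1) D1 by (intro mult_nonneg_nonneg divide_nonneg_nonneg) auto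
  ultimately have "sqrt (2 / a) * E \<le> 238 / 100 * (\<beta> * (A * \<rho>) / (3 - \<beta>))" by (rule power2_le_imp_le)
  also have "\<dots> = \<beta> * (238 / 100 * ((A / (3 - \<beta>)) * \<rho>))"
  proof -
    have "238 / 100 * (\<beta> * (A * y) / z) = \<beta> * (238 / 100 * ((A / z) * y))" for y z :: real by simp
    then show ?thesis .
  qed
  also have "\<dots> \<le> \<beta> * (727 / 1000 * (A / (3 - \<beta>)) + 82 / 100 * \<rho>)^2"
  proof (rule mult_left_mono)
    \<comment> \<open>four times the product of 727/1000 and 82/100 exceeds 238/100\<close>
    have amgm: "238 / 100 * (u * v) \<le> (727 / 1000 * u + 82 / 100 * v)^2" if "0 \<le> u" "0 \<le> v" for u v :: real
    proof -
      have "(727 / 1000 * u + 82 / 100 * v)^2 - 238 / 100 * (u * v)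
          = (727 / 1000 * u - 82 / 100 * v)^2 + (4 * (727 / 1000) * (82 / 100) - 238 / 100) * (u * v)"
        by (simp add: power2_eq_square algebra_simps)
      moreover have "0 \<le> (4 * (727 / 1000) * (82 / 100) - 238 / 100) * (u * v)" using that by simp
      moreover have "0 \<le> (727 / 1000 * u - 82 / 100 * v)^2" by simp
      ultimately show ?thesis by linarith
    qed
    show "238 / 100 * (A / (3 - \<beta>) * \<rho>) \<le> (727 / 1000 * (A / (3 - \<beta>)) + 82 / 100 * \<rho>)^2"
      using Ar0 \<beta> by (intro amgm) auto
  qed (use \<beta> in auto)
  also have "\<dots> = (sqrt \<beta> * (727 / 1000 * (A / (3 - \<beta>)) + 82 / 100 * \<rho>))^2"
    using \<beta> by (simp add: power_mult_distrib)
  finally show ?thesis unfolding E_def .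
qed

text \<open>A permuted statistic can reach the observed one only if its signal, its linear part or its
  degenerate part is large. Each of the three has its own moment bound over permutations (sixth,
  fourth and second), and the level \<open>a\<close> is divided as a quarter, a half and a
  quarter. The first threshold is deterministic; the other two depend on the data and are
  controlled in mean square.\<close>

lemma binned_tail: "measure Data {x \<in> space Data. a < pval x} \<le> 5 / 6 * \<beta>"
proof -
  interpret PM: prob_space Data by (rule two_sample_prob)
  define L4 where "L4 x = mean Bperms (\<lambda>\<pi>. (lin n1 n2 (Sb \<pi>) x)^4)" for x
  define Q2 where "Q2 x = mean Bperms (\<lambda>\<pi>. (quad n1 n2 (Sb \<pi>) x)^2)" for x
  define t2 where "t2 x = sqrt (sqrt (2 / a) * sqrt (L4 x))" for x
  define t3 where "t3 x = sqrt (4 / a * Q2 x)" for x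
  \<comment> \<open>keeps nine tenths of the gap between the effect and \<open>effect / D\<close>\<close>
  define t where "t = effect * (1 / 10 + 9 / 10 * (1 / D))"
  \<comment> \<open>the optimal shift in Cantelli's trick is variance over gap, here \<open>\<beta> / (3 - \<beta>)
    * A\<close> up to a constant\<close>
  define u where "u = 9 / 10 * (\<beta> / (3 - \<beta>) * A)"
  define w2 where "w2 = sqrt \<beta> * (727 / 1000 * (A / (3 - \<beta>)) + 82 / 100 * \<rho>)"
  \<comment> \<open>53/100 exceeds the square root of 5/18, which comes from \<open>N2_le\<close> with the factor 5\<close>
  define w3 where "w3 = 53 / 100 * (sqrt \<beta> * Bq)"
  have nonneg: "0 \<le> L4 x" "0 \<le> Q2 x" for x unfolding L4_def Q2_def by (auto intro: mean_nonneg)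
  have t0: "0 \<le> t2 x" "0 \<le> t3 x" for x unfolding t2_def t3_def using nonneg a by auto
  have t2sq: "(t2 x)^2 = sqrt (2 / a) * sqrt (L4 x)" for x unfolding t2_def using nonneg a by simp
  have t3sq: "(t3 x)^2 = 4 / a * Q2 x" for x unfolding t3_def using nonneg a by simp
  have [measurable]: "L4 \<in> borel_measurable Data" "Q2 \<in> borel_measurable Data"
    unfolding L4_def Q2_def by (intro lin_quad_mean_measurable; measurable)+
  have [measurable]: "t2 \<in> borel_measurable Data" "t3 \<in> borel_measurable Data"
    unfolding t2_def t3_def by measurable
  have b3: "0 < 3 - \<beta>" using \<beta> by simp
  have A0: "0 \<le> A / (3 - \<beta>)" "0 \<le> \<rho>" "0 \<le> u" using AB_nonneg b3 rr D1 \<beta> unfolding u_def by auto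
  have w: "0 \<le> w2" "0 \<le> w3" unfolding w2_def w3_def using A0 AB_nonneg \<beta> by auto
  have i2: "integrable Data (\<lambda>x. (t2 x)^2)"
    unfolding t2sq L4_def by (intro integrable_mult_right lin_L4_norm_expectation(1)[OF perms_finite witness_var_le_vmax])
  have e2: "(\<integral>x. (t2 x)^2 \<partial>Data) \<le> w2^2"
    using lin_threshold unfolding t2sq L4_def w2_def integral_mult_right_zero .
  have i3: "integrable Data (\<lambda>x. (t3 x)^2)"
    unfolding t3sq Q2_def by (intro integrable_mult_right mean_integral(1) quad_square(1))
  have e3: "(\<integral>x. (t3 x)^2 \<partial>Data) \<le> w3^2"
  proof -
    have "(\<integral>x. (t3 x)^2 \<partial>Data) = 4 / a * mean Bperms (\<lambda>\<pi>. \<integral>x. (quad n1 n2 (Sb \<pi>) x)^2 \<partial>Data)"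
      unfolding t3sq Q2_def integral_mult_right_zero by (subst mean_integral(2)[OF quad_square(1)]) simp_all
    also have "\<dots> \<le> 4 / a * mean Bperms (\<lambda>\<pi>. N2)"
    proof (intro mult_left_mono mean_mono)
      fix \<pi> assume \<pi>: "\<pi> \<in> Bperms"
      show "(\<integral>x. (quad n1 n2 (Sb \<pi>) x)^2 \<partial>Data) \<le> N2"
        using quad_square(2)[of n1 n2 "Sb \<pi>"] unfolding coef_square_sum[OF sizes(1,2) split_ok[OF \<pi>]] .
    qed (use a in auto)
    also have "\<dots> = 4 * (1 / a) * N2" using perms_finite by (simp add: mean_const)
    also have "\<dots> \<le> 4 * (5 / 4 * odds) * N2"
      using odds_bounds(2) N2_nonneg by (intro mult_right_mono mult_left_mono) auto
    also have "\<dots> = 5 * (odds * N2)" by (simp only: mult_ac) simp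
    also have "\<dots> \<le> 5 * (\<beta> * Bq^2 / 18)" using N2_le(1) by (intro mult_left_mono) auto
    also have "\<dots> \<le> 2809 / 10000 * (\<beta> * Bq^2)"
    proof -
      have "0 \<le> \<beta> * Bq^2" using \<beta> by simp
      then show ?thesis by linarith
    qed
    also have "\<dots> = w3^2" using \<beta> unfolding w3_def by (simp add: power_mult_distrib power_divide)
    finally show ?thesis .
  qed
  have gap: "9 / 10 * (A + Bq + \<rho>) \<le> effect - t"
  proof -
    have e: "effect - t = 9 / 10 * (effect * (1 - 1 / D))" unfolding t_def by (simp add: algebra_simps)
    show ?thesis unfolding e by (rule mult_left_mono[OF eff(1)]) simp
  qed
  have gap_pos: "0 < effect - t"
  proof -
    have "effect - t = 9 / 10 * (effect * (1 - 1 / D))" unfolding t_def by (simp add: algebra_simps)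
    moreover have "0 < effect * (1 - 1 / D)" using eff(2) D1 by simp
    ultimately show ?thesis by linarith
  qed
  show ?thesis
  proof (rule tail_bound[where W = "\<lambda>x. t2 x + t3 x" and w = "w2 + w3" and u = u and t = t])
    show "(\<lambda>x. t2 x + t3 x) \<in> borel_measurable Data" by measurable
    show "integrable Data (\<lambda>x. (t2 x + t3 x)^2)" using i2 i3 by (intro integrable_square_add) auto
    show "(\<integral>x. (t2 x + t3 x)^2 \<partial>Data) \<le> (w2 + w3)^2"
      using i2 i3 e2 e3 w by (intro PM.square_sum_expectation_le) auto
    show "0 \<le> w2 + w3" using w by simp
    show "0 < effect - t + u" using gap_pos A0(3) by linarith
    show "0 \<le> 5 / 6 * \<beta>" using \<beta> by simp
    show "sqrt (V1 + N2 + u^2) + (w2 + w3) \<le> sqrt (5 / 6 * \<beta>) * (effect - t + u)"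
    proof -
      define A' where "A' = sqrt \<beta> * (A / (3 - \<beta>))"
      define B' where "B' = sqrt \<beta> * Bq"
      define R' where "R' = sqrt \<beta> * \<rho>"
      have pos: "0 \<le> A'" "0 \<le> B'" "0 \<le> R'" unfolding A'_def B'_def R'_def
        using A0 AB_nonneg \<beta> by (intro mult_nonneg_nonneg real_sqrt_ge_zero; linarith)+
      \<comment> \<open>1733/1000 exceeds the square root of 3\<close>
      have V: "V1 + u^2 \<le> (1733 / 1000 * A')^2"
      proof -
        define y where "y = A / (3 - \<beta>)"
        have Ay: "A = (3 - \<beta>) * y" using b3 by (simp add: y_def)
        have v: "V1 = \<beta> * (3 - \<beta>) * y^2"
          unfolding V1_eq Ay using b3 by (simp add: power2_eq_square)
        have uy: "u = 9 / 10 * (\<beta> * y)" unfolding u_def y_def by simp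
        have "V1 + u^2 = (\<beta> * y^2) * (3 - 19 / 100 * \<beta>)"
          unfolding v uy by (simp add: power2_eq_square algebra_simps)
        also have "\<dots> \<le> (\<beta> * y^2) * (1733 / 1000)^2"
          using \<beta> by (intro mult_left_mono) (auto simp: power2_eq_square)
        also have "\<dots> = (1733 / 1000 * A')^2"
          using \<beta> unfolding A'_def y_def[symmetric] by (simp add: power_mult_distrib power_divide)
        finally show ?thesis .
      qed
      then have sV: "sqrt (V1 + u^2) \<le> 1733 / 1000 * A'" using pos by (intro real_le_lsqrt) auto
      have w2': "w2 = 727 / 1000 * A' + 82 / 100 * R'"
        unfolding w2_def A'_def R'_def by (simp add: algebra_simps)
      have w3': "w3 = 53 / 100 * B'" unfolding w3_def B'_def ..
      have "sqrt (V1 + N2 + u^2) + (w2 + w3) \<le> 82 / 100 * (3 * A' + B' + R')"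
      proof -
        have "v + (727 / 1000 * A' + 82 / 100 * R' + 53 / 100 * B') \<le> 82 / 100 * (3 * A' + B' + R')"
          if "v \<le> x + y" "x \<le> 1733 / 1000 * A'" "y \<le> 12 / 100 * B'" for v x y :: real
          using that pos by argo
        from this[OF sqrt_sum3_le[OF V1_nonneg N2_nonneg zero_le_power2] sV N2_le(2)[folded B'_def]]
        show ?thesis unfolding w2' w3' .
      qed
      also have "\<dots> \<le> sqrt (5 / 6) * (sqrt \<beta> * (effect - t + u))"
      proof -
        \<comment> \<open>nine tenths of 912/1000 still exceed 82/100\<close>
        have c: "912 / 1000 \<le> sqrt (5 / 6)" by (rule real_le_rsqrt) (simp add: power2_eq_square)
        have "9 / 10 * (3 * (A / (3 - \<beta>)) + Bq + \<rho>) \<le> effect - t + u"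
        proof -
          have "A + \<beta> / (3 - \<beta>) * A = 3 * (A / (3 - \<beta>))" using b3 by (simp add: field_simps)
          moreover have "9 / 10 * (z + b + r) \<le> e + 9 / 10 * y" if "x + y = z" "9 / 10 * (x + b + r) \<le> e"
            for x y z b r e :: real using that by argo
          ultimately show ?thesis using gap unfolding u_def by blast
        qed
        then have "sqrt \<beta> * (9 / 10 * (3 * (A / (3 - \<beta>)) + Bq + \<rho>)) \<le> sqrt \<beta> * (effect - t + u)"
          using \<beta> by (intro mult_left_mono) auto
        moreover have "sqrt \<beta> * (9 / 10 * (3 * (A / (3 - \<beta>)) + Bq + \<rho>)) = 9 / 10 * (3 * A' + B' + R')"
          unfolding A'_def B'_def R'_def by (simp add: algebra_simps)
        ultimately have le: "9 / 10 * (3 * A' + B' + R') \<le> sqrt \<beta> * (effect - t + u)" by (simp only:)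
        have sum0: "0 \<le> 3 * A' + B' + R'" using pos by simp
        have "912 / 1000 * (9 / 10 * (3 * A' + B' + R')) \<le> sqrt (5 / 6) * (sqrt \<beta> * (effect - t + u))"
          by (rule mult_mono[OF c le]) (use sum0 in simp_all)
        moreover have "82 / 100 * y \<le> z" if "0 \<le> y" "912 / 1000 * (9 / 10 * y) \<le> z" for y z :: real
          using that by argo
        ultimately show ?thesis using sum0 by blast
      qed
      also have "\<dots> = sqrt (5 / 6 * \<beta>) * (effect - t + u)" by (simp only: real_sqrt_mult mult.assoc)
      finally show ?thesis .
    qed
    fix x assume x: "x \<in> space Data" and lt: "t + (t2 x + t3 x) < effect + lin n1 n2 I0 x + quad n1 n2 I0 x"
    have "pval x \<le> mean Bperms (\<lambda>\<pi>. of_bool (t < effect * disc n1 n2 (Sb \<pi>)^2)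
        + (of_bool (t2 x < lin n1 n2 (Sb \<pi>) x) + of_bool (t3 x < quad n1 n2 (Sb \<pi>) x)))"
    proof (rule mean_mono)
      fix \<pi> assume \<pi>: "\<pi> \<in> Bperms"
      have le: "split_stat g n1 n2 (Sb \<pi>) x \<le> effect * disc n1 n2 (Sb \<pi>)^2 + lin n1 n2 (Sb \<pi>) x + quad n1 n2 (Sb \<pi>) x"
        using eff(2) by (intro split_stat_le[OF sizes(1,2) split_ok[OF \<pi>]]) simp
      have "t < effect * disc n1 n2 (Sb \<pi>)^2 \<or> t2 x < lin n1 n2 (Sb \<pi>) x \<or> t3 x < quad n1 n2 (Sb \<pi>) x"
        if "effect + lin n1 n2 I0 x + quad n1 n2 I0 x \<le> split_stat g n1 n2 (Sb \<pi>) x"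
        using that le lt by linarith
      then show "of_bool (effect + lin n1 n2 I0 x + quad n1 n2 I0 x \<le> split_stat g n1 n2 (Sb \<pi>) x)
          \<le> (of_bool (t < effect * disc n1 n2 (Sb \<pi>)^2)
        + (of_bool (t2 x < lin n1 n2 (Sb \<pi>) x) + of_bool (t3 x < quad n1 n2 (Sb \<pi>) x)) :: real)"
        by (auto simp: of_bool_def)
    qed
    also have "\<dots> \<le> a / 4 + (a / 2 + a / 4)"
      unfolding mean_add
    proof (intro add_mono)
      show "mean Bperms (\<lambda>\<pi>. of_bool (t < effect * disc n1 n2 (Sb \<pi>)^2)) \<le> a / 4"
        unfolding t_def by (rule disc_large_deviation)
      show "mean Bperms (\<lambda>\<pi>. of_bool (t2 x < lin n1 n2 (Sb \<pi>) x)) \<le> a / 2"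
      proof (rule mean_tail_le[OF perms_finite, where k = 4])
        have "(t2 x)^4 = ((t2 x)^2)^2" by simp
        also have "\<dots> = 2 / a * L4 x" unfolding t2sq using a nonneg by (simp add: power_mult_distrib)
        finally show "mean Bperms (\<lambda>\<pi>. (lin n1 n2 (Sb \<pi>) x)^4) \<le> a / 2 * (t2 x)^4"
          using a unfolding L4_def by simp
      qed (use a t0 in auto)
      show "mean Bperms (\<lambda>\<pi>. of_bool (t3 x < quad n1 n2 (Sb \<pi>) x)) \<le> a / 4"
      proof (rule mean_tail_le[OF perms_finite, where k = 2])
        show "mean Bperms (\<lambda>\<pi>. (quad n1 n2 (Sb \<pi>) x)^2) \<le> a / 4 * (t3 x)^2"
          using a unfolding t3sq Q2_def by simp
      qed (use a t0 in auto)
    qed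
    finally show "pval x \<le> a" by simp
  qed
qed

end

end

end

end

section \<open>Power of the test\<close>

theorem theorem1:
  fixes P Q :: "'a measure" and g :: "'a \<Rightarrow> 'a \<Rightarrow> real"
    and \<alpha> \<beta> :: real and n1 n2 s B :: nat
  assumes "prob_space P" and "prob_space Q" and "sets Q = sets P"
    and "(\<lambda>(x, y). g x y) \<in> borel_measurable (P \<Otimes>\<^sub>M P)"
    and "\<And>x y. x \<in> space P \<Longrightarrow> y \<in> space P \<Longrightarrow> g x y = g y x"
    and "0 < \<alpha>" "\<alpha> < 1" and "0 < \<beta>" "\<beta> < 1"
    and "4 \<le> n1" and "n1 \<le> n2"
    and "4 \<le> s" and "s dvd n1 + n2" and "n1 + n2 dvd s * n1"
    and "real B \<ge> 1 / \<alpha> - 1"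
    and "finite_psi P Q g"
    and nondegenerate: "0 < psi_YZ2 P Q g"
    and positive_denominator: "s < n1 + n2 \<Longrightarrow> 1 < bin_factor \<alpha> \<beta> B n1 n2 s"
    and "expected_U P Q g n1 n2 \<ge> gamma_cheap P Q g \<alpha> \<beta> B n1 n2 s"
  shows "cheap_test_power (U_ho n1 n2 g) P Q n1 n2 s B \<alpha> \<ge> 1 - \<beta>"
proof -
  interpret two_sample_kernel P Q g using assms(1-5,16) by (rule two_sample_kernel.intro)
  note ab = \<open>0 < \<alpha>\<close> \<open>\<alpha> < 1\<close> \<open>0 < \<beta>\<close> \<open>\<beta> < 1\<close> and n = \<open>4 \<le> n1\<close> \<open>n1 \<le> n2\<close>
  have n': "2 \<le> n1" "2 \<le> n2" using n by auto
  have B: "1 \<le> \<alpha> * (real B + 1)" using \<open>real B \<ge> 1 / \<alpha> - 1\<close> ab by (simp add: field_simps)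
  obtain m where m: "n1 + n2 = s * m" using \<open>s dvd n1 + n2\<close> by (rule dvdE)
  obtain s1 where "s * n1 = (n1 + n2) * s1" using \<open>n1 + n2 dvd s * n1\<close> by (rule dvdE)
  then have bin1: "n1 = s1 * m" using \<open>4 \<le> s\<close> unfolding m by (simp add: mult.commute)
  have "0 < m" using m n by (auto intro: Nat.gr0I)
  have "s1 * m \<le> s * m" using m bin1 by linarith
  then have "s1 \<le> s" using \<open>0 < m\<close> by simp
  then obtain s2 where s: "s = s1 + s2" using le_Suc_ex by blast
  have bin2: "n2 = s2 * m" using m bin1 unfolding s by (simp add: add_mult_distrib)
  note bins = bin1 bin2
  have s4: "4 \<le> s1 + s2" using \<open>4 \<le> s\<close> s by simp
  define a where "a = alpha_star \<alpha> \<beta> B"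
  have a: "0 < a" "a \<le> 1 / 5" unfolding a_def by (rule alpha_star_bounds[OF ab B])+
  define A where "A = sqrt ((3 - \<beta>) / \<beta> * (4 * vmax / real n1 + 4 * vmax / real n2))"
  define Bq where "Bq = sqrt ((1 - a) / a * ((36 * real n1 ^ 2 + 36 * real n2 ^ 2 + 198 * real n1 * real n2) * psi_YZ2 P Q g
        / (\<beta> * real n1 * (real n1 - 1) * real n2 * (real n2 - 1))))"
  have psi: "psi_Y1 P Q g = vmax" "psi_Z1 P Q g = vmax"
    unfolding psi_Y1_eq psi_Z1_eq vmax_def by (rule refl)+
  have full: "gamma_full P Q g \<alpha> \<beta> B n1 n2 = A + Bq"
    unfolding gamma_full_def psi A_def Bq_def a_def ..
  have "0 \<le> A" unfolding A_def using ab vmax_nonneg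
    by (intro real_sqrt_ge_zero mult_nonneg_nonneg add_nonneg_nonneg divide_nonneg_nonneg) auto
  moreover have "0 < Bq" unfolding Bq_def using ab a nondegenerate n
    by (intro real_sqrt_gt_zero mult_pos_pos divide_pos_pos add_pos_pos) auto
  ultimately have \<gamma>: "0 < A + Bq" by linarith
  have large: "gamma_cheap P Q g \<alpha> \<beta> B n1 n2 s \<le> effect"
    using assms(19) unfolding expected_U_eq_effect[OF n'] .
  show ?thesis unfolding s
  proof (rule cheap_power_ge[OF n' bins ab(1,3) B, folded a_def])
    show "measure (two_sample P Q n1 n2) {x \<in> space (two_sample P Q n1 n2).
      a < mean {\<pi>. \<pi> permutes {..<s1 + s2}}
        (\<lambda>\<pi>. of_bool (effect + lin n1 n2 {..<n1} x + quad n1 n2 {..<n1} x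
          \<le> split_stat g n1 n2 (bin_split n1 m \<pi>) x))} \<le> 5 / 6 * \<beta>"
    proof (cases "s < n1 + n2")
      case False
      have "m = 1"
      proof (rule ccontr)
        assume "m \<noteq> 1"
        with \<open>0 < m\<close> have "s * 2 \<le> s * m" by (intro mult_left_mono) auto
        then show False using False m \<open>4 \<le> s\<close> by linarith
      qed
      moreover have "A + Bq \<le> effect" using large False unfolding gamma_cheap_def full by simp
      ultimately show ?thesis
        using \<gamma> by (intro unbinned_tail[OF n bins s4 a ab(3,4) A_def Bq_def]) auto
    next
      case True
      define D where "D = bin_factor \<alpha> \<beta> B n1 n2 s"
      define r where "r = sqrt (201 * real s ^ 2 / (4 * real (n1 + n2) ^ 2) * psi_YZ2 P Q g +
               12 * real s / real (n1 + n2) * vmax)"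
      have D1: "1 < D" unfolding D_def by (rule positive_denominator[OF True])
      have m2: "2 \<le> m"
      proof (rule ccontr)
        assume "\<not> 2 \<le> m"
        then have "m = 1" using \<open>0 < m\<close> by simp
        then show False using True m by simp
      qed
      have "0 \<le> real s ^ 3 * (\<beta> * a / (24 * (1 - a))) * rho n1 n2"
        unfolding rho_def using ab a n by (intro mult_nonneg_nonneg divide_nonneg_nonneg) auto
      then have D2: "D^2 = (real s1 + real s2)^3 * (\<beta> * a / (24 * (1 - a))) * rho n1 n2"
        unfolding D_def bin_factor_def a_def[symmetric] unfolding s by simp
      have parts: "0 \<le> 201 * real s ^ 2 / (4 * real (n1 + n2) ^ 2) * psi_YZ2 P Q g"
        "0 \<le> 12 * real s / real (n1 + n2) * vmax"
        using psi_YZ2_nonneg vmax_nonneg by (intro mult_nonneg_nonneg divide_nonneg_nonneg; simp)+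
      have r0: "0 \<le> r" unfolding r_def using parts by (intro real_sqrt_ge_zero) linarith
      have "r^2 = 201 * real s ^ 2 / (4 * real (n1 + n2) ^ 2) * psi_YZ2 P Q g + 12 * real s / real (n1 + n2) * vmax"
        unfolding r_def using parts by (intro real_sqrt_pow2) linarith
      then have "12 * real s / real (n1 + n2) * vmax \<le> r^2" using parts by linarith
      then have r2: "12 * (real s1 + real s2) / (real n1 + real n2) * vmax \<le> r^2" unfolding s by simp
      have ge: "(A + Bq) + (A + Bq + r) / (D - 1) \<le> effect"
        using large True unfolding gamma_cheap_def full psi max.idem D_def[symmetric] r_def[symmetric] by simp
      have "0 \<le> (A + Bq + r) / (D - 1)" using \<gamma> r0 D1 by (intro divide_nonneg_nonneg) linarith+
      then have "0 < effect" using ge \<gamma> by linarith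
      have "A + Bq + r / D \<le> effect * (1 - 1 / D)"
      proof -
        have "((A + Bq) + (A + Bq + r) / (D - 1)) * (D - 1) \<le> effect * (D - 1)"
          using ge D1 by (intro mult_right_mono) auto
        moreover have "((A + Bq) + (A + Bq + r) / (D - 1)) * (D - 1) = (A + Bq) * D + r"
        proof -
          have "(x + (x + r) / y) * y = x * (y + 1) + r" if "0 < y" for x y :: real
            using that by (simp add: field_simps)
          from this[of "D - 1" "A + Bq"] show ?thesis using D1 by (simp only: diff_gt_0_iff_gt diff_add_cancel)
        qed
        ultimately have "(A + Bq) * D + r \<le> effect * (D - 1)" by linarith
        then have "((A + Bq) * D + r) / D \<le> effect * (D - 1) / D" using D1 by (intro divide_right_mono) auto
        moreover have "(x * d + y) / d = x + y / d" "e * (d - 1) / d = e * (1 - 1 / d)" if "1 < d" for x y d e :: real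
          using that by (simp_all add: field_simps)
        ultimately show ?thesis using D1 by metis
      qed
      then show ?thesis
        using \<open>0 < effect\<close> by (intro binned_tail[OF n bins s4 a ab(3,4) A_def Bq_def m2 D1 D2 r0 r2])
    qed
  qed
qed

end
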